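(* Let $n \geq 3$ and $d \geq 3$ be integers. Then the dual hypersurface $V^{\vee}$ of a generic hypersurface $V \subset \mathbb{P}^n$ of degree $d$ has at least one normal crossing singularity of multiplicity $n$. Explicitly: there is a Zariski open and dense subset $U \subset \mathbb{P}(S_d)$, consisting of classes of polynomials $f$ with $V(f)$ smooth, such that for every $f \in U$ there is a point of $V(f)^{\vee}$ at which $V(f)^{\vee}$ has a normal crossing singularity of multiplicity $n$.
   Context: We work over $\mathbb{C}$. $S=\mathbb{C}[x_0,\ldots,x_n]$ is the graded polynomial ring, $S_d$ is its space of homogeneous polynomials of degree $d$, and $\mathbb{P}(S_d)$ is the associated projective space, which parametrizes the degree $d$ hypersurfaces $V(f): f=0$ in $\mathbb{P}^n=\mathbb{P}^n_{\mathbb{C}}$. A property is generic if it holds for a Zariski open and dense subset of $\mathbb{P}(S_d)$. For $V(f)$ smooth, the dual mapping is $$\phi_f: V(f) \to (\mathbb{P}^n)^{\vee}, \quad x \mapsto (f_0(x): f_1(x): \ldots : f_n(x)), \qquad f_j= \frac{\partial f}{\partial x_j},$$ where $(\mathbb{P}^n)^{\vee}$ is the dual projective space (whose points are the hyperplanes of $\mathbb{P}^n$), and the dual hypersurface is its image $V(f)^{\vee} = \phi_f(V(f))$, with its reduced structure. A hypersurface in an $n$-dimensional complex manifold has a normal crossing singularity of multiplicity $n$ at a point if its analytic germ there is the union of $n$ smooth hypersurface germs whose tangent hyperplanes at the point are given by $n$ linearly independent linear forms. *)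

theory Defs
  imports "HOL-Analysis.Analysis" "HOL-Library.Poly_Mapping"
begin

section \<open>Complex polynomials in variables indexed by a type\<close>

type_synonym 'v cpoly = "('v \<Rightarrow>\<^sub>0 nat) \<Rightarrow>\<^sub>0 complex"

definition monom_degree :: "('v \<Rightarrow>\<^sub>0 nat) \<Rightarrow> nat" where
  "monom_degree m = (\<Sum>v\<in>Poly_Mapping.keys m. Poly_Mapping.lookup m v)"

definition homogeneous :: "nat \<Rightarrow> 'v cpoly \<Rightarrow> bool" where
  "homogeneous d p \<longleftrightarrow> (\<forall>m\<in>Poly_Mapping.keys p. monom_degree m = d)"

definition monom_eval :: "('v \<Rightarrow> complex) \<Rightarrow> ('v \<Rightarrow>\<^sub>0 nat) \<Rightarrow> complex" where
  "monom_eval a m = (\<Prod>v\<in>Poly_Mapping.keys m. a v ^ Poly_Mapping.lookup m v)"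

definition cpoly_eval :: "('v \<Rightarrow> complex) \<Rightarrow> 'v cpoly \<Rightarrow> complex" where
  "cpoly_eval a p = (\<Sum>m\<in>Poly_Mapping.keys p. Poly_Mapping.lookup p m * monom_eval a m)"

definition cpoly_scale :: "complex \<Rightarrow> 'v cpoly \<Rightarrow> 'v cpoly" where
  "cpoly_scale c = Poly_Mapping.map ((*) c)"

text \<open>Subtraction of exponents truncates, but only in terms whose coefficient is 0.\<close>

definition partial_deriv :: "'v \<Rightarrow> 'v cpoly \<Rightarrow> 'v cpoly" where
  "partial_deriv j p =
    (\<Sum>m\<in>Poly_Mapping.keys p.
      Poly_Mapping.single (m - Poly_Mapping.single j 1)
        (of_nat (Poly_Mapping.lookup m j) * Poly_Mapping.lookup p m))"

definition forms :: "nat \<Rightarrow> 'v cpoly set" where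
  "forms d = {p. homogeneous d p}"

lemma monom_eval_superset:
  assumes "finite A" "Poly_Mapping.keys m \<subseteq> A"
  shows "monom_eval a m = (\<Prod>v\<in>A. a v ^ Poly_Mapping.lookup m v)"
  unfolding monom_eval_def
  by (rule prod.mono_neutral_left) (use assms in \<open>auto simp: in_keys_iff\<close>)

lemma monom_degree_superset:
  assumes "finite A" "Poly_Mapping.keys m \<subseteq> A"
  shows "monom_degree m = (\<Sum>v\<in>A. Poly_Mapping.lookup m v)"
  unfolding monom_degree_def
  by (rule sum.mono_neutral_left) (use assms in \<open>auto simp: in_keys_iff\<close>)

lemma cpoly_eval_superset:
  assumes "finite A" "Poly_Mapping.keys p \<subseteq> A"
  shows "cpoly_eval a p = (\<Sum>m\<in>A. Poly_Mapping.lookup p m * monom_eval a m)"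
  unfolding cpoly_eval_def
  by (rule sum.mono_neutral_left) (use assms in \<open>auto simp: in_keys_iff\<close>)

lemma monom_eval_add: "monom_eval a (m + m') = monom_eval a m * monom_eval a m'"
proof -
  let ?A = "Poly_Mapping.keys m \<union> Poly_Mapping.keys m'"
  have "Poly_Mapping.keys (m + m') \<subseteq> ?A"
    by (rule keys_add)
  then show ?thesis
    by (simp add: monom_eval_superset[of ?A] lookup_add power_add prod.distrib)
qed

lemma monom_degree_add: "monom_degree (m + m') = monom_degree m + monom_degree m'"
proof -
  let ?A = "Poly_Mapping.keys m \<union> Poly_Mapping.keys m'"
  have "Poly_Mapping.keys (m + m') \<subseteq> ?A"
    by (rule keys_add)
  then show ?thesis
    by (simp add: monom_degree_superset[of ?A] lookup_add sum.distrib)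
qed

lemma cpoly_eval_zero [simp]: "cpoly_eval a 0 = 0"
  by (simp add: cpoly_eval_def)

lemma cpoly_eval_single [simp]: "cpoly_eval a (Poly_Mapping.single m c) = c * monom_eval a m"
  by (cases "c = 0") (auto simp: cpoly_eval_def)

lemma cpoly_eval_add: "cpoly_eval a (p + q) = cpoly_eval a p + cpoly_eval a q"
proof -
  let ?A = "Poly_Mapping.keys p \<union> Poly_Mapping.keys q"
  have "Poly_Mapping.keys (p + q) \<subseteq> ?A"
    by (rule keys_add)
  then show ?thesis
    by (simp add: cpoly_eval_superset[of ?A] lookup_add ring_distribs sum.distrib)
qed

lemma cpoly_eval_mult: "cpoly_eval a (p * q) = cpoly_eval a p * cpoly_eval a q"
proof (induction p rule: update_induct)
  case const
  then show ?case by simp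
next
  case (update p m c)
  have upd: "Poly_Mapping.update m c p = Poly_Mapping.single m c + p"
    using update.hyps
    by (intro poly_mapping_eqI) (auto simp: lookup_update lookup_add lookup_single in_keys_iff when_def)
  have *: "cpoly_eval a (Poly_Mapping.single m c * q) = c * monom_eval a m * cpoly_eval a q"
  proof (induction q rule: update_induct)
    case const
    then show ?case by simp
  next
    case (update q m' c')
    have "Poly_Mapping.update m' c' q = Poly_Mapping.single m' c' + q"
      using update.hyps
      by (intro poly_mapping_eqI) (auto simp: lookup_update lookup_add lookup_single in_keys_iff when_def)
    then show ?case
      using update.IH
      by (simp add: distrib_left mult_single cpoly_eval_add monom_eval_add)
  qed
  show ?case
    unfolding upd using update.IH by (simp add: distrib_right cpoly_eval_add *)
qed

lemma homogeneous_mult: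
  assumes "homogeneous d p" "homogeneous e q"
  shows "homogeneous (d + e) (p * q)"
  using assms keys_mult[of p q] by (fastforce simp: homogeneous_def monom_degree_add)

lemma cpoly_eval_homogeneous_scale:
  assumes "homogeneous d p"
  shows "cpoly_eval (\<lambda>v. c * a v) p = c ^ d * cpoly_eval a p"
proof -
  have "monom_eval (\<lambda>v. c * a v) m = c ^ d * monom_eval a m" if "m \<in> Poly_Mapping.keys p" for m
    using that assms
    by (auto simp: monom_eval_def homogeneous_def monom_degree_def power_mult_distrib
        prod.distrib power_sum)
  then show ?thesis
    by (simp add: cpoly_eval_def sum_distrib_left mult_ac)
qed

lemma lookup_cpoly_scale [simp]:
  "Poly_Mapping.lookup (cpoly_scale c p) m = c * Poly_Mapping.lookup p m"
  by (simp add: cpoly_scale_def map.rep_eq when_def)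


section \<open>Projective spaces\<close>

text \<open>A point of the projective space of a vector space is the set of all nonzero multiples of a
  nonzero vector. The scalar multiplication is a parameter, so that the same definition applies to
  coordinate vectors and to polynomials.\<close>

definition proj_class :: "(complex \<Rightarrow> 'a \<Rightarrow> 'a) \<Rightarrow> 'a \<Rightarrow> 'a set" where
  "proj_class smul x = {smul c x | c. c \<noteq> 0}"

definition proj_space :: "(complex \<Rightarrow> 'a \<Rightarrow> 'a) \<Rightarrow> 'a::zero set \<Rightarrow> 'a set set" where
  "proj_space smul V = proj_class smul ` (V - {0})"

abbreviation vec_class :: "complex^'m \<Rightarrow> (complex^'m) set" where
  "vec_class \<equiv> proj_class (*s)"

text \<open>The space of homogeneous coordinate tuples indexed by \<open>'m\<close>; its dimension is
  \<open>CARD('m) - 1\<close>.\<close>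

abbreviation coord_proj_space :: "(complex^'m) set set" where
  "coord_proj_space \<equiv> proj_space (*s) UNIV"

abbreviation proj_forms :: "nat \<Rightarrow> 'v cpoly set set" where
  "proj_forms d \<equiv> proj_space cpoly_scale (forms d)"


section \<open>The Zariski topology on the projective space of forms\<close>

text \<open>The homogeneous coordinates of the class of \<open>f\<close> are the coefficients of \<open>f\<close>, so a polynomial
  in these coordinates has monomials as its variables. Variables belonging to monomials of degree
  other than \<open>d\<close> vanish on forms of degree \<open>d\<close>.\<close>

definition zero_locus :: "nat \<Rightarrow> ('v \<Rightarrow>\<^sub>0 nat) cpoly set \<Rightarrow> 'v cpoly set set" where
  "zero_locus d I = {P \<in> proj_forms d. \<forall>F\<in>I. \<forall>f\<in>P. cpoly_eval (Poly_Mapping.lookup f) F = 0}"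

definition zariski_closed :: "nat \<Rightarrow> 'v cpoly set set \<Rightarrow> bool" where
  "zariski_closed d Z \<longleftrightarrow> (\<exists>I. (\<forall>F\<in>I. \<exists>e. homogeneous e F) \<and> Z = zero_locus d I)"

definition zariski_topology :: "nat \<Rightarrow> 'v cpoly set topology" where
  "zariski_topology d = topology (\<lambda>U. U \<subseteq> proj_forms d \<and> zariski_closed d (proj_forms d - U))"

lemma zariski_closed_Un:
  assumes "zariski_closed d Y" "zariski_closed d Z"
  shows "zariski_closed d (Y \<union> Z)"
proof -
  obtain I J where I: "\<forall>F\<in>I. \<exists>e. homogeneous e F" "Y = zero_locus d I"
    and J: "\<forall>F\<in>J. \<exists>e. homogeneous e F" "Z = zero_locus d J"
    using assms unfolding zariski_closed_def by blast
  define K where "K = {F * G | F G. F \<in> I \<and> G \<in> J}"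
  have hom: "\<forall>F\<in>K. \<exists>e. homogeneous e F"
    using I(1) J(1) homogeneous_mult unfolding K_def by blast
  have "zero_locus d K \<subseteq> Y \<union> Z"
  proof (rule ccontr)
    assume "\<not> zero_locus d K \<subseteq> Y \<union> Z"
    then obtain P F f G g where P: "P \<in> zero_locus d K"
      and F: "F \<in> I" "f \<in> P" "cpoly_eval (Poly_Mapping.lookup f) F \<noteq> 0"
      and G: "G \<in> J" "g \<in> P" "cpoly_eval (Poly_Mapping.lookup g) G \<noteq> 0"
      using I(2) J(2) unfolding zero_locus_def by blast
    obtain h where "P = proj_class cpoly_scale h"
      using P unfolding zero_locus_def proj_space_def by blast
    then obtain a b where ab: "f = cpoly_scale a h" "a \<noteq> 0" "g = cpoly_scale b h" "b \<noteq> 0"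
      using F(2) G(2) unfolding proj_class_def by blast
    have "g = cpoly_scale (b / a) f"
      using ab by (intro poly_mapping_eqI) simp
    then have "Poly_Mapping.lookup g = (\<lambda>m. b / a * Poly_Mapping.lookup f m)"
      by auto
    moreover obtain e where "homogeneous e G"
      using G(1) J(1) by blast
    ultimately have "cpoly_eval (Poly_Mapping.lookup g) G =
        (b / a) ^ e * cpoly_eval (Poly_Mapping.lookup f) G"
      using cpoly_eval_homogeneous_scale[of e G "b / a" "Poly_Mapping.lookup f"] by simp
    then have "cpoly_eval (Poly_Mapping.lookup f) G \<noteq> 0"
      using G(3) by auto
    moreover have "cpoly_eval (Poly_Mapping.lookup f) (F * G) = 0"
      using P F G unfolding zero_locus_def K_def by blast
    ultimately show False
      using F(3) by (simp add: cpoly_eval_mult)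
  qed
  moreover have "Y \<union> Z \<subseteq> zero_locus d K"
    unfolding I(2) J(2) K_def zero_locus_def by (auto simp: cpoly_eval_mult)
  ultimately show ?thesis
    using hom unfolding zariski_closed_def by blast
qed

lemma zariski_closed_Inter:
  assumes "\<And>Z. Z \<in> \<Z> \<Longrightarrow> zariski_closed d Z"
  shows "zariski_closed d (proj_forms d \<inter> \<Inter>\<Z>)"
proof -
  obtain I where I: "\<And>Z. Z \<in> \<Z> \<Longrightarrow> (\<forall>F\<in>I Z. \<exists>e. homogeneous e F) \<and> Z = zero_locus d (I Z)"
    using assms unfolding zariski_closed_def by metis
  have "proj_forms d \<inter> \<Inter>\<Z> = zero_locus d (\<Union>Z\<in>\<Z>. I Z)"
  proof -
    have "proj_forms d \<inter> \<Inter>\<Z> = proj_forms d \<inter> (\<Inter>Z\<in>\<Z>. zero_locus d (I Z))"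
      using I by auto
    also have "\<dots> = zero_locus d (\<Union>Z\<in>\<Z>. I Z)"
      unfolding zero_locus_def by blast
    finally show ?thesis .
  qed
  moreover have "\<forall>F\<in>(\<Union>Z\<in>\<Z>. I Z). \<exists>e. homogeneous e F"
    using I by blast
  ultimately show ?thesis
    unfolding zariski_closed_def by blast
qed

lemma openin_zariski_topology:
  fixes U :: "'v cpoly set set"
  shows "openin (zariski_topology d) U \<longleftrightarrow> U \<subseteq> proj_forms d \<and> zariski_closed d (proj_forms d - U)"
proof -
  have "istopology (\<lambda>U :: 'v cpoly set set. U \<subseteq> proj_forms d \<and> zariski_closed d (proj_forms d - U))"
    unfolding istopology_def
  proof (intro conjI allI impI)
    fix S T :: "'v cpoly set set"
    assume S: "S \<subseteq> proj_forms d \<and> zariski_closed d (proj_forms d - S)"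
      and T: "T \<subseteq> proj_forms d \<and> zariski_closed d (proj_forms d - T)"
    show "S \<inter> T \<subseteq> proj_forms d"
      using S by blast
    show "zariski_closed d (proj_forms d - S \<inter> T)"
      using S T zariski_closed_Un by (metis Diff_Int)
  next
    fix \<K> :: "'v cpoly set set set"
    assume *: "\<forall>K\<in>\<K>. K \<subseteq> proj_forms d \<and> zariski_closed d (proj_forms d - K)"
    then show "\<Union>\<K> \<subseteq> proj_forms d"
      by blast
    have "proj_forms d - \<Union>\<K> = proj_forms d \<inter> \<Inter>((-) (proj_forms d) ` \<K>)"
      by blast
    then show "zariski_closed d (proj_forms d - \<Union>\<K>)"
      using zariski_closed_Inter[of "(-) (proj_forms d) ` \<K>" d] * by (metis (no_types, lifting) imageE)
  qed
  then show ?thesis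
    by (simp add: zariski_topology_def topology_inverse')
qed

lemma topspace_zariski_topology: "topspace (zariski_topology d) = (proj_forms d :: 'v cpoly set set)"
proof (rule antisym)
  show "topspace (zariski_topology d) \<subseteq> (proj_forms d :: 'v cpoly set set)"
    using openin_zariski_topology openin_topspace by blast
  have "zariski_closed d (proj_forms d - proj_forms d :: 'v cpoly set set)"
  proof -
    have "homogeneous 0 (1 :: ('v \<Rightarrow>\<^sub>0 nat) cpoly)"
      by (simp add: homogeneous_def monom_degree_def)
    moreover have "{} = zero_locus d {1 :: ('v \<Rightarrow>\<^sub>0 nat) cpoly}"
      by (auto simp: zero_locus_def proj_space_def proj_class_def cpoly_eval_def monom_eval_def)
    ultimately show ?thesis
      unfolding zariski_closed_def Diff_cancel by blast
  qed
  then show "(proj_forms d :: 'v cpoly set set) \<subseteq> topspace (zariski_topology d)"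
    by (intro openin_subset) (simp add: openin_zariski_topology)
qed


section \<open>Hypersurfaces and their duals\<close>

definition hypersurface :: "'m::finite cpoly \<Rightarrow> (complex^'m) set set" where
  "hypersurface f = {P \<in> coord_proj_space. \<forall>x\<in>P. cpoly_eval (($) x) f = 0}"

definition gradient :: "'m::finite cpoly \<Rightarrow> complex^'m \<Rightarrow> complex^'m" where
  "gradient f x = (\<chi> j. cpoly_eval (($) x) (partial_deriv j f))"

definition smooth_hypersurface :: "'m::finite cpoly \<Rightarrow> bool" where
  "smooth_hypersurface f \<longleftrightarrow> (\<forall>P\<in>hypersurface f. \<forall>x\<in>P. gradient f x \<noteq> 0)"

text \<open>The point with coordinates \<open>a\<close> of the dual space is the hyperplane \<open>\<Sum>j. a $ j * x $ j = 0\<close>.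
  For homogeneous \<open>f\<close> all representatives of \<open>P\<close> give the same class, hence the union below
  is that class.\<close>

definition dual_map :: "'m::finite cpoly \<Rightarrow> (complex^'m) set \<Rightarrow> (complex^'m) set" where
  "dual_map f P = (\<Union>x\<in>P. vec_class (gradient f x))"

definition dual_hypersurface :: "'m::finite cpoly \<Rightarrow> (complex^'m) set set" where
  "dual_hypersurface f = dual_map f ` hypersurface f"


section \<open>Normal crossings\<close>

definition has_complex_deriv ::
  "(complex^'n \<Rightarrow> complex) \<Rightarrow> (complex^'n \<Rightarrow> complex) \<Rightarrow> complex^'n \<Rightarrow> bool" where
  "has_complex_deriv h D z \<longleftrightarrow> (h has_derivative D) (at z) \<and> (\<forall>c v. D (c *s v) = c * D v)"

definition multi_holomorphic_on :: "(complex^'n \<Rightarrow> complex) \<Rightarrow> (complex^'n) set \<Rightarrow> bool" where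
  "multi_holomorphic_on h W \<longleftrightarrow> open W \<and> (\<forall>z\<in>W. \<exists>D. has_complex_deriv h D z)"

text \<open>\<open>H\<close> is the zero set in \<open>W\<close> of a holomorphic function that vanishes at \<open>p\<close> and has the nonzero
  differential \<open>l\<close> there. So the germ of \<open>H\<close> at \<open>p\<close> is smooth, with tangent hyperplane \<open>l = 0\<close>.\<close>

definition smooth_branch ::
  "(complex^'n) set \<Rightarrow> complex^'n \<Rightarrow> (complex^'n) set \<Rightarrow> (complex^'n \<Rightarrow> complex) \<Rightarrow> bool" where
  "smooth_branch W p H l \<longleftrightarrow>
    (\<exists>h. multi_holomorphic_on h W \<and> h p = 0 \<and> has_complex_deriv h l p \<and> (\<exists>v. l v \<noteq> 0) \<and>
         H = {z \<in> W. h z = 0})"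

definition independent_forms :: "nat \<Rightarrow> (nat \<Rightarrow> complex^'n \<Rightarrow> complex) \<Rightarrow> bool" where
  "independent_forms k l \<longleftrightarrow>
    (\<forall>c. (\<forall>v. (\<Sum>i<k. c i * l i v) = 0) \<longrightarrow> (\<forall>i<k. c i = 0))"

definition normal_crossing_germ :: "nat \<Rightarrow> (complex^'n) set \<Rightarrow> complex^'n \<Rightarrow> bool" where
  "normal_crossing_germ k X p \<longleftrightarrow>
    (\<exists>W H l. open W \<and> p \<in> W \<and> (\<forall>i<k. smooth_branch W p (H i) (l i)) \<and>
       independent_forms k l \<and> X \<inter> W = (\<Union>i<k. H i))"

text \<open>Homogeneous coordinates are indexed by \<open>'n option\<close>, affine ones by \<open>'n\<close>. The chart number
  \<open>i\<close> covers the points whose \<open>i\<close>-th homogeneous coordinate is nonzero: this coordinate is set to 1,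
  and if \<open>i = Some j\<close> then the affine coordinate \<open>j\<close> becomes the homogeneous coordinate
  \<open>None\<close>.\<close>

definition affine_chart :: "'n::finite option \<Rightarrow> complex^'n \<Rightarrow> (complex^('n option)) set" where
  "affine_chart i z =
    vec_class (\<chi> k. case Transposition.transpose None i k of None \<Rightarrow> 1 | Some j \<Rightarrow> z $ j)"

text \<open>Being a normal crossing is invariant under biholomorphic coordinate changes, so it does not
  matter which chart around the point is used.\<close>

definition normal_crossing_at ::
  "nat \<Rightarrow> (complex^('n::finite option)) set set \<Rightarrow> (complex^('n option)) set \<Rightarrow> bool" where
  "normal_crossing_at k X Q \<longleftrightarrow>
    (\<exists>i z. Q = affine_chart i z \<and> normal_crossing_germ k (affine_chart i -` X) z)"

end

theory Submission
  imports Defs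
begin

text \<open>A hyperplane \<open>H\<close> tangent to a smooth \<open>V(f)\<close> at exactly \<open>n\<close> linearly independent points, with
  nondegenerate tangencies, is a normal crossing of the dual hypersurface: near \<open>H\<close>, the tangency at
  the point \<open>p\<close> can be continued holomorphically by the implicit function theorem, which gives a
  smooth branch whose tangent hyperplane is given by the linear form \<open>p\<close>, and by compactness there are no
  other branches.

  Such an \<open>H\<close> exists for generic \<open>f\<close>. The pairs of a form and \<open>n\<close> normalized tangency points are
  parametrized by as many parameters as there are coefficients, so counting monomials shows that on
  these pairs every coordinate, and also the Jacobian of the tangency equations, is algebraic over
  the coefficients of the form. Off the zeros of suitable coefficients of these relations,
  solutions stay bounded and nondegenerate. Hence a solution for one explicit form can be continued
  along a complex line, from which only finitely many points have been removed, to any other generic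
  form.

  Singular hypersurfaces, and multitangent hyperplanes with a further tangency, are parametrized
  with fewer parameters than there are coefficients. The same counting argument puts them into a
  proper hypersurface of the space of forms.\<close>

section \<open>Polynomial functions\<close>

text \<open>That the hyperplane through \<open>n\<close> points is tangent to \<open>f\<close> at
  each of them amounts to \<open>n ^ 2\<close> conditions, linear in the coefficients of
  \<open>f\<close>; the normalized points have \<open>n ^ 2\<close> parameters too. Where one fixed
  minor of this linear system is nonzero, Cramer's rule makes the pairs of a form and its points a
  rational family, and the same minor forces the points to be independent. Dimension theory is
  thereby reduced to comparing numbers of monomials.

  The obstacle is the further tangencies. The counting needs the conditions at an additional point
  \<open>y\<close> of the hyperplane to be independent of those at the nodes. The nodes already use
  up the restricted monomials with an exponent of at least \<open>d - 1\<close>. For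
  \<open>d = 3\<close> and \<open>d = 4\<close> too few monomials remain if \<open>y\<close> has few
  nonzero coordinates. The conditions at \<open>y\<close> then contain the vanishing of one
  coefficient of the restricted form, so that \<open>y\<close> can be replaced by a fixed point
  without parameters.\<close>

inductive_set pol :: "'j set \<Rightarrow> (('j \<Rightarrow> complex) \<Rightarrow> complex) set" for J where
  pol_const [intro]: "(\<lambda>t. c) \<in> pol J"
| pol_var: "j \<in> J \<Longrightarrow> (\<lambda>t. t j) \<in> pol J"
| pol_add [intro]: "F \<in> pol J \<Longrightarrow> G \<in> pol J \<Longrightarrow> (\<lambda>t. F t + G t) \<in> pol J"
| pol_mult [intro]: "F \<in> pol J \<Longrightarrow> G \<in> pol J \<Longrightarrow> (\<lambda>t. F t * G t) \<in> pol J"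

lemma pol_sum [intro]: "(\<And>a. a \<in> A \<Longrightarrow> F a \<in> pol J) \<Longrightarrow> (\<lambda>t. \<Sum>a\<in>A. F a t) \<in> pol J"
  by (induction A rule: infinite_finite_induct) auto

lemma pol_prod [intro]: "(\<And>a. a \<in> A \<Longrightarrow> F a \<in> pol J) \<Longrightarrow> (\<lambda>t. \<Prod>a\<in>A. F a t) \<in> pol J"
  by (induction A rule: infinite_finite_induct) auto

lemma pol_power [intro]: "F \<in> pol J \<Longrightarrow> (\<lambda>t. F t ^ k) \<in> pol J"
  by (induction k) auto

lemma pol_uminus [intro]: "F \<in> pol J \<Longrightarrow> (\<lambda>t. - F t) \<in> pol J"
  using pol_mult[OF pol_const[of "-1"], of F J] by simp

lemma pol_det:
  fixes A :: "('j \<Rightarrow> complex) \<Rightarrow> complex^'r^'r"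
  assumes "\<And>r s. (\<lambda>t. A t $ r $ s) \<in> pol J"
  shows "(\<lambda>t. det (A t)) \<in> pol J"
  unfolding det_def using assms by (intro pol_sum pol_mult pol_const pol_prod) auto

lemma pol_compose:
  assumes "F \<in> pol I" "\<And>i. i \<in> I \<Longrightarrow> (\<lambda>t. h t i) \<in> pol J"
  shows "(\<lambda>t. F (h t)) \<in> pol J"
  using assms by (induction rule: pol.induct) auto

lemma pol_mono: "F \<in> pol I \<Longrightarrow> I \<subseteq> J \<Longrightarrow> F \<in> pol J"
  by (induction rule: pol.induct) (auto intro: pol.intros)

lemma pol_cong: "F \<in> pol J \<Longrightarrow> (\<And>j. j \<in> J \<Longrightarrow> x j = y j) \<Longrightarrow> F x = F y"
  by (induction rule: pol.induct) auto

lemma pol_line: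
  assumes "F \<in> pol J"
  shows "\<exists>p. \<forall>s. F (\<lambda>j. x j + s * (y j - x j)) = poly p s"
  using assms
proof (induction rule: pol.induct)
  case (pol_const c)
  show ?case by (rule exI[of _ "[:c:]"]) simp
next
  case (pol_var j)
  show ?case by (rule exI[of _ "[:x j, y j - x j:]"]) simp
next
  case (pol_add F G)
  then obtain p q where "\<forall>s. F (\<lambda>j. x j + s * (y j - x j)) = poly p s"
    "\<forall>s. G (\<lambda>j. x j + s * (y j - x j)) = poly q s" by blast
  then show ?case by (intro exI[of _ "p + q"]) simp
next
  case (pol_mult F G)
  then obtain p q where "\<forall>s. F (\<lambda>j. x j + s * (y j - x j)) = poly p s"
    "\<forall>s. G (\<lambda>j. x j + s * (y j - x j)) = poly q s" by blast
  then show ?case by (intro exI[of _ "p * q"]) simp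
qed

lemma pol_finite_zeros_on_line:
  assumes "F \<in> pol J" "F y \<noteq> 0"
  shows "finite {s. F (\<lambda>j. x j + s * (y j - x j)) = 0}"
proof -
  obtain p where p: "\<forall>s. F (\<lambda>j. x j + s * (y j - x j)) = poly p s"
    using pol_line[OF assms(1)] by blast
  have "poly p 1 \<noteq> 0" using p[rule_format, of 1] assms(2) by simp
  then have "p \<noteq> 0" by auto
  then show ?thesis using poly_roots_finite p by simp
qed

text \<open>\<open>F\<close> is nonzero at the start of the line from \<open>x\<close> to
  \<open>y\<close> and \<open>G\<close> at its end, so each has only finitely many zeros on it. This
  is the irreducibility of affine space.\<close>

lemma pol_common_nonzero:
  assumes "F \<in> pol J" "F x \<noteq> 0" "G \<in> pol J" "G y \<noteq> 0"
  shows "\<exists>z. F z \<noteq> 0 \<and> G z \<noteq> 0"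
proof -
  have 1: "finite {s. G (\<lambda>j. x j + s * (y j - x j)) = 0}"
    by (rule pol_finite_zeros_on_line) fact+
  have "finite {s. F (\<lambda>j. y j + s * (x j - y j)) = 0}"
    by (rule pol_finite_zeros_on_line) fact+
  \<comment> \<open>The line is run backwards, since the finiteness lemma wants the nonzero value at
    the end point.\<close>
  then have "finite ((\<lambda>s. 1 - s) ` {s. F (\<lambda>j. y j + s * (x j - y j)) = 0})"
    by blast
  moreover have "{s. F (\<lambda>j. x j + s * (y j - x j)) = 0} \<subseteq>
      (\<lambda>s. 1 - s) ` {s. F (\<lambda>j. y j + s * (x j - y j)) = 0}"
  proof
    fix s assume "s \<in> {s. F (\<lambda>j. x j + s * (y j - x j)) = 0}"
    moreover have "(\<lambda>j. x j + s * (y j - x j)) = (\<lambda>j. y j + (1 - s) * (x j - y j))"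
      by (auto simp: algebra_simps)
    ultimately show "s \<in> (\<lambda>s. 1 - s) ` {s. F (\<lambda>j. y j + s * (x j - y j)) = 0}"
      by (intro image_eqI[of _ _ "1 - s"]) auto
  qed
  ultimately have 2: "finite {s. F (\<lambda>j. x j + s * (y j - x j)) = 0}"
    by (rule finite_subset[rotated])
  have "\<exists>s::complex. s \<notin> {s. F (\<lambda>j. x j + s * (y j - x j)) = 0} \<union> {s. G (\<lambda>j. x j + s * (y j - x j)) = 0}"
    by (rule ex_new_if_finite[OF infinite_UNIV_char_0 finite_UnI[OF 2 1]])
  then show ?thesis by auto
qed

lemma pol_finite_product_nonzero:
  assumes "finite A" "\<And>a. a \<in> A \<Longrightarrow> F a \<in> pol J" "\<And>a. a \<in> A \<Longrightarrow> \<exists>x. F a x \<noteq> 0"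
  shows "\<exists>x. (\<Prod>a\<in>A. F a x) \<noteq> 0"
  using assms
proof (induction A rule: finite_induct)
  case empty
  then show ?case by simp
next
  case (insert a A)
  obtain x where x: "(\<Prod>a\<in>A. F a x) \<noteq> 0"
    using insert.IH insert.prems by blast
  obtain y where y: "F a y \<noteq> 0"
    using insert.prems(2) by blast
  have 1: "F a \<in> pol J" using insert.prems(1) by blast
  have 2: "(\<lambda>x. \<Prod>a\<in>A. F a x) \<in> pol J"
    using insert.prems by (intro pol_prod) auto
  obtain z where "F a z \<noteq> 0 \<and> (\<Prod>a\<in>A. F a z) \<noteq> 0"
    using pol_common_nonzero[of "F a" J y "\<lambda>x. \<Prod>a\<in>A. F a x" x] 1 2 x y by blast
  then show ?case
    using insert.hyps by (intro exI[of _ z]) simp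
qed

text \<open>Induction on the variables: for fixed values of the others, the sum is a polynomial in
  \<open>x a\<close> that vanishes everywhere, so each of its coefficients vanishes and falls under
  the induction hypothesis.\<close>

lemma polynomial_identity_multi:
  fixes c :: "('i \<Rightarrow> nat) \<Rightarrow> complex"
  assumes "finite I" "\<And>x. (\<Sum>\<alpha>\<in>PiE I (\<lambda>_. {..N}). c \<alpha> * (\<Prod>i\<in>I. x i ^ \<alpha> i)) = 0"
    "\<alpha> \<in> PiE I (\<lambda>_. {..N})"
  shows "c \<alpha> = 0"
  using assms
proof (induction I arbitrary: c \<alpha> rule: finite_induct)
  case empty
  then show ?case by simp
next
  case (insert a I)
  let ?P = "PiE I (\<lambda>_. {..N})"
  have *: "(\<Sum>\<alpha>\<in>?P. c (\<alpha>(a := k)) * (\<Prod>i\<in>I. x i ^ \<alpha> i)) = 0" if "k \<le> N" for x k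
  proof -
    let ?q = "\<Sum>k\<le>N. monom (\<Sum>\<alpha>\<in>?P. c (\<alpha>(a := k)) * (\<Prod>i\<in>I. x i ^ \<alpha> i)) k"
    have "poly ?q z = 0" for z
    proof -
      have "0 = (\<Sum>\<alpha>\<in>PiE (insert a I) (\<lambda>_. {..N}). c \<alpha> * (\<Prod>i\<in>insert a I. (x(a := z)) i ^ \<alpha> i))"
        using insert.prems(1) by simp
      also have "\<dots> = (\<Sum>(k, \<alpha>)\<in>{..N} \<times> ?P. c (\<alpha>(a := k)) * (\<Prod>i\<in>insert a I. (x(a := z)) i ^ (\<alpha>(a := k)) i))"
        unfolding PiE_insert_eq
        by (subst sum.reindex[OF inj_combinator[OF insert.hyps(2)]]) (simp add: case_prod_unfold)
      also have "\<dots> = (\<Sum>(k, \<alpha>)\<in>{..N} \<times> ?P. c (\<alpha>(a := k)) * (\<Prod>i\<in>I. x i ^ \<alpha> i) * z ^ k)"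
      proof (rule sum.cong[OF refl], clarify)
        fix k \<alpha>
        have "(\<Prod>i\<in>I. (x(a := z)) i ^ (\<alpha>(a := k)) i) = (\<Prod>i\<in>I. x i ^ \<alpha> i)"
          using insert.hyps(2) by (intro prod.cong) auto
        then show "c (\<alpha>(a := k)) * (\<Prod>i\<in>insert a I. (x(a := z)) i ^ (\<alpha>(a := k)) i) =
           c (\<alpha>(a := k)) * (\<Prod>i\<in>I. x i ^ \<alpha> i) * z ^ k"
          using insert.hyps by simp
      qed
      also have "\<dots> = (\<Sum>k\<le>N. (\<Sum>\<alpha>\<in>?P. c (\<alpha>(a := k)) * (\<Prod>i\<in>I. x i ^ \<alpha> i)) * z ^ k)"
        by (simp add: sum.cartesian_product sum_distrib_right)
      also have "\<dots> = poly ?q z"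
        by (simp add: poly_sum poly_monom)
      finally show ?thesis by simp
    qed
    then have "?q = 0"
      using poly_all_0_iff_0 by blast
    then have "coeff ?q k = 0" by simp
    then show ?thesis
      using that by (simp add: coeff_sum if_distrib cong: if_cong)
  qed
  have "\<alpha> \<in> (\<lambda>(y, g). g(a := y)) ` ({..N} \<times> ?P)"
    using insert.prems(2) unfolding PiE_insert_eq by simp
  then obtain k \<beta> where "k \<le> N" "\<beta> \<in> ?P" "\<alpha> = \<beta>(a := k)"
    by auto
  then show ?case
    using insert.IH[of "\<lambda>\<alpha>. c (\<alpha>(a := k))" \<beta>, OF *] by blast
qed

section \<open>Algebraic dependence by counting\<close>

text \<open>Degree at most \<open>D\<close> in each variable separately. Partial degrees, unlike the
  total degree, give a space whose dimension is bounded by the plain power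
  \<open>(D + 1) ^ card J\<close>.\<close>

inductive bounded_pol :: "'j set \<Rightarrow> nat \<Rightarrow> (('j \<Rightarrow> complex) \<Rightarrow> complex) \<Rightarrow> bool" for J D where
  zero: "bounded_pol J D (\<lambda>t. 0)"
| add_term: "bounded_pol J D F \<Longrightarrow> (\<And>j. j \<in> J \<Longrightarrow> \<beta> j \<le> D) \<Longrightarrow>
    bounded_pol J D (\<lambda>t. c * (\<Prod>j\<in>J. t j ^ \<beta> j) + F t)"

lemma bounded_pol_mono: "bounded_pol J D F \<Longrightarrow> D \<le> E \<Longrightarrow> bounded_pol J E F"
  by (induction rule: bounded_pol.induct) (auto intro!: bounded_pol.intros, meson dual_order.trans)

lemma bounded_pol_const: "bounded_pol J D (\<lambda>t. c)"
  using bounded_pol.add_term[OF bounded_pol.zero, of J "\<lambda>_. 0" D c] by simp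

lemma bounded_pol_var: 
  assumes "finite J" "j \<in> J" shows "bounded_pol J 1 (\<lambda>t. t j)"
proof -
  have "bounded_pol J 1 (\<lambda>t. 1 * (\<Prod>i\<in>J. t i ^ (if i = j then 1 else 0)) + 0)"
    by (intro bounded_pol.intros) auto
  moreover have "(\<Prod>i\<in>J. t i ^ (if i = j then 1 else 0)) = t j" for t :: "_ \<Rightarrow> complex"
  proof -
    have "(\<Prod>i\<in>J. t i ^ (if i = j then 1 else 0)) = (\<Prod>i\<in>J. if i = j then t i else 1)"
      by (intro prod.cong) auto
    then show ?thesis using assms by simp
  qed
  ultimately show ?thesis by simp
qed

lemma bounded_pol_add:
  "bounded_pol J D F \<Longrightarrow> bounded_pol J D G \<Longrightarrow> bounded_pol J D (\<lambda>t. F t + G t)"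
proof (induction rule: bounded_pol.induct)
  case (add_term F \<beta> c)
  then show ?case
    using bounded_pol.add_term[of J D "\<lambda>t. F t + G t" \<beta> c] by (simp add: add.assoc)
qed simp

lemma bounded_pol_mult:
  "bounded_pol J D F \<Longrightarrow> bounded_pol J E G \<Longrightarrow> bounded_pol J (D + E) (\<lambda>t. F t * G t)"
proof (induction rule: bounded_pol.induct)
  case zero
  then show ?case by (simp add: bounded_pol.zero)
next
  case (add_term F \<beta> c)
  have 1: "bounded_pol J (D + E) (\<lambda>t. c * (\<Prod>j\<in>J. t j ^ \<beta> j) * G t)"
    using add_term.prems
  proof (induction rule: bounded_pol.induct)
    case zero
    then show ?case by (simp add: bounded_pol.zero)
  next
    case (add_term G \<gamma> c')
    have "bounded_pol J (D + E)
       (\<lambda>t. c * c' * (\<Prod>j\<in>J. t j ^ (\<beta> j + \<gamma> j)) + c * (\<Prod>j\<in>J. t j ^ \<beta> j) * G t)"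
      using add_term \<open>\<And>j. j \<in> J \<Longrightarrow> \<beta> j \<le> D\<close>
      by (intro bounded_pol.add_term) (auto intro: add_mono)
    then show ?case
      by (simp add: algebra_simps power_add prod.distrib)
  qed
  then show ?case
    using bounded_pol_add[OF 1 add_term.IH[OF add_term.prems]] by (simp add: distrib_right)
qed

lemma bounded_pol_power:
  "bounded_pol J D F \<Longrightarrow> bounded_pol J (k * D) (\<lambda>t. F t ^ k)"
  by (induction k) (auto simp: bounded_pol_const intro: bounded_pol_mult)

lemma bounded_pol_prod:
  assumes "finite A" "\<And>a. a \<in> A \<Longrightarrow> bounded_pol J D (F a)"
  shows "bounded_pol J (card A * D) (\<lambda>t. \<Prod>a\<in>A. F a t)"
  using assms by (induction A rule: finite_induct) (auto simp: bounded_pol_const intro: bounded_pol_mult)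

lemma pol_imp_bounded_pol:
  assumes "finite J" "F \<in> pol J"
  shows "\<exists>D. bounded_pol J D F"
  using assms(2)
proof (induction rule: pol.induct)
  case (pol_const c)
  show ?case by (intro exI[of _ 0] bounded_pol_const)
next
  case (pol_var j)
  then show ?case using bounded_pol_var[OF assms(1)] by (intro exI[of _ 1])
next
  case (pol_add F G)
  then obtain D E where "bounded_pol J D F" "bounded_pol J E G" by blast
  then show ?case
    by (intro exI[of _ "max D E"] bounded_pol_add) (auto elim: bounded_pol_mono)
next
  case (pol_mult F G)
  then obtain D E where "bounded_pol J D F" "bounded_pol J E G" by blast
  then show ?case by (intro exI[of _ "D + E"] bounded_pol_mult)
qed

lemma bounded_pol_expand:
  assumes "finite J" "bounded_pol J D F"
  shows "\<exists>c. \<forall>t. F t = (\<Sum>\<beta>\<in>PiE J (\<lambda>_. {..D}). c \<beta> * (\<Prod>j\<in>J. t j ^ \<beta> j))"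
  using assms(2)
proof (induction rule: bounded_pol.induct)
  case zero
  then show ?case by (intro exI[of _ "\<lambda>_. 0"]) simp
next
  case (add_term F \<beta> a)
  then obtain c where c: "\<And>t. F t = (\<Sum>\<beta>\<in>PiE J (\<lambda>_. {..D}). c \<beta> * (\<Prod>j\<in>J. t j ^ \<beta> j))"
    by blast
  \<comment> \<open>Exponents outside \<open>J\<close> are cut off, so that the new term is indexed
    by an element of the finite set of extensional functions.\<close>
  let ?b = "restrict \<beta> J"
  have b: "?b \<in> PiE J (\<lambda>_. {..D})" using add_term by auto
  have fin: "finite (PiE J (\<lambda>_. {..D}))" using assms(1) by (intro finite_PiE) auto
  show ?case
  proof (intro exI[of _ "\<lambda>\<gamma>. (if \<gamma> = ?b then a else 0) + c \<gamma>"] allI)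
    fix t
    have "(\<Sum>\<gamma>\<in>PiE J (\<lambda>_. {..D}). (if \<gamma> = ?b then a else 0) * (\<Prod>j\<in>J. t j ^ \<gamma> j)) =
      (\<Sum>\<gamma>\<in>PiE J (\<lambda>_. {..D}). if \<gamma> = ?b then a * (\<Prod>j\<in>J. t j ^ \<beta> j) else 0)"
      by (intro sum.cong) auto
    also have "\<dots> = a * (\<Prod>j\<in>J. t j ^ \<beta> j)"
      using fin b by simp
    finally show "a * (\<Prod>j\<in>J. t j ^ \<beta> j) + F t =
         (\<Sum>\<gamma>\<in>PiE J (\<lambda>_. {..D}). ((if \<gamma> = ?b then a else 0) + c \<gamma>) * (\<Prod>j\<in>J. t j ^ \<gamma> j))"
      by (simp add: c distrib_right sum.distrib)
  qed
qed

text \<open>Gaussian elimination by induction on the equations: a pivot \<open>a0\<close> for the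
  equation \<open>b\<close> removes one equation and one unknown, which preserves the strict
  inequality of the cardinalities.\<close>

lemma underdetermined_system:
  fixes M :: "'a \<Rightarrow> 'b \<Rightarrow> 'f::field"
  assumes "finite B" "finite A" "card B < card A"
  shows "\<exists>x. (\<exists>a\<in>A. x a \<noteq> 0) \<and> (\<forall>b\<in>B. (\<Sum>a\<in>A. x a * M a b) = 0)"
  using assms
proof (induction B arbitrary: A M rule: finite_induct)
  case empty
  then obtain a where "a \<in> A" by fastforce
  then show ?case by (intro exI[of _ "\<lambda>_. 1"]) auto
next
  case (insert b B)
  show ?case
  proof (cases "\<forall>a\<in>A. M a b = 0")
    case True
    obtain x where "\<exists>a\<in>A. x a \<noteq> 0" "\<forall>b\<in>B. (\<Sum>a\<in>A. x a * M a b) = 0"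
      using insert.IH[of A M] insert.prems insert.hyps by auto
    then show ?thesis using True by (intro exI[of _ x]) auto
  next
    case False
    then obtain a0 where a0: "a0 \<in> A" "M a0 b \<noteq> 0" by blast
    let ?A = "A - {a0}"
    have "card B < card ?A"
      using insert a0 by auto
    then obtain x where x: "\<exists>a\<in>?A. x a \<noteq> 0"
      "\<And>b'. b' \<in> B \<Longrightarrow> (\<Sum>a\<in>?A. x a * (M a b' - M a b / M a0 b * M a0 b')) = 0"
      using insert.IH[of ?A "\<lambda>a b'. M a b' - M a b / M a0 b * M a0 b'"] insert.prems by auto
    \<comment> \<open>The value that the equation \<open>b\<close> forces on the pivot
      unknown.\<close>
    let ?v = "- (\<Sum>a\<in>?A. x a * M a b) / M a0 b"
    let ?x = "x(a0 := ?v)"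
    have sum: "(\<Sum>a\<in>A. ?x a * M a b') = ?v * M a0 b' + (\<Sum>a\<in>?A. x a * M a b')" for b'
      using insert.prems(1) a0 by (subst sum.remove[of A a0]) auto
    have "(\<Sum>a\<in>A. ?x a * M a b) = 0"
      unfolding sum using a0 by simp
    moreover have "(\<Sum>a\<in>A. ?x a * M a b') = 0" if "b' \<in> B" for b'
    proof -
      have "(\<Sum>a\<in>?A. x a * (M a b' - M a b / M a0 b * M a0 b')) =
         (\<Sum>a\<in>?A. x a * M a b') - (\<Sum>a\<in>?A. x a * M a b) / M a0 b * M a0 b'"
        by (simp add: sum_subtractf sum_distrib_left sum_divide_distrib right_diff_distrib mult_ac)
      then show ?thesis
        unfolding sum using x(2)[OF that] by (simp add: algebra_simps)
    qed
    moreover have "\<exists>a\<in>A. ?x a \<noteq> 0" using x(1) by auto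
    ultimately show ?thesis by (intro exI[of _ ?x]) auto
  qed
qed

text \<open>The coefficient vectors of the \<open>F a\<close> lie in a space of dimension
  \<open>(D + 1) ^ card J\<close>, which is less than their number.\<close>

lemma bounded_pol_dependent:
  assumes "finite J" "finite A" "\<And>a. a \<in> A \<Longrightarrow> bounded_pol J D (F a)"
    and "(D + 1) ^ card J < card A"
  shows "\<exists>x. (\<exists>a\<in>A. x a \<noteq> 0) \<and> (\<forall>t. (\<Sum>a\<in>A. x a * F a t) = 0)"
proof -
  let ?B = "PiE J (\<lambda>_. {..D})"
  have "\<forall>a\<in>A. \<exists>c. \<forall>t. F a t = (\<Sum>\<beta>\<in>?B. c \<beta> * (\<Prod>j\<in>J. t j ^ \<beta> j))"
    by (intro ballI bounded_pol_expand[OF assms(1) assms(3)])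
  then obtain c where c: "\<And>a t. a \<in> A \<Longrightarrow> F a t = (\<Sum>\<beta>\<in>?B. c a \<beta> * (\<Prod>j\<in>J. t j ^ \<beta> j))"
    by metis
  have "card ?B < card A" "finite ?B"
    using assms by (auto simp: card_PiE intro: finite_PiE)
  then obtain x where x: "\<exists>a\<in>A. x a \<noteq> 0" "\<forall>b\<in>?B. (\<Sum>a\<in>A. x a * c a b) = 0"
    using underdetermined_system[of ?B A c] assms(2) by blast
  have "(\<Sum>a\<in>A. x a * F a t) = 0" for t
  proof -
    have "(\<Sum>a\<in>A. x a * F a t) = (\<Sum>a\<in>A. \<Sum>\<beta>\<in>?B. x a * c a \<beta> * (\<Prod>j\<in>J. t j ^ \<beta> j))"
      by (simp add: c sum_distrib_left mult.assoc)
    also have "\<dots> = (\<Sum>\<beta>\<in>?B. (\<Sum>a\<in>A. x a * c a \<beta>) * (\<Prod>j\<in>J. t j ^ \<beta> j))"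
      by (subst sum.swap) (simp add: sum_distrib_right)
    also have "\<dots> = 0" using x(2) by simp
    finally show ?thesis .
  qed
  then show ?thesis using x(1) by blast
qed

text \<open>Rational functions whose denominator is a power of \<open>Q\<close>. Nothing is asked
  where \<open>Q\<close> vanishes, so the value assigned to a division by zero does not
  matter.\<close>

definition rational_over :: "'j set \<Rightarrow> (('j \<Rightarrow> complex) \<Rightarrow> complex) \<Rightarrow> (('j \<Rightarrow> complex) \<Rightarrow> complex) \<Rightarrow> bool"
  where "rational_over J Q g \<longleftrightarrow> (\<exists>e P. P \<in> pol J \<and> (\<forall>t. Q t \<noteq> 0 \<longrightarrow> g t * Q t ^ e = P t))"

lemma rational_over_pol: "P \<in> pol J \<Longrightarrow> rational_over J Q P"
  unfolding rational_over_def by (intro exI[of _ 0] exI[of _ P]) simp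

lemma rational_over_divide: "P \<in> pol J \<Longrightarrow> rational_over J Q (\<lambda>t. P t / Q t)"
  unfolding rational_over_def by (intro exI[of _ 1] exI[of _ P]) simp

lemma rational_over_raise:
  assumes "Q \<in> pol J" "P \<in> pol J" "\<forall>t. Q t \<noteq> 0 \<longrightarrow> g t * Q t ^ e = P t" "e \<le> e'"
  shows "\<exists>P'\<in>pol J. \<forall>t. Q t \<noteq> 0 \<longrightarrow> g t * Q t ^ e' = P' t"
proof (intro bexI[of _ "\<lambda>t. P t * Q t ^ (e' - e)"] allI impI)
  fix t assume "Q t \<noteq> 0"
  have "g t * Q t ^ e' = g t * Q t ^ e * Q t ^ (e' - e)"
    using assms(4) by (simp add: mult.assoc flip: power_add)
  then show "g t * Q t ^ e' = P t * Q t ^ (e' - e)"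
    using assms(3) \<open>Q t \<noteq> 0\<close> by simp
qed (use assms in auto)

lemma rational_over_add:
  assumes "Q \<in> pol J" "rational_over J Q g" "rational_over J Q h"
  shows "rational_over J Q (\<lambda>t. g t + h t)"
proof -
  obtain e P e' P' where *: "P \<in> pol J" "\<forall>t. Q t \<noteq> 0 \<longrightarrow> g t * Q t ^ e = P t"
    "P' \<in> pol J" "\<forall>t. Q t \<noteq> 0 \<longrightarrow> h t * Q t ^ e' = P' t"
    using assms unfolding rational_over_def by blast
  show ?thesis
    unfolding rational_over_def
  proof (intro exI[of _ "e + e'"] exI[of _ "\<lambda>t. P t * Q t ^ e' + P' t * Q t ^ e"] conjI allI impI)
    fix t assume "Q t \<noteq> 0"
    then have "g t * Q t ^ e = P t" "h t * Q t ^ e' = P' t" using * by auto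
    then show "(g t + h t) * Q t ^ (e + e') = P t * Q t ^ e' + P' t * Q t ^ e"
      by (simp add: power_add algebra_simps)
  next
    show "(\<lambda>t. P t * Q t ^ e' + P' t * Q t ^ e) \<in> pol J"
      using * assms by (intro pol_add pol_mult pol_power)
  qed
qed

lemma rational_over_mult:
  assumes "rational_over J Q g" "rational_over J Q h"
  shows "rational_over J Q (\<lambda>t. g t * h t)"
proof -
  obtain e P e' P' where *: "P \<in> pol J" "\<forall>t. Q t \<noteq> 0 \<longrightarrow> g t * Q t ^ e = P t"
    "P' \<in> pol J" "\<forall>t. Q t \<noteq> 0 \<longrightarrow> h t * Q t ^ e' = P' t"
    using assms unfolding rational_over_def by blast
  show ?thesis
    unfolding rational_over_def
  proof (intro exI[of _ "e + e'"] exI[of _ "\<lambda>t. P t * P' t"] conjI allI impI)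
    fix t assume "Q t \<noteq> 0"
    then have "g t * Q t ^ e = P t" "h t * Q t ^ e' = P' t" using * by auto
    then show "(g t * h t) * Q t ^ (e + e') = P t * P' t"
      by (metis mult.assoc mult.left_commute power_add)
  qed (use * assms in auto)
qed

lemma rational_over_compose:
  assumes "F \<in> pol I" "Q \<in> pol J" "\<And>i. i \<in> I \<Longrightarrow> rational_over J Q (\<lambda>t. h t i)"
  shows "rational_over J Q (\<lambda>t. F (h t))"
  using assms(1)
proof (induction rule: pol.induct)
  case (pol_const c)
  show ?case by (rule rational_over_pol) auto
next
  case (pol_var j)
  then show ?case using assms(3) by auto
next
  case (pol_add F G)
  then show ?case using rational_over_add[OF assms(2)] by blast
next
  case (pol_mult F G)
  then show ?case using rational_over_mult by blast
qed

text \<open>Transcendence degree by counting: the monomials of degree at most \<open>N\<close> in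
  each of the \<open>card I + 1\<close> functions, cleared of denominators, lie in a space whose
  dimension grows like \<open>N ^ card J\<close>, so they are linearly dependent for large
  \<open>N\<close>. The relation may be one between the \<phi> alone; what matters later is that
  some coefficient is not the zero polynomial.\<close>

lemma algebraic_relation:
  fixes \<phi> :: "'i \<Rightarrow> ('j \<Rightarrow> complex) \<Rightarrow> complex"
  assumes "finite I" "finite J" "card J \<le> card I" "Q \<in> pol J"
    and phi: "\<And>i. i \<in> I \<Longrightarrow> rational_over J Q (\<phi> i)" and g: "rational_over J Q g"
  shows "\<exists>N c. (\<forall>k. c k \<in> pol I) \<and> (\<exists>k\<le>N. \<exists>x. c k x \<noteq> 0) \<and>
    (\<forall>t. Q t \<noteq> 0 \<longrightarrow> (\<Sum>k\<le>N. c k (\<lambda>i. \<phi> i t) * g t ^ k) = 0)"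
proof -
  obtain e0 P0 where e0: "P0 \<in> pol J" "\<forall>t. Q t \<noteq> 0 \<longrightarrow> g t * Q t ^ e0 = P0 t"
    using g unfolding rational_over_def by blast
  obtain ei Pj where ei: "\<And>i. i \<in> I \<Longrightarrow> Pj i \<in> pol J"
    "\<And>i. i \<in> I \<Longrightarrow> \<forall>t. Q t \<noteq> 0 \<longrightarrow> \<phi> i t * Q t ^ ei i = Pj i t"
    using phi unfolding rational_over_def by metis
  \<comment> \<open>One exponent that clears the denominators of \<open>g\<close> and of all \<phi>
    at once.\<close>
  define e where "e = e0 + (\<Sum>i\<in>I. ei i)"
  obtain P where P: "P \<in> pol J" "\<And>t. Q t \<noteq> 0 \<Longrightarrow> g t * Q t ^ e = P t"
    using rational_over_raise[OF assms(4) e0] unfolding e_def by (metis le_add1)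
  have "\<exists>P'\<in>pol J. \<forall>t. Q t \<noteq> 0 \<longrightarrow> \<phi> i t * Q t ^ e = P' t" if "i \<in> I" for i
    using rational_over_raise[OF assms(4) ei(1,2)[OF that]] that assms(1) unfolding e_def
    by (metis member_le_sum trans_le_add2 zero_le)
  then obtain R where R: "\<And>i. i \<in> I \<Longrightarrow> R i \<in> pol J"
    "\<And>i t. i \<in> I \<Longrightarrow> Q t \<noteq> 0 \<Longrightarrow> \<phi> i t * Q t ^ e = R i t"
    by metis
  let ?q = "\<lambda>t. Q t ^ e"
  have "?q \<in> pol J" using assms(4) by blast
  then obtain D1 where D1: "bounded_pol J D1 ?q"
    using pol_imp_bounded_pol[OF assms(2)] by blast
  obtain D2 where D2: "bounded_pol J D2 P"
    using pol_imp_bounded_pol[OF assms(2) P(1)] by blast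
  obtain D3 where D3: "\<And>i. i \<in> I \<Longrightarrow> bounded_pol J (D3 i) (R i)"
    using pol_imp_bounded_pol[OF assms(2) R(1)] by metis
  define D where "D = D1 + D2 + (\<Sum>i\<in>I. D3 i)"
  have bq: "bounded_pol J D ?q"
    by (rule bounded_pol_mono[OF D1]) (simp add: D_def)
  have bP: "bounded_pol J D P"
    by (rule bounded_pol_mono[OF D2]) (simp add: D_def)
  have bR: "bounded_pol J D (R i)" if "i \<in> I" for i
    using bounded_pol_mono[OF D3[OF that]] that assms(1) unfolding D_def
    by (metis member_le_sum trans_le_add2 zero_le)
  define s where "s = Suc (card I)"
  \<comment> \<open>Chosen so that \<open>(s * D + 1) ^ card I \<le> N\<close>. Then the dimension
    bound \<open>((s * D + 1) * (N + 1)) ^ card I\<close> is less than the number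
    \<open>(N + 1) ^ s\<close> of monomials.\<close>
  define N where "N = (s * D + 1) ^ s"
  have bpow: "bounded_pol J (N * D) (\<lambda>t. F t ^ k * ?q t ^ (N - k))"
    if "bounded_pol J D F" "k \<le> N" for F k
  proof -
    have "bounded_pol J (k * D + (N - k) * D) (\<lambda>t. F t ^ k * ?q t ^ (N - k))"
      using that bq by (intro bounded_pol_mult bounded_pol_power) auto
    moreover have "k * D + (N - k) * D = N * D"
      using that(2) by (simp flip: add_mult_distrib)
    ultimately show ?thesis by simp
  qed
  let ?A = "PiE I (\<lambda>_. {..N}) \<times> {..N}"
  \<comment> \<open>Each factor is padded to the same power of the denominator, so that all products
    share the factor \<open>?q t ^ (s * N)\<close>.\<close>
  define \<psi> where "\<psi> = (\<lambda>a t. (\<Prod>i\<in>I. R i t ^ fst a i * ?q t ^ (N - fst a i)) * (P t ^ snd a * ?q t ^ (N - snd a)))"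
  have b\<psi>: "bounded_pol J (s * (N * D)) (\<psi> a)" if "a \<in> ?A" for a
  proof -
    have "bounded_pol J (card I * (N * D) + N * D) (\<psi> a)"
      unfolding \<psi>_def using that assms(1) bP bR
      by (intro bounded_pol_mult bounded_pol_prod bpow) auto
    then show ?thesis by (simp add: s_def add.commute)
  qed
  have cardA: "card ?A = (N + 1) ^ s"
    using assms(1) by (simp add: card_PiE card_cartesian_product s_def)
  have "(s * (N * D) + 1) ^ card J < card ?A"
  proof -
    have "(s * (N * D) + 1) ^ card J \<le> ((s * D + 1) * (N + 1)) ^ card J"
      by (rule power_mono) (simp_all add: algebra_simps)
    also have "\<dots> \<le> ((s * D + 1) * (N + 1)) ^ card I"
      using assms(3) by (intro power_increasing) auto
    also have "\<dots> = (s * D + 1) ^ card I * (N + 1) ^ card I"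
      by (rule power_mult_distrib)
    also have "(s * D + 1) ^ card I * (N + 1) ^ card I \<le> N * (N + 1) ^ card I"
      unfolding N_def s_def by (intro mult_right_mono power_increasing) auto
    also have "\<dots> < (N + 1) ^ s"
      unfolding s_def by simp
    finally show ?thesis using cardA by simp
  qed
  moreover have fin: "finite ?A" using assms(1) by (auto intro: finite_PiE)
  ultimately have "\<exists>x. (\<exists>a\<in>?A. x a \<noteq> 0) \<and> (\<forall>t. (\<Sum>a\<in>?A. x a * \<psi> a t) = 0)"
    by (intro bounded_pol_dependent[OF assms(2) _ b\<psi>]) auto
  then obtain x where x: "\<exists>a\<in>?A. x a \<noteq> 0" "\<And>t. (\<Sum>a\<in>?A. x a * \<psi> a t) = 0"
    by blast
  define c where "c = (\<lambda>k y. \<Sum>\<alpha>\<in>PiE I (\<lambda>_. {..N}). x (\<alpha>, k) * (\<Prod>i\<in>I. y i ^ \<alpha> i))"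
  have "c k \<in> pol I" for k
    unfolding c_def by (intro pol_sum pol_mult pol_const pol_prod pol_power pol_var)
  moreover have "\<exists>k\<le>N. \<exists>y. c k y \<noteq> 0"
  proof (rule ccontr)
    assume "\<not> (\<exists>k\<le>N. \<exists>y. c k y \<noteq> 0)"
    then have "x (\<alpha>, k) = 0" if "\<alpha> \<in> PiE I (\<lambda>_. {..N})" "k \<le> N" for \<alpha> k
      using polynomial_identity_multi[OF assms(1), where c = "\<lambda>\<alpha>. x (\<alpha>, k)" and N = N] that
      unfolding c_def by blast
    then show False using x(1) by auto
  qed
  moreover have "(\<Sum>k\<le>N. c k (\<lambda>i. \<phi> i t) * g t ^ k) = 0" if t: "Q t \<noteq> 0" for t
  proof -
    have p: "P t ^ k * ?q t ^ (N - k) = g t ^ k * ?q t ^ N" if "k \<le> N" for k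
      using that by (simp flip: P(2)[OF t] add: power_mult_distrib mult.assoc flip: power_add)
    have r: "R i t ^ k * ?q t ^ (N - k) = \<phi> i t ^ k * ?q t ^ N" if "k \<le> N" "i \<in> I" for k i
      using that by (simp flip: R(2)[OF _ t] add: power_mult_distrib mult.assoc flip: power_add)
    have "\<psi> a t = (\<Prod>i\<in>I. \<phi> i t ^ fst a i) * g t ^ snd a * ?q t ^ (s * N)" if "a \<in> ?A" for a
    proof -
      have "(\<Prod>i\<in>I. R i t ^ fst a i * ?q t ^ (N - fst a i)) = (\<Prod>i\<in>I. \<phi> i t ^ fst a i * ?q t ^ N)"
        using that by (intro prod.cong refl r) auto
      moreover have "P t ^ snd a * ?q t ^ (N - snd a) = g t ^ snd a * ?q t ^ N"
        using that by (intro p) auto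
      moreover have "?q t ^ (s * N) = (?q t ^ N) ^ card I * ?q t ^ N"
        by (simp add: s_def algebra_simps power_add flip: power_mult)
      ultimately show ?thesis
        unfolding \<psi>_def by (simp add: prod.distrib mult_ac)
    qed
    then have "0 = (\<Sum>a\<in>?A. x a * ((\<Prod>i\<in>I. \<phi> i t ^ fst a i) * g t ^ snd a * ?q t ^ (s * N)))"
      using x(2)[of t] by simp
    also have "\<dots> = (\<Sum>a\<in>?A. x a * (\<Prod>i\<in>I. \<phi> i t ^ fst a i) * g t ^ snd a) * ?q t ^ (s * N)"
      by (simp add: sum_distrib_left mult_ac)
    also have "(\<Sum>a\<in>?A. x a * (\<Prod>i\<in>I. \<phi> i t ^ fst a i) * g t ^ snd a) =
        (\<Sum>\<alpha>\<in>PiE I (\<lambda>_. {..N}). \<Sum>k\<le>N. x (\<alpha>, k) * (\<Prod>i\<in>I. \<phi> i t ^ \<alpha> i) * g t ^ k)"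
      by (simp add: sum.cartesian_product case_prod_unfold)
    also have "\<dots> = (\<Sum>k\<le>N. c k (\<lambda>i. \<phi> i t) * g t ^ k)"
      unfolding c_def by (subst sum.swap) (simp add: sum_distrib_right)
    finally show ?thesis using t by simp
  qed
  ultimately show ?thesis by blast
qed

section \<open>Thin sets and families of linear systems\<close>

definition thin :: "'m set \<Rightarrow> ('m \<Rightarrow> complex) set \<Rightarrow> bool" where
  "thin I B \<longleftrightarrow> (\<exists>F\<in>pol I. (\<exists>x. F x \<noteq> 0) \<and> (\<forall>x\<in>B. F x = 0))"

lemma thin_subset: "thin I B \<Longrightarrow> A \<subseteq> B \<Longrightarrow> thin I A"
  unfolding thin_def by blast

lemma thin_UN:
  assumes "finite A" "\<And>a. a \<in> A \<Longrightarrow> thin I (B a)"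
  shows "thin I (\<Union>a\<in>A. B a)"
proof -
  obtain F where F: "\<And>a. a \<in> A \<Longrightarrow> F a \<in> pol I" "\<And>a. a \<in> A \<Longrightarrow> \<exists>x. F a x \<noteq> 0"
    "\<And>a x. a \<in> A \<Longrightarrow> x \<in> B a \<Longrightarrow> F a x = 0"
    using assms(2) unfolding thin_def by metis
  show ?thesis
    unfolding thin_def
  proof (intro bexI conjI)
    show "\<exists>x. (\<Prod>a\<in>A. F a x) \<noteq> 0"
      by (rule pol_finite_product_nonzero[OF assms(1) F(1,2)])
    show "\<forall>x\<in>(\<Union>a\<in>A. B a). (\<Prod>a\<in>A. F a x) = 0"
      using F(3) assms(1) by (auto intro!: prod_zero)
    show "(\<lambda>x. \<Prod>a\<in>A. F a x) \<in> pol I"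
      by (intro pol_prod F(1))
  qed
qed

lemma thin_Un: "thin I A \<Longrightarrow> thin I B \<Longrightarrow> thin I (A \<union> B)"
  using thin_UN[of "{True, False}" I "\<lambda>b. if b then A else B"] by (simp add: Un_commute)

lemma thin_zeros: "F \<in> pol I \<Longrightarrow> F x \<noteq> 0 \<Longrightarrow> thin I {x. F x = 0}"
  unfolding thin_def by blast

text \<open>One coordinate is set aside as \<open>g\<close>; the remaining ones still number at
  least \<open>card J\<close>, so the algebraic relation applies and becomes an equation for the
  image.\<close>

lemma thin_rational_image:
  fixes \<phi> :: "'i \<Rightarrow> ('j \<Rightarrow> complex) \<Rightarrow> complex"
  assumes "finite I" "finite J" "card J < card I" "Q \<in> pol J"
    and phi: "\<And>i. i \<in> I \<Longrightarrow> rational_over J Q (\<phi> i)"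
  shows "thin I {x. \<exists>t. Q t \<noteq> 0 \<and> (\<forall>i\<in>I. x i = \<phi> i t)}"
proof -
  obtain i where i: "i \<in> I" using assms(3) by fastforce
  have "card J \<le> card (I - {i})" using assms i by simp
  then have "\<exists>N c. (\<forall>k. c k \<in> pol (I - {i})) \<and> (\<exists>k\<le>N. \<exists>x. c k x \<noteq> 0) \<and>
    (\<forall>t. Q t \<noteq> 0 \<longrightarrow> (\<Sum>k\<le>N. c k (\<lambda>i. \<phi> i t) * \<phi> i t ^ k) = 0)"
    using assms i by (intro algebraic_relation) auto
  then obtain N c where c': "\<And>k. c k \<in> pol (I - {i})" "\<exists>k\<le>N. \<exists>x. c k x \<noteq> 0"
    "\<And>t. Q t \<noteq> 0 \<Longrightarrow> (\<Sum>k\<le>N. c k (\<lambda>i. \<phi> i t) * \<phi> i t ^ k) = 0"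
    by blast
  from c'(2) obtain k x where "k \<le> N" "c k x \<noteq> 0"
    by blast
  note c = c'(1) this c'(3)
  define F where "F = (\<lambda>x. \<Sum>k\<le>N. c k x * x i ^ k)"
  have "c k \<in> pol I" for k by (rule pol_mono[OF c(1)]) auto
  then have FI: "F \<in> pol I"
    unfolding F_def using i by (intro pol_sum pol_mult pol_power pol_var) auto
  have "\<exists>z. F (x(i := z)) \<noteq> 0"
  proof (rule ccontr)
    assume *: "\<not> (\<exists>z. F (x(i := z)) \<noteq> 0)"
    \<comment> \<open>The \<open>c\<close> do not involve the variable \<open>i\<close>, so varying
      \<open>x i\<close> alone gives a univariate polynomial, with the nonzero coefficient
      \<open>c k x\<close>.\<close>
    let ?q = "\<Sum>k\<le>N. monom (c k x) k"
    have "c j (x(i := z)) = c j x" for j z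
      by (rule pol_cong[OF c(1)]) auto
    then have "poly ?q z = 0" for z
      using * by (simp add: F_def poly_sum poly_monom)
    then have "?q = 0" using poly_all_0_iff_0 by blast
    then have "coeff ?q k = 0" by simp
    then show False
      using c(2,3) by (simp add: coeff_sum if_distrib cong: if_cong)
  qed
  moreover have "F x = 0" if "Q t \<noteq> 0" "\<forall>i\<in>I. x i = \<phi> i t" for x t
  proof -
    have "F x = F (\<lambda>i. \<phi> i t)"
      by (rule pol_cong[OF FI]) (use that in auto)
    then show ?thesis using c(4)[OF that(1)] by (simp add: F_def)
  qed
  ultimately show ?thesis
    unfolding thin_def using FI by blast
qed

section \<open>Linear systems with polynomial coefficients\<close>

abbreviation system_minor ::
  "('r \<Rightarrow> 'm \<Rightarrow> ('j \<Rightarrow> complex) \<Rightarrow> complex) \<Rightarrow> ('r::finite \<Rightarrow> 'm) \<Rightarrow> ('j \<Rightarrow> complex) \<Rightarrow> complex" where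
  "system_minor A \<sigma> t \<equiv> det (\<chi> r s. A r (\<sigma> s) t)"

text \<open>Cramer's rule, with the parameters of the system and the remaining unknowns as variables.\<close>

lemma linear_system_rational_solution:
  fixes A :: "'r::finite \<Rightarrow> 'm \<Rightarrow> ('j \<Rightarrow> complex) \<Rightarrow> complex"
  assumes "finite I" "\<And>r m. m \<in> I \<Longrightarrow> A r m \<in> pol J" "inj \<sigma>" "range \<sigma> \<subseteq> I"
  defines "J' \<equiv> Inl ` J \<union> Inr ` (I - range \<sigma>)"
  shows "(\<lambda>\<tau>. system_minor A \<sigma> (\<lambda>j. \<tau> (Inl j))) \<in> pol J'"
    and "\<exists>\<phi>. (\<forall>m\<in>I. rational_over J' (\<lambda>\<tau>. system_minor A \<sigma> (\<lambda>j. \<tau> (Inl j))) (\<phi> m)) \<and>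
      (\<forall>t x. system_minor A \<sigma> t \<noteq> 0 \<longrightarrow> (\<forall>r. (\<Sum>m\<in>I. A r m t * x m) = 0) \<longrightarrow>
        (\<forall>m\<in>I. \<phi> m (case_sum t x) = x m))"
proof -
  have AJ: "(\<lambda>\<tau>. A r m (\<lambda>j. \<tau> (Inl j))) \<in> pol J'" if "m \<in> I" for r m
    by (rule pol_compose[OF assms(2)[OF that]]) (auto simp: J'_def intro: pol_var)
  have sI: "\<sigma> s \<in> I" for s using assms(4) by auto
  show Q: "(\<lambda>\<tau>. system_minor A \<sigma> (\<lambda>j. \<tau> (Inl j))) \<in> pol J'"
    by (intro pol_det) (simp add: AJ sI)
  let ?b = "\<lambda>\<tau> r. - (\<Sum>m\<in>I - range \<sigma>. A r m (\<lambda>j. \<tau> (Inl j)) * \<tau> (Inr m))"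
  let ?C = "\<lambda>s0 \<tau>. (\<chi> r s. if s = s0 then ?b \<tau> r else A r (\<sigma> s) (\<lambda>j. \<tau> (Inl j))) :: complex^'r^'r"
  define \<phi> where "\<phi> = (\<lambda>m \<tau>. if m \<in> range \<sigma>
    then det (?C (inv \<sigma> m) \<tau>) / system_minor A \<sigma> (\<lambda>j. \<tau> (Inl j)) else \<tau> (Inr m))"
  have b: "(\<lambda>\<tau>. ?b \<tau> r) \<in> pol J'" for r
    by (intro pol_uminus pol_sum pol_mult AJ pol_var) (auto simp: J'_def)
  have "rational_over J' (\<lambda>\<tau>. system_minor A \<sigma> (\<lambda>j. \<tau> (Inl j))) (\<phi> m)" if "m \<in> I" for m
  proof (cases "m \<in> range \<sigma>")
    case True
    have "(\<lambda>\<tau>. det (?C (inv \<sigma> m) \<tau>)) \<in> pol J'"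
    proof (rule pol_det)
      fix r s
      show "(\<lambda>\<tau>. ?C (inv \<sigma> m) \<tau> $ r $ s) \<in> pol J'"
        using b[of r] AJ[OF sI] by (cases "s = inv \<sigma> m") simp_all
    qed
    then show ?thesis
      using True unfolding \<phi>_def by (simp add: rational_over_divide)
  next
    case False
    then show ?thesis
      using that unfolding \<phi>_def by (simp add: rational_over_pol pol_var J'_def)
  qed
  moreover have "\<phi> m (case_sum t x) = x m"
    if t: "system_minor A \<sigma> t \<noteq> 0" and x: "\<forall>r. (\<Sum>m\<in>I. A r m t * x m) = 0" and m: "m \<in> I" for t x m
  proof (cases "m \<in> range \<sigma>")
    case True
    let ?M = "(\<chi> r s. A r (\<sigma> s) t) :: complex^'r^'r"
    let ?y = "(\<chi> s. x (\<sigma> s)) :: complex^'r"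
    let ?v = "(\<chi> r. ?b (case_sum t x) r) :: complex^'r"
    have "?M *v ?y = ?v"
    proof (simp add: vec_eq_iff matrix_vector_mult_def, intro allI)
      fix r
      have "0 = (\<Sum>m\<in>range \<sigma>. A r m t * x m) + (\<Sum>m\<in>I - range \<sigma>. A r m t * x m)"
        using x sum.subset_diff[OF assms(4,1), of "\<lambda>m. A r m t * x m"] by (simp add: add.commute)
      also have "(\<Sum>m\<in>range \<sigma>. A r m t * x m) = (\<Sum>s\<in>UNIV. A r (\<sigma> s) t * x (\<sigma> s))"
        using assms(3) by (simp add: sum.reindex)
      finally show "(\<Sum>s\<in>UNIV. A r (\<sigma> s) t * x (\<sigma> s)) = - (\<Sum>m\<in>I - range \<sigma>. A r m t * x m)"
        by (metis eq_neg_iff_add_eq_0)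
    qed
    then have "?y = (\<chi> k. det (\<chi> i j. if j = k then ?v $ i else ?M $ i $ j) / det ?M)"
      using cramer[OF t, of ?y ?v] by blast
    then have "?y $ inv \<sigma> m = det (\<chi> i j. if j = inv \<sigma> m then ?v $ i else ?M $ i $ j) / det ?M"
      by (simp add: vec_eq_iff)
    then show ?thesis
      using True unfolding \<phi>_def by (simp add: f_inv_into_f cong: if_cong)
  next
    case False
    then show ?thesis by (simp add: \<phi>_def)
  qed
  ultimately show "\<exists>\<phi>. (\<forall>m\<in>I. rational_over J' (\<lambda>\<tau>. system_minor A \<sigma> (\<lambda>j. \<tau> (Inl j))) (\<phi> m)) \<and>
      (\<forall>t x. system_minor A \<sigma> t \<noteq> 0 \<longrightarrow> (\<forall>r. (\<Sum>m\<in>I. A r m t * x m) = 0) \<longrightarrow>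
        (\<forall>m\<in>I. \<phi> m (case_sum t x) = x m))"
    by (intro exI[of _ \<phi>]) blast
qed

text \<open>Each equation eliminates one unknown. The count is written additively because
  subtraction of naturals truncates.\<close>

lemma card_system_variables:
  fixes \<sigma> :: "'r::finite \<Rightarrow> 'm"
  assumes "finite I" "finite (J :: 'j set)" "inj \<sigma>" "range \<sigma> \<subseteq> I"
  shows "card (Inl ` J \<union> Inr ` (I - range \<sigma>) :: ('j + 'm) set) + CARD('r) = card J + card I"
proof -
  have "card (Inl ` J \<union> Inr ` (I - range \<sigma>) :: ('j + 'm) set) = card J + card (I - range \<sigma>)"
    using assms by (subst card_Un_disjoint) (auto simp: card_image)
  moreover have "card (I - range \<sigma>) = card I - CARD('r)"
    using assms by (simp add: card_Diff_subset card_image)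
  moreover have "CARD('r) \<le> card I"
    using card_mono[OF assms(1,4)] assms(3) by (simp add: card_image)
  ultimately show ?thesis by simp
qed

text \<open>With at most as many parameters as equations, the pairs of a parameter \<open>t\<close>
  and a solution \<open>x\<close> are rational functions of at most \<open>card I\<close> free
  variables, so every polynomial \<open>G\<close> in the pair is algebraic over
  \<open>x\<close>.\<close>

lemma system_algebraic_relation:
  fixes A :: "'r::finite \<Rightarrow> 'm \<Rightarrow> ('j \<Rightarrow> complex) \<Rightarrow> complex"
  assumes "finite I" "finite J" "card J \<le> CARD('r)" "\<And>r m. m \<in> I \<Longrightarrow> A r m \<in> pol J"
    and "inj \<sigma>" "range \<sigma> \<subseteq> I" "G \<in> pol (Inl ` J \<union> Inr ` I)"
  shows "\<exists>N c. (\<forall>k. c k \<in> pol I) \<and> (\<exists>k\<le>N. \<exists>x. c k x \<noteq> 0) \<and>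
    (\<forall>t x. system_minor A \<sigma> t \<noteq> 0 \<longrightarrow> (\<forall>r. (\<Sum>m\<in>I. A r m t * x m) = 0) \<longrightarrow>
       (\<Sum>k\<le>N. c k x * G (case_sum t x) ^ k) = 0)"
proof -
  let ?J = "Inl ` J \<union> Inr ` (I - range \<sigma>)"
  let ?Q = "\<lambda>\<tau>. system_minor A \<sigma> (\<lambda>j. \<tau> (Inl j))"
  note * = linear_system_rational_solution[where A = A, OF assms(1,4,5,6)]
  obtain \<phi> where \<phi>: "\<And>m. m \<in> I \<Longrightarrow> rational_over ?J ?Q (\<phi> m)"
    "\<And>t x m. system_minor A \<sigma> t \<noteq> 0 \<Longrightarrow> (\<forall>r. (\<Sum>m\<in>I. A r m t * x m) = 0) \<Longrightarrow>
        m \<in> I \<Longrightarrow> \<phi> m (case_sum t x) = x m"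
    using *(2) by blast
  let ?h = "\<lambda>\<tau>. case_sum (\<lambda>j. \<tau> (Inl j)) (\<lambda>m. \<phi> m \<tau>)"
  have g: "rational_over ?J ?Q (\<lambda>\<tau>. G (?h \<tau>))"
  proof (rule rational_over_compose[OF assms(7) *(1)])
    fix i assume "i \<in> Inl ` J \<union> Inr ` I"
    then consider j where "j \<in> J" "i = Inl j" | m where "m \<in> I" "i = Inr m" by auto
    then show "rational_over ?J ?Q (\<lambda>\<tau>. ?h \<tau> i)"
    proof cases
      case 1
      then show ?thesis by (simp add: rational_over_pol pol_var)
    next
      case 2
      then show ?thesis using \<phi>(1) by simp
    qed
  qed
  have "card ?J \<le> card I"
    using card_system_variables[OF assms(1,2,5,6)] assms(3) by linarith
  then have "\<exists>N c. (\<forall>k. c k \<in> pol I) \<and> (\<exists>k\<le>N. \<exists>x. c k x \<noteq> 0) \<and>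
    (\<forall>\<tau>. ?Q \<tau> \<noteq> 0 \<longrightarrow> (\<Sum>k\<le>N. c k (\<lambda>i. \<phi> i \<tau>) * G (?h \<tau>) ^ k) = 0)"
    using assms(1,2) by (intro algebraic_relation[OF _ _ _ *(1) \<phi>(1) g]) auto
  then obtain N c where c: "\<And>k. c k \<in> pol I" "\<exists>k\<le>N. \<exists>x. c k x \<noteq> 0"
    "\<And>\<tau>. ?Q \<tau> \<noteq> 0 \<Longrightarrow> (\<Sum>k\<le>N. c k (\<lambda>i. \<phi> i \<tau>) * G (?h \<tau>) ^ k) = 0"
    by blast
  have "(\<Sum>k\<le>N. c k x * G (case_sum t x) ^ k) = 0"
    if t: "system_minor A \<sigma> t \<noteq> 0" and x: "\<forall>r. (\<Sum>m\<in>I. A r m t * x m) = 0" for t x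
  proof -
    have "c k (\<lambda>i. \<phi> i (case_sum t x)) = c k x" for k
      by (rule pol_cong[OF c(1)]) (rule \<phi>(2)[OF t x])
    moreover have "G (?h (case_sum t x)) = G (case_sum t x)"
      by (rule pol_cong[OF assms(7)]) (auto simp: \<phi>(2)[OF t x])
    ultimately show ?thesis
      using c(3)[of "case_sum t x"] t by simp
  qed
  then show ?thesis using c(1,2) by (intro exI[of _ N] exI[of _ c]) simp
qed

text \<open>A maximal independent set of columns has \<open>CARD('r)\<close> elements: for fewer, an
  underdetermined system would yield nonzero weights \<open>w\<close> that annihilate these columns
  and hence all columns.\<close>

lemma full_row_rank_minor:
  fixes a :: "'r::finite \<Rightarrow> 'm \<Rightarrow> complex"
  assumes "\<And>w. (\<And>m. m \<in> I \<Longrightarrow> (\<Sum>r\<in>UNIV. w r * a r m) = 0) \<Longrightarrow> w = (\<lambda>_. 0)"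
  shows "\<exists>\<sigma>. inj \<sigma> \<and> range \<sigma> \<subseteq> I \<and> det (\<chi> r s. a r (\<sigma> s)) \<noteq> 0"
proof -
  define v where "v = (\<lambda>m. (\<chi> r. a r m) :: complex^'r)"
  obtain B where B: "B \<subseteq> v ` I" "vec.independent B" "v ` I \<subseteq> vec.span B"
    using vec.maximal_independent_subset by blast
  have fin: "finite B" using B(2) vec.finiteI_independent by blast
  have "card B = CARD('r)"
  proof (rule ccontr)
    assume ne: "card B \<noteq> CARD('r)"
    have "card B \<le> CARD('r)"
      using vec.independent_bound_general[OF B(2)] vec.dim_subset_UNIV[of B]
      by (simp add: vec.dimension_def card_cart_basis)
    with ne have "card B < card (UNIV :: 'r set)" by simp
    then obtain w where w: "\<exists>r. w r \<noteq> 0" "\<forall>b\<in>B. (\<Sum>r\<in>UNIV. w r * b $ r) = 0"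
      using underdetermined_system[OF fin finite_class.finite_UNIV, of "\<lambda>r b. b $ r"] by auto
    have "(\<Sum>r\<in>UNIV. w r * x $ r) = 0" if "x \<in> vec.span B" for x
      using that
    proof (induction rule: vec.span_induct_alt)
      case base
      then show ?case by simp
    next
      case (step c b y)
      have "(\<Sum>r\<in>UNIV. w r * (c *s b + y) $ r) = c * (\<Sum>r\<in>UNIV. w r * b $ r) + (\<Sum>r\<in>UNIV. w r * y $ r)"
        by (simp add: algebra_simps sum.distrib sum_distrib_left)
      then show ?case using step w(2) by simp
    qed
    then have "(\<Sum>r\<in>UNIV. w r * a r m) = 0" if "m \<in> I" for m
      using that B(3) by (fastforce simp: v_def)
    then have "w = (\<lambda>_. 0)" by (rule assms)
    then show False using w(1) by simp
  qed
  then obtain \<beta> where \<beta>: "bij_betw \<beta> (UNIV :: 'r set) B"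
    using fin by (metis finite_class.finite_UNIV finite_same_card_bij)
  have "\<forall>s. \<exists>m\<in>I. v m = \<beta> s"
    using \<beta> B(1) by (metis UNIV_I bij_betwE image_iff subset_iff)
  then obtain \<sigma> where \<sigma>: "\<And>s. \<sigma> s \<in> I" "\<And>s. v (\<sigma> s) = \<beta> s" by metis
  have "inj \<sigma>"
    by (rule injI) (metis \<sigma>(2) \<beta> bij_betw_def injD)
  moreover have "det (\<chi> r s. a r (\<sigma> s)) \<noteq> 0"
  proof -
    let ?M = "(\<chi> r s. a r (\<sigma> s)) :: complex^'r^'r"
    have "x = 0" if "?M *v x = 0" for x
    proof -
      have "(\<Sum>s\<in>UNIV. x $ s *s \<beta> s) = 0"
        using that by (simp add: vec_eq_iff matrix_vector_mult_def mult.commute flip: \<sigma>(2)) (simp add: v_def)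
      moreover have "(\<Sum>s\<in>UNIV. x $ s *s \<beta> s) = (\<Sum>b\<in>B. x $ (inv_into UNIV \<beta> b) *s b)"
        using sum.reindex_bij_betw[OF \<beta>, of "\<lambda>b. x $ (inv_into UNIV \<beta> b) *s b"]
          bij_betw_inv_into_left[OF \<beta>] by simp
      ultimately have *: "(\<Sum>b\<in>B. x $ (inv_into UNIV \<beta> b) *s b) = 0"
        by simp
      have "\<forall>b\<in>B. x $ (inv_into UNIV \<beta> b) = 0"
        by (intro ballI vec.independentD[OF B(2) fin subset_refl *])
      then have "x $ s = 0" for s
        using \<beta> by (metis UNIV_I bij_betwE bij_betw_inv_into_left)
      then show ?thesis by (simp add: vec_eq_iff)
    qed
    then have "\<exists>N. N ** ?M = mat 1"
      using matrix_left_invertible_ker by blast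
    then have "invertible ?M"
      by (simp only: invertible_left_inverse)
    then show ?thesis
      by (rule invertible_det_nz[THEN iffD1])
  qed
  ultimately show ?thesis using \<sigma>(1) by blast
qed

text \<open>Independent rows have a nonzero minor, and there are finitely many minors. Where a given
  one is nonzero, Cramer's rule parametrizes the solutions by fewer than \<open>card I\<close>
  variables.\<close>

lemma thin_linear_family:
  fixes A :: "'r::finite \<Rightarrow> 'm \<Rightarrow> ('j \<Rightarrow> complex) \<Rightarrow> complex"
  assumes "finite I" "finite J" "card J < CARD('r)" "\<And>r m. m \<in> I \<Longrightarrow> A r m \<in> pol J"
  shows "thin I {x. \<exists>t. (\<forall>r. (\<Sum>m\<in>I. A r m t * x m) = 0) \<and>
    (\<forall>w. (\<forall>m\<in>I. (\<Sum>r\<in>UNIV. w r * A r m t) = 0) \<longrightarrow> w = (\<lambda>_. 0))}" (is "thin I ?B")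
proof -
  define S where "S = {\<sigma> :: 'r \<Rightarrow> 'm. inj \<sigma> \<and> range \<sigma> \<subseteq> I}"
  let ?C = "\<lambda>\<sigma>. {x. \<exists>t. (\<forall>r. (\<Sum>m\<in>I. A r m t * x m) = 0) \<and> system_minor A \<sigma> t \<noteq> 0}"
  have "finite (PiE (UNIV :: 'r set) (\<lambda>_. I))"
    using assms(1) by (intro finite_PiE) auto
  moreover have "S \<subseteq> PiE UNIV (\<lambda>_. I)" unfolding S_def by auto
  ultimately have finS: "finite S" by (rule rev_finite_subset)
  have "thin I (?C \<sigma>)" if "\<sigma> \<in> S" for \<sigma>
  proof -
    have \<sigma>: "inj \<sigma>" "range \<sigma> \<subseteq> I" using that by (auto simp: S_def)
    let ?J = "Inl ` J \<union> Inr ` (I - range \<sigma>)"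
    let ?Q = "\<lambda>\<tau>. system_minor A \<sigma> (\<lambda>j. \<tau> (Inl j))"
    note * = linear_system_rational_solution[where A = A, OF assms(1,4) \<sigma>]
    obtain \<phi> where \<phi>: "\<And>m. m \<in> I \<Longrightarrow> rational_over ?J ?Q (\<phi> m)"
      "\<And>t x m. system_minor A \<sigma> t \<noteq> 0 \<Longrightarrow> (\<forall>r. (\<Sum>m\<in>I. A r m t * x m) = 0) \<Longrightarrow>
          m \<in> I \<Longrightarrow> \<phi> m (case_sum t x) = x m"
      using *(2) by blast
    have card: "card ?J < card I"
      using card_system_variables[OF assms(1,2) \<sigma>] assms(3) by linarith
    have "thin I {x. \<exists>\<tau>. ?Q \<tau> \<noteq> 0 \<and> (\<forall>m\<in>I. x m = \<phi> m \<tau>)}"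
      by (rule thin_rational_image[OF assms(1) _ card *(1) \<phi>(1)]) (use assms in auto)
    then show ?thesis
    proof (rule thin_subset, intro subsetI)
      fix x assume "x \<in> ?C \<sigma>"
      then obtain t where t: "\<forall>r. (\<Sum>m\<in>I. A r m t * x m) = 0" "system_minor A \<sigma> t \<noteq> 0"
        by blast
      have "\<forall>m\<in>I. x m = \<phi> m (case_sum t x)"
        by (intro ballI \<phi>(2)[OF t(2,1), symmetric])
      then show "x \<in> {x. \<exists>\<tau>. ?Q \<tau> \<noteq> 0 \<and> (\<forall>m\<in>I. x m = \<phi> m \<tau>)}"
        using t(2) by (intro CollectI exI[of _ "case_sum t x"] conjI) simp_all
    qed
  qed
  then have "thin I (\<Union>\<sigma>\<in>S. ?C \<sigma>)" by (intro thin_UN[OF finS])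
  then show ?thesis
  proof (rule thin_subset, intro subsetI)
    fix x assume "x \<in> ?B"
    then obtain t where t: "\<forall>r. (\<Sum>m\<in>I. A r m t * x m) = 0"
      "\<And>w. \<forall>m\<in>I. (\<Sum>r\<in>UNIV. w r * A r m t) = 0 \<Longrightarrow> w = (\<lambda>_. 0)" by blast
    have "\<exists>\<sigma>. inj \<sigma> \<and> range \<sigma> \<subseteq> I \<and> system_minor A \<sigma> t \<noteq> 0"
      by (rule full_row_rank_minor) (use t(2) in blast)
    then obtain \<sigma> where "\<sigma> \<in> S" "system_minor A \<sigma> t \<noteq> 0" unfolding S_def by auto
    then show "x \<in> (\<Union>\<sigma>\<in>S. ?C \<sigma>)" using t(1) by (intro UN_I[of \<sigma>]) auto
  qed
qed

section \<open>Forms and their derivatives\<close>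

abbreviation lookup :: "('a \<Rightarrow>\<^sub>0 'b::zero) \<Rightarrow> 'a \<Rightarrow> 'b" where
  "lookup \<equiv> Poly_Mapping.lookup"

abbreviation single :: "'a \<Rightarrow> 'b \<Rightarrow> 'a \<Rightarrow>\<^sub>0 'b::zero" where
  "single \<equiv> Poly_Mapping.single"

abbreviation keys :: "('a \<Rightarrow>\<^sub>0 'b::zero) \<Rightarrow> 'a set" where
  "keys \<equiv> Poly_Mapping.keys"

definition monoms :: "nat \<Rightarrow> ('v \<Rightarrow>\<^sub>0 nat) set" where
  "monoms d = {m. monom_degree m = d}"

lemma monom_degree_UNIV: "monom_degree (m :: 'v::finite \<Rightarrow>\<^sub>0 nat) = (\<Sum>v\<in>UNIV. lookup m v)"
  by (rule monom_degree_superset) auto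

lemma monom_eval_UNIV: "monom_eval a (m :: 'v::finite \<Rightarrow>\<^sub>0 nat) = (\<Prod>v\<in>UNIV. a v ^ lookup m v)"
  by (rule monom_eval_superset) auto

lemma monom_degree_single [simp]: "monom_degree (single k c) = c"
  by (simp add: monom_degree_def)

lemma monom_eval_single [simp]: "monom_eval a (single k c) = a k ^ c"
  by (simp add: monom_eval_def)

lemma monom_eval_zero [simp]: "monom_eval a 0 = 1"
  by (simp add: monom_eval_def)

lemma monom_degree_zero [simp]: "monom_degree 0 = 0"
  by (simp add: monom_degree_def)

lemma finite_monoms: "finite (monoms d :: ('v::finite \<Rightarrow>\<^sub>0 nat) set)"
proof -
  have "lookup ` (monoms d :: ('v \<Rightarrow>\<^sub>0 nat) set) \<subseteq> PiE UNIV (\<lambda>_. {..d})"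
  proof
    fix h assume "h \<in> lookup ` (monoms d :: ('v \<Rightarrow>\<^sub>0 nat) set)"
    then obtain m :: "'v \<Rightarrow>\<^sub>0 nat" where m: "(\<Sum>v\<in>UNIV. lookup m v) = d" "h = lookup m"
      by (auto simp: monoms_def monom_degree_UNIV)
    have "lookup m v \<le> d" for v
      using member_le_sum[of v UNIV "lookup m"] m(1) by simp
    then show "h \<in> PiE UNIV (\<lambda>_. {..d})" using m(2) by auto
  qed
  moreover have "finite (PiE (UNIV :: 'v set) (\<lambda>_. {..d}))"
    by (intro finite_PiE) auto
  ultimately have "finite (lookup ` (monoms d :: ('v \<Rightarrow>\<^sub>0 nat) set))"
    by (rule finite_subset)
  then show ?thesis
    by (rule finite_imageD) (auto simp: inj_on_def poly_mapping_eqI)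
qed

lemma keys_form: "f \<in> forms d \<Longrightarrow> keys f \<subseteq> monoms d"
  by (auto simp: forms_def homogeneous_def monoms_def)

lemma formsI: "keys f \<subseteq> monoms d \<Longrightarrow> f \<in> forms d"
  by (auto simp: forms_def homogeneous_def monoms_def)

lemma cpoly_eval_form:
  fixes f :: "'v::finite cpoly"
  assumes "f \<in> forms d"
  shows "cpoly_eval a f = (\<Sum>m\<in>monoms d. lookup f m * monom_eval a m)"
  by (rule cpoly_eval_superset[OF finite_monoms keys_form[OF assms]])

text \<open>Coefficient vectors are arbitrary functions on all monomials, and those of degree other
  than \<open>d\<close> are ignored. Genericity can so be stated for total functions.\<close>

definition form_of :: "nat \<Rightarrow> (('v \<Rightarrow>\<^sub>0 nat) \<Rightarrow> complex) \<Rightarrow> 'v cpoly" where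
  "form_of d c = (\<Sum>m\<in>monoms d. single m (c m))"

lemma lookup_form_of:
  "lookup (form_of d c :: 'v::finite cpoly) m = (if m \<in> monoms d then c m else 0)"
  by (auto simp: form_of_def lookup_sum lookup_single when_def finite_monoms)

lemma form_of_in_forms: "(form_of d c :: 'v::finite cpoly) \<in> forms d"
  by (rule formsI) (auto simp: in_keys_iff lookup_form_of split: if_splits)

lemma form_of_lookup:
  assumes "f \<in> forms d"
  shows "form_of d (lookup f) = (f :: 'v::finite cpoly)"
  using keys_form[OF assms]
  by (intro poly_mapping_eqI) (auto simp: lookup_form_of in_keys_iff)

text \<open>The weight with which the coefficient of \<open>m\<close> enters the partial derivative
  \<open>k\<close> at \<open>a\<close>. Where the exponent truncates, the factor
  \<open>lookup m k\<close> is 0.\<close>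

definition monom_deriv :: "('v \<Rightarrow> complex) \<Rightarrow> 'v \<Rightarrow> ('v \<Rightarrow>\<^sub>0 nat) \<Rightarrow> complex" where
  "monom_deriv a k m = of_nat (lookup m k) * monom_eval a (m - single k 1)"

lemma cpoly_eval_sum: "cpoly_eval a (\<Sum>i\<in>A. p i) = (\<Sum>i\<in>A. cpoly_eval a (p i))"
  by (induction A rule: infinite_finite_induct) (auto simp: cpoly_eval_add)

lemma cpoly_eval_one [simp]: "cpoly_eval a 1 = 1"
proof -
  have "cpoly_eval a (single 0 1) = 1" by (simp only: cpoly_eval_single) simp
  then show ?thesis by simp
qed

lemma cpoly_eval_prod: "cpoly_eval a (\<Prod>i\<in>A. p i) = (\<Prod>i\<in>A. cpoly_eval a (p i))"
  by (induction A rule: infinite_finite_induct) (auto simp: cpoly_eval_mult)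

lemma cpoly_eval_power: "cpoly_eval a (p ^ k) = cpoly_eval a p ^ k"
  by (induction k) (auto simp: cpoly_eval_mult)

lemma cpoly_eval_partial_deriv:
  "cpoly_eval a (partial_deriv k p) = (\<Sum>m\<in>keys p. lookup p m * monom_deriv a k m)"
  unfolding partial_deriv_def cpoly_eval_sum by (simp add: monom_deriv_def mult_ac)

lemma gradient_form:
  fixes f :: "'v::finite cpoly"
  assumes "f \<in> forms d"
  shows "gradient f x $ k = (\<Sum>m\<in>monoms d. lookup f m * monom_deriv (($) x) k m)"
  unfolding gradient_def using keys_form[OF assms]
  by (simp add: cpoly_eval_partial_deriv, intro sum.mono_neutral_left)
     (auto simp: finite_monoms in_keys_iff)

lemma lookup_partial_deriv:
  "lookup (partial_deriv k p) m = of_nat (lookup m k + 1) * lookup p (m + single k 1)"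
proof -
  \<comment> \<open>The second conjunct excludes truncation, by which a monomial without the
    variable \<open>k\<close> would be sent to itself.\<close>
  have *: "m' - single k 1 = m \<and> lookup m' k \<noteq> 0 \<longleftrightarrow> m' = m + single k 1" for m' :: "'a \<Rightarrow>\<^sub>0 nat"
  proof
    assume *: "m' - single k 1 = m \<and> lookup m' k \<noteq> 0"
    show "m' = m + single k 1"
    proof (rule poly_mapping_eqI)
      fix v
      have "lookup m v = lookup m' v - lookup (single k 1) v"
        using * by (auto simp: lookup_minus)
      then show "lookup m' v = lookup (m + single k 1) v"
        using * by (auto simp: lookup_add lookup_single when_def)
    qed
  next
    assume "m' = m + single k 1"
    then show "m' - single k 1 = m \<and> lookup m' k \<noteq> 0"
      by (simp add: lookup_add)
  qed
  have "lookup (partial_deriv k p) m = (\<Sum>m'\<in>keys p.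
      (of_nat (lookup m' k) * lookup p m' when m' - single k 1 = m))"
    by (simp add: partial_deriv_def lookup_sum lookup_single)
  also have "\<dots> = (\<Sum>m'\<in>keys p. 
      if m' = m + single k 1 then of_nat (lookup m' k) * lookup p m' else 0)"
  proof (intro sum.cong refl)
    fix m'
    show "(of_nat (lookup m' k) * lookup p m' when m' - single k 1 = m) =
      (if m' = m + single k 1 then of_nat (lookup m' k) * lookup p m' else 0)"
      by (cases "lookup m' k = 0") (use *[of m'] in \<open>simp_all add: when_def del: One_nat_def\<close>)
  qed
  also have "\<dots> = of_nat (lookup m k + 1) * lookup p (m + single k 1)"
    by (auto simp: lookup_add in_keys_iff)
  finally show ?thesis .
qed

lemma partial_deriv_form:
  assumes "f \<in> forms d"
  shows "partial_deriv k f \<in> forms (d - 1)"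
proof (rule formsI, rule subsetI)
  fix m assume "m \<in> keys (partial_deriv k f)"
  then have "m + single k 1 \<in> keys f"
    by (auto simp: in_keys_iff lookup_partial_deriv)
  then have "monom_degree m + 1 = d"
    using keys_form[OF assms] by (auto simp: monoms_def monom_degree_add)
  then show "m \<in> monoms (d - 1)" by (simp add: monoms_def)
qed

lemma partial_deriv_commute:
  "partial_deriv k (partial_deriv l p) = partial_deriv l (partial_deriv k p)"
  by (rule poly_mapping_eqI)
     (auto simp: lookup_partial_deriv lookup_add lookup_single when_def algebra_simps)

section \<open>Gradients, Hessians and Euler's formulas\<close>

lemma has_derivative_vec_lambda:
  fixes f :: "'v::finite \<Rightarrow> 'a::real_normed_vector \<Rightarrow> complex"
  assumes "\<And>k. (f k has_derivative f' k) (at x within S)"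
  shows "((\<lambda>x. \<chi> k. f k x) has_derivative (\<lambda>v. \<chi> k. f' k v)) (at x within S)"
  by (subst has_derivative_componentwise_within)
     (auto simp: Basis_vec_def inner_axis intro!: has_derivative_inner_left assms)

lemma has_derivative_vec_nth: "((\<lambda>x. x $ k) has_derivative (\<lambda>v. v $ k)) (at x within S)"
  by (rule bounded_linear_imp_has_derivative[OF bounded_linear_vec_nth])

lemma monom_eval_has_derivative:
  "((\<lambda>x. monom_eval (($) x) m) has_derivative (\<lambda>v. \<Sum>k\<in>UNIV. monom_deriv (($) x) k m * v $ k)) (at (x :: complex^'v::finite))"
proof -
  have "((\<lambda>x. \<Prod>k\<in>UNIV. x $ k ^ lookup m k) has_derivative
      (\<lambda>v. \<Sum>k\<in>UNIV. (of_nat (lookup m k) * (v $ k * x $ k ^ (lookup m k - 1))) *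
        (\<Prod>j\<in>UNIV - {k}. x $ j ^ lookup m j))) (at x)"
    by (intro has_derivative_prod has_derivative_eq_rhs[OF has_derivative_power[OF has_derivative_vec_nth]])
       (simp add: mult_ac)
  moreover have "(of_nat (lookup m k) * (v $ k * x $ k ^ (lookup m k - 1))) *
        (\<Prod>j\<in>UNIV - {k}. x $ j ^ lookup m j) = monom_deriv (($) x) k m * v $ k" for v k
  proof -
    have "monom_eval (($) x) (m - single k 1) =
       x $ k ^ (lookup m k - 1) * (\<Prod>j\<in>UNIV - {k}. x $ j ^ lookup m j)"
      unfolding monom_eval_UNIV
      by (subst prod.remove[of UNIV k]) (auto simp: lookup_minus lookup_single when_def intro!: prod.cong)
    then show ?thesis by (simp add: monom_deriv_def)
  qed
  ultimately show ?thesis by (simp only: monom_eval_UNIV)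
qed

lemma cpoly_eval_has_derivative:
  "((\<lambda>x. cpoly_eval (($) x) f) has_derivative (\<lambda>v. \<Sum>k\<in>UNIV. gradient f x $ k * v $ k)) (at (x :: complex^'v::finite))"
proof -
  have "((\<lambda>x. \<Sum>m\<in>keys f. lookup f m * monom_eval (($) x) m) has_derivative
     (\<lambda>v. \<Sum>m\<in>keys f. lookup f m * (\<Sum>k\<in>UNIV. monom_deriv (($) x) k m * v $ k))) (at x)"
    by (intro has_derivative_sum has_derivative_mult_right monom_eval_has_derivative)
  moreover have "(\<Sum>m\<in>keys f. lookup f m * (\<Sum>k\<in>UNIV. monom_deriv (($) x) k m * v $ k)) =
      (\<Sum>k\<in>UNIV. gradient f x $ k * v $ k)" for v
    unfolding gradient_def cpoly_eval_partial_deriv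
    by (simp add: sum_distrib_left sum_distrib_right mult_ac) (rule sum.swap)
  ultimately show ?thesis by (simp add: cpoly_eval_def)
qed

definition hessian :: "'v::finite cpoly \<Rightarrow> complex^'v \<Rightarrow> complex^'v^'v" where
  "hessian f x = (\<chi> k l. cpoly_eval (($) x) (partial_deriv l (partial_deriv k f)))"

lemma hessian_sym: "hessian f x $ k $ l = hessian f x $ l $ k"
  by (simp add: hessian_def partial_deriv_commute[of k l])

lemma gradient_has_derivative:
  "(gradient f has_derivative (\<lambda>v. hessian f x *v v)) (at (x :: complex^'v::finite))"
proof -
  have "((\<lambda>x. \<chi> k. cpoly_eval (($) x) (partial_deriv k f)) has_derivative
     (\<lambda>v. \<chi> k. \<Sum>l\<in>UNIV. gradient (partial_deriv k f) x $ l * v $ l)) (at x)"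
    by (intro has_derivative_vec_lambda cpoly_eval_has_derivative)
  then show ?thesis
    by (simp add: gradient_def[abs_def] hessian_def matrix_vector_mult_def)
qed

lemma continuous_on_cpoly_eval: "continuous_on S (\<lambda>x :: complex^'v::finite. cpoly_eval (($) x) f)"
  by (intro continuous_at_imp_continuous_on ballI) (rule has_derivative_continuous[OF cpoly_eval_has_derivative])

lemma continuous_on_gradient: "continuous_on S (gradient f :: complex^'v::finite \<Rightarrow> _)"
  by (intro continuous_at_imp_continuous_on ballI) (rule has_derivative_continuous[OF gradient_has_derivative])

lemma continuous_on_hessian: "continuous_on S (\<lambda>x :: complex^'v::finite. hessian f x $ k $ l)"
  unfolding hessian_def by (simp add: continuous_on_cpoly_eval)

lemma monom_deriv_euler:
  "(\<Sum>k\<in>UNIV. a k * monom_deriv a k m) = of_nat (monom_degree m) * monom_eval a (m :: 'v::finite \<Rightarrow>\<^sub>0 nat)"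
proof -
  have "a k * monom_deriv a k m = of_nat (lookup m k) * monom_eval a m" for k
  proof (cases "lookup m k = 0")
    case False
    have "m = single k 1 + (m - single k 1)"
      using False by (intro poly_mapping_eqI) (auto simp: lookup_add lookup_minus lookup_single when_def)
    then have "monom_eval a m = a k * monom_eval a (m - single k 1)"
      by (metis monom_eval_add monom_eval_single power_one_right)
    then show ?thesis by (simp add: monom_deriv_def)
  qed (simp add: monom_deriv_def)
  then show ?thesis
    by (simp add: monom_degree_UNIV sum_distrib_right)
qed

lemma euler_gradient:
  fixes f :: "'v::finite cpoly"
  assumes "f \<in> forms d"
  shows "(\<Sum>k\<in>UNIV. gradient f x $ k * x $ k) = of_nat d * cpoly_eval (($) x) f"
proof -
  have "(\<Sum>k\<in>UNIV. gradient f x $ k * x $ k) =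
    (\<Sum>m\<in>monoms d. lookup f m * (\<Sum>k\<in>UNIV. x $ k * monom_deriv (($) x) k m))"
    by (simp add: gradient_form[OF assms] sum_distrib_left sum_distrib_right mult_ac) (rule sum.swap)
  also have "\<dots> = of_nat d * cpoly_eval (($) x) f"
    unfolding monom_deriv_euler cpoly_eval_form[OF assms] sum_distrib_left
    by (rule sum.cong) (auto simp: monoms_def)
  finally show ?thesis .
qed

lemma euler_hessian:
  fixes f :: "'v::finite cpoly"
  assumes "f \<in> forms d"
  shows "hessian f x *v x = of_nat (d - 1) *s gradient f x"
  using euler_gradient[OF partial_deriv_form[OF assms], where x = x]
  by (simp add: vec_eq_iff matrix_vector_mult_def hessian_def gradient_def)

lemma gradient_scale_arg:
  fixes f :: "'v::finite cpoly"
  assumes "f \<in> forms d"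
  shows "gradient f (c *s x) = c ^ (d - 1) *s gradient f x"
proof -
  have "homogeneous (d - 1) (partial_deriv k f)" for k
    using partial_deriv_form[OF assms] by (simp add: forms_def)
  from cpoly_eval_homogeneous_scale[OF this, where c = c and a = "($) x"]
  have "cpoly_eval (($) (c *s x)) (partial_deriv k f) = c ^ (d - 1) * cpoly_eval (($) x) (partial_deriv k f)" for k
    by (simp only: vector_smult_component[abs_def])
  then show ?thesis
    by (simp only: gradient_def vec_eq_iff vec_lambda_beta vector_smult_component simp_thms)
qed

lemma cpoly_eval_scale_arg:
  fixes f :: "'v::finite cpoly"
  assumes "f \<in> forms d"
  shows "cpoly_eval (($) (c *s x)) f = c ^ d * cpoly_eval (($) x) f"
  using cpoly_eval_homogeneous_scale[of d f c "($) x"] assms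
  by (simp add: forms_def vector_smult_component[abs_def])

lemma directional_derivative:
  fixes f :: "'v::finite cpoly"
  shows "((\<lambda>t. cpoly_eval (($) (x + t *s v)) f) has_field_derivative
     (\<Sum>k\<in>UNIV. gradient f x $ k * v $ k)) (at 0)"
proof -
  have l: "((\<lambda>t. x + t *s v) has_derivative (\<lambda>t. t *s v)) (at 0)"
    unfolding has_derivative_componentwise_within[of "\<lambda>t. x + t *s v"]
    by (auto intro!: derivative_eq_intros simp: Basis_vec_def inner_axis)
  have "((\<lambda>t. cpoly_eval (($) (x + t *s v)) f) has_derivative
      (\<lambda>t. \<Sum>k\<in>UNIV. gradient f x $ k * (t *s v) $ k)) (at 0)"
  proof (rule has_derivative_compose[OF l])
    show "((\<lambda>x. cpoly_eval (($) x) f) has_derivative (\<lambda>v. \<Sum>k\<in>UNIV. gradient f x $ k * v $ k)) (at (x + 0 *s v))"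
      using cpoly_eval_has_derivative[of f x] by simp
  qed
  moreover have "(\<lambda>t. \<Sum>k\<in>UNIV. gradient f x $ k * (t *s v) $ k) = (*) (\<Sum>k\<in>UNIV. gradient f x $ k * v $ k)"
    by (auto simp: sum_distrib_left sum_distrib_right mult_ac)
  ultimately show ?thesis by (simp add: has_field_derivative_def)
qed

section \<open>Construction of forms\<close>

definition linear_form :: "('v \<Rightarrow> complex) \<Rightarrow> 'v::finite cpoly" where
  "linear_form a = (\<Sum>k\<in>UNIV. single (single k 1) (a k))"

lemma cpoly_eval_linear_form: "cpoly_eval x (linear_form a) = (\<Sum>k\<in>UNIV. a k * x k)"
  by (simp add: linear_form_def cpoly_eval_sum)

lemma homogeneous_add: "homogeneous d p \<Longrightarrow> homogeneous d q \<Longrightarrow> homogeneous d (p + q)"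
  using keys_add[of p q] by (auto simp: homogeneous_def)

lemma homogeneous_zero [simp]: "homogeneous d 0"
  by (simp add: homogeneous_def)

lemma homogeneous_sum: "(\<And>i. i \<in> A \<Longrightarrow> homogeneous d (p i)) \<Longrightarrow> homogeneous d (\<Sum>i\<in>A. p i)"
  by (induction A rule: infinite_finite_induct) (auto intro: homogeneous_add)

lemma homogeneous_single: "homogeneous (monom_degree m) (single m c)"
  by (simp add: homogeneous_def)

lemma homogeneous_one: "homogeneous 0 1"
  using homogeneous_single[of 0 1] by simp

lemma homogeneous_linear_form: "homogeneous 1 (linear_form a)"
  unfolding linear_form_def
  by (intro homogeneous_sum) (metis homogeneous_single monom_degree_single)

lemma homogeneous_power: "homogeneous d p \<Longrightarrow> homogeneous (k * d) (p ^ k)"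
  by (induction k) (auto simp: homogeneous_one intro: homogeneous_mult)

lemma homogeneous_prod:
  "finite A \<Longrightarrow> (\<And>i. i \<in> A \<Longrightarrow> homogeneous (e i) (p i)) \<Longrightarrow> homogeneous (\<Sum>i\<in>A. e i) (\<Prod>i\<in>A. p i)"
  by (induction A rule: finite_induct) (auto simp: homogeneous_one intro: homogeneous_mult)

text \<open>Source of the test forms: with linear forms dual to given points, such a product
  restricts to a prescribed monomial.\<close>

lemma ex_product_form:
  fixes L :: "'i::finite \<Rightarrow> 'v::finite \<Rightarrow> complex"
  shows "\<exists>f\<in>forms (\<Sum>i\<in>UNIV. e i). \<forall>x. cpoly_eval x f = (\<Prod>i\<in>UNIV. (\<Sum>k\<in>UNIV. L i k * x k) ^ e i)"
proof (intro bexI allI)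
  show "cpoly_eval x (\<Prod>i\<in>UNIV. linear_form (L i) ^ e i) = (\<Prod>i\<in>UNIV. (\<Sum>k\<in>UNIV. L i k * x k) ^ e i)" for x
    by (simp add: cpoly_eval_prod cpoly_eval_power cpoly_eval_linear_form)
  show "(\<Prod>i\<in>UNIV. linear_form (L i) ^ e i) \<in> forms (\<Sum>i\<in>UNIV. e i)"
  proof -
    have "homogeneous (e i) (linear_form (L i) ^ e i)" for i
      using homogeneous_power[OF homogeneous_linear_form, of "e i" "L i"] by simp
    then show ?thesis
      unfolding forms_def using homogeneous_prod[of UNIV e "\<lambda>i. linear_form (L i) ^ e i"] by simp
  qed
qed

text \<open>Restriction of \<open>f\<close> to the span of the vectors \<open>p i\<close>, in the
  coordinates along them.\<close>

lemma ex_linear_substitution: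
  fixes f :: "'v::finite cpoly" and p :: "'i::finite \<Rightarrow> 'v \<Rightarrow> complex"
  assumes "f \<in> forms d"
  shows "\<exists>g\<in>forms d. \<forall>y. cpoly_eval y g = cpoly_eval (\<lambda>k. \<Sum>i\<in>UNIV. y i * p i k) f"
proof (intro bexI allI)
  let ?g = "\<Sum>m\<in>keys f. single 0 (lookup f m) *
      (\<Prod>k\<in>UNIV. linear_form (\<lambda>i. p i k) ^ lookup m k)"
  show "cpoly_eval y ?g = cpoly_eval (\<lambda>k. \<Sum>i\<in>UNIV. y i * p i k) f" for y
    by (simp add: cpoly_eval_sum cpoly_eval_mult cpoly_eval_prod cpoly_eval_power
        cpoly_eval_linear_form cpoly_eval_def[of _ f] monom_eval_UNIV mult.commute)
  have "homogeneous d (single 0 (lookup f m) * (\<Prod>k\<in>UNIV. linear_form (\<lambda>i. p i k) ^ lookup m k))"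
    if "m \<in> keys f" for m
  proof -
    have "homogeneous (0 + (\<Sum>k\<in>UNIV. lookup m k * 1))
       (single 0 (lookup f m) * (\<Prod>k\<in>UNIV. linear_form (\<lambda>i. p i k) ^ lookup m k))"
      using homogeneous_single[of "0::'i \<Rightarrow>\<^sub>0 nat" "lookup f m"]
      by (intro homogeneous_mult homogeneous_prod homogeneous_power homogeneous_linear_form) auto
    then show ?thesis
      using keys_form[OF assms] that by (auto simp: monoms_def monom_degree_UNIV)
  qed
  then show "?g \<in> forms d"
    unfolding forms_def by (auto intro: homogeneous_sum)
qed

text \<open>The way back to formal polynomials, in terms of which the Zariski topology is
  defined.\<close>

lemma pol_imp_cpoly:
  assumes "F \<in> pol I"
  shows "\<exists>p. \<forall>x. F x = cpoly_eval x p"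
  using assms
proof (induction rule: pol.induct)
  case (pol_const c)
  show ?case by (intro exI[of _ "single 0 c"]) simp
next
  case (pol_var j)
  show ?case by (intro exI[of _ "single (single j 1) 1"]) simp
next
  case (pol_add F G)
  then obtain p q where "\<forall>x. F x = cpoly_eval x p" "\<forall>x. G x = cpoly_eval x q" by blast
  then show ?case by (intro exI[of _ "p + q"]) (simp add: cpoly_eval_add)
next
  case (pol_mult F G)
  then obtain p q where "\<forall>x. F x = cpoly_eval x p" "\<forall>x. G x = cpoly_eval x q" by blast
  then show ?case by (intro exI[of _ "p * q"]) (simp add: cpoly_eval_mult)
qed

lemma pol_monom_eval:
  assumes "\<And>k. (\<lambda>t. x t k) \<in> pol J"
  shows "(\<lambda>t. monom_eval (x t) (m :: 'v::finite \<Rightarrow>\<^sub>0 nat)) \<in> pol J"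
  unfolding monom_eval_UNIV by (intro pol_prod pol_power assms)

lemma pol_monom_deriv:
  assumes "\<And>k. (\<lambda>t. x t k) \<in> pol J"
  shows "(\<lambda>t. monom_deriv (x t) k (m :: 'v::finite \<Rightarrow>\<^sub>0 nat)) \<in> pol J"
  unfolding monom_deriv_def by (intro pol_mult pol_const pol_monom_eval assms)

lemma gradient_form_of:
  "gradient (form_of d c :: 'v::finite cpoly) x $ k = (\<Sum>m\<in>monoms d. monom_deriv (($) x) k m * c m)"
  by (simp add: gradient_form[OF form_of_in_forms] lookup_form_of mult.commute)

lemma hessian_form_of:
  assumes "d \<ge> 2"
  shows "hessian (form_of d c :: 'v::finite cpoly) x $ k $ l =
    (\<Sum>m\<in>monoms (d - 2). of_nat (lookup m l + 1) *
      (of_nat (lookup (m + single l 1) k + 1) *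
        c (m + single l 1 + single k 1)) * monom_eval (($) x) m)"
proof -
  have "partial_deriv l (partial_deriv k (form_of d c)) \<in> forms (d - 1 - 1)"
    by (intro partial_deriv_form form_of_in_forms)
  then have 1: "partial_deriv l (partial_deriv k (form_of d c)) \<in> forms (d - 2)"
    by (simp add: numeral_2_eq_2)
  have "m + single l 1 + single k 1 \<in> monoms d" if "m \<in> monoms (d - 2)" for m
    using that assms by (simp add: monoms_def monom_degree_add)
  then show ?thesis
    unfolding hessian_def vec_lambda_beta cpoly_eval_form[OF 1]
    by (intro sum.cong refl) (simp only: lookup_partial_deriv lookup_form_of if_True)
qed

section \<open>Derivatives at coordinate points\<close>

lemma monom_eval_coordinate_point:
  "monom_eval (\<lambda>u. if u = v then 1 else 0) (m :: 'v::finite \<Rightarrow>\<^sub>0 nat) =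
    (if m = single v (monom_degree m) then 1 else 0)"
proof (cases "m = single v (monom_degree m)")
  case True
  have "monom_eval (\<lambda>u. if u = v then 1 else 0) (single v (monom_degree m)) = 1"
    by (simp only: monom_eval_single) simp
  then show ?thesis using True by simp
next
  case False
  have "\<exists>u. u \<noteq> v \<and> lookup m u \<noteq> 0"
  proof (rule ccontr)
    assume *: "\<not> (\<exists>u. u \<noteq> v \<and> lookup m u \<noteq> 0)"
    then have "monom_degree m = lookup m v"
      unfolding monom_degree_UNIV by (subst sum.remove[of UNIV v]) auto
    then have "m = single v (monom_degree m)"
      using * by (intro poly_mapping_eqI) (auto simp: lookup_single when_def)
    then show False using False by blast
  qed
  then obtain u where "u \<noteq> v" "lookup m u \<noteq> 0" by blast
  then have "monom_eval (\<lambda>u. if u = v then 1 else 0) m = 0"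
    unfolding monom_eval_UNIV by (intro prod_zero) (auto intro!: bexI[of _ u])
  then show ?thesis using False by simp
qed

lemma monom_deriv_coordinate_point:
  assumes "m \<in> monoms d" "d \<ge> 1"
  shows "monom_deriv (\<lambda>u. if u = v then 1 else 0) k (m :: 'v::finite \<Rightarrow>\<^sub>0 nat) =
    (if m = single v (d - 1) + single k 1 then of_nat (lookup m k) else 0)"
proof (cases "lookup m k = 0")
  case True
  then show ?thesis by (auto simp: monom_deriv_def)
next
  case False
  let ?m = "m - single k 1"
  have m: "m = ?m + single k 1"
    using False by (intro poly_mapping_eqI) (auto simp: lookup_add lookup_minus lookup_single when_def)
  have "monom_degree m = monom_degree ?m + 1"
    by (subst m) (simp only: monom_degree_add monom_degree_single)
  then have deg: "monom_degree ?m = d - 1"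
    using assms by (simp add: monoms_def)
  have "?m = single v (d - 1) \<longleftrightarrow> m = single v (d - 1) + single k 1"
    using m by (metis add_right_cancel)
  then show ?thesis
    unfolding monom_deriv_def monom_eval_coordinate_point deg by simp
qed

text \<open>Coordinate points isolate single coefficients. The numerical factor is \<open>d\<close>
  for \<open>k = v\<close> and 1 otherwise.\<close>

lemma gradient_coordinate_point:
  assumes "d \<ge> 1"
  shows "gradient (form_of d c :: 'v::finite cpoly) (axis v 1) $ k =
    of_nat (lookup (single v (d - 1) + single k 1) k) *
      c (single v (d - 1) + single k 1)"
proof -
  let ?m = "single v (d - 1) + single k 1"
  have "($) (axis v (1::complex)) = (\<lambda>u. if u = v then 1 else 0)"
    by (auto simp: axis_def)
  then have "gradient (form_of d c :: 'v cpoly) (axis v 1) $ k =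
     (\<Sum>m\<in>monoms d. (if m = ?m then of_nat (lookup m k) else 0) * c m)"
    unfolding gradient_form_of using assms by (simp add: monom_deriv_coordinate_point)
  also have "\<dots> = (\<Sum>m\<in>monoms d. if m = ?m then of_nat (lookup m k) * c m else 0)"
    by (intro sum.cong) auto
  also have "?m \<in> monoms d"
    using assms by (simp add: monoms_def monom_degree_add)
  then have "(\<Sum>m\<in>monoms d. if m = ?m then of_nat (lookup m k) * c m else 0) = of_nat (lookup ?m k) * c ?m"
    by (simp add: finite_monoms)
  finally show ?thesis .
qed

lemma hessian_coordinate_point:
  assumes "d \<ge> 2"
  shows "hessian (form_of d c :: 'v::finite cpoly) (axis v 1) $ k $ l =
    of_nat (lookup (single v (d - 2)) l + 1) *
      of_nat (lookup (single v (d - 2) + single l 1) k + 1) *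
      c (single v (d - 2) + single l 1 + single k 1)"
proof -
  have ax: "($) (axis v (1::complex)) = (\<lambda>u. if u = v then 1 else 0)"
    by (auto simp: axis_def)
  have "hessian (form_of d c :: 'v::finite cpoly) (axis v 1) $ k $ l =
     (\<Sum>m\<in>monoms (d - 2). if m = single v (d - 2) then of_nat (lookup m l + 1) *
      of_nat (lookup (m + single l 1) k + 1) *
        c (m + single l 1 + single k 1) else 0)"
    unfolding hessian_form_of[OF assms] ax monom_eval_coordinate_point
    by (intro sum.cong refl) (simp add: monoms_def mult.assoc)
  also have "single v (d - 2) \<in> monoms (d - 2)"
    by (simp add: monoms_def)
  then have "(\<Sum>m\<in>monoms (d - 2). if m = single v (d - 2) then of_nat (lookup m l + 1) *
      of_nat (lookup (m + single l 1) k + 1) *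
        c (m + single l 1 + single k 1) else 0) =
    of_nat (lookup (single v (d - 2)) l + 1) *
      of_nat (lookup (single v (d - 2) + single l 1) k + 1) *
      c (single v (d - 2) + single l 1 + single k 1)"
    by (simp only: sum.delta[OF finite_monoms] if_True)
  finally show ?thesis .
qed

section \<open>Smoothness of generic hypersurfaces\<close>

text \<open>A singular point with coordinate \<open>k\<close> normalized to 1 has one parameter less
  than the number of equations saying that the gradient vanishes.\<close>

lemma thin_singular_forms:
  assumes "d \<ge> 1"
  shows "thin (monoms d) {c. \<not> smooth_hypersurface (form_of d c :: 'v::finite cpoly)}"
proof -
  define y where "y = (\<lambda>(k::'v) t j. if j = k then 1 else t j :: complex)"
  define A where "A = (\<lambda>(k::'v) r m t. monom_deriv (y k t) r m)"
  let ?B = "\<lambda>k. {c. \<exists>t. (\<forall>r. (\<Sum>m\<in>monoms d. A k r m t * c m) = 0) \<and>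
    (\<forall>w. (\<forall>m\<in>monoms d. (\<Sum>r\<in>UNIV. w r * A k r m t) = 0) \<longrightarrow> w = (\<lambda>_. 0))}"
  have "thin (monoms d) (?B k)" for k
  proof (rule thin_linear_family[OF finite_monoms, of "- {k}"])
    show "card (- {k}) < CARD('v)"
      by (intro psubset_card_mono) auto
    have "(\<lambda>t. y k t j) \<in> pol (- {k})" for j
      unfolding y_def by (cases "j = k") (auto intro: pol_var)
    then show "A k r m \<in> pol (- {k})" for r m
      unfolding A_def by (intro pol_monom_deriv)
  qed auto
  then have "thin (monoms d) (\<Union>k. ?B k)"
    by (intro thin_UN) auto
  then show ?thesis
  proof (rule thin_subset, intro subsetI)
    fix c assume "c \<in> {c. \<not> smooth_hypersurface (form_of d c :: 'v cpoly)}"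
    then obtain P x where P: "P \<in> hypersurface (form_of d c :: 'v cpoly)" "x \<in> P"
      and g: "gradient (form_of d c) x = 0"
      unfolding smooth_hypersurface_def by blast
    have "x \<noteq> 0"
      using P unfolding hypersurface_def proj_space_def proj_class_def by auto
    then obtain k where k: "x $ k \<noteq> 0" by (auto simp: vec_eq_iff)
    define z where "z = (1 / x $ k) *s x"
    have gz: "gradient (form_of d c) z = 0"
      unfolding z_def gradient_scale_arg[OF form_of_in_forms] g by simp
    have zk: "z $ k = 1" using k by (simp add: z_def)
    have yz: "y k (($) z) = ($) z"
      using zk by (auto simp: y_def)
    have "(\<Sum>m\<in>monoms d. A k r m (($) z) * c m) = 0" for r
      using gz by (simp add: A_def yz flip: gradient_form_of)
    moreover have "w = (\<lambda>_. 0)" if w: "\<forall>m\<in>monoms d. (\<Sum>r\<in>UNIV. w r * A k r m (($) z)) = 0" for w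
    proof -
      \<comment> \<open>The monomial \<open>x_k ^ d\<close> isolates the weight
        \<open>w k\<close>.\<close>
      let ?m = "single k d"
      have "w r * A k r ?m (($) z) = (if r = k then w k * of_nat d else 0)" for r
        by (auto simp: A_def yz monom_deriv_def lookup_single when_def zk simp flip: single_diff)
      moreover have "?m \<in> monoms d" by (simp add: monoms_def)
      ultimately have "(\<Sum>r\<in>UNIV. if r = k then w k * of_nat d else 0) = 0"
        using w[rule_format, of ?m] by simp
      then have wk: "w k = 0"
        using assms by simp
      have "w r = 0" for r
      proof (cases "r = k")
        case False
        \<comment> \<open>The derivative of this monomial by \<open>x_k\<close> has weight
          \<open>w k = 0\<close>, so the monomial isolates \<open>w r\<close>.\<close>
        let ?m = "single k (d - 1) + single r 1"
        have "w s * A k s ?m (($) z) = (if s = r then w r else 0)" for s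
          using False wk
          by (auto simp: A_def yz monom_deriv_def lookup_single lookup_add when_def zk)
        moreover have "?m \<in> monoms d" using assms by (simp add: monoms_def monom_degree_add)
        ultimately have "(\<Sum>s\<in>UNIV. if s = r then w r else 0) = 0"
          using w[rule_format, of ?m] by simp
        then show ?thesis by simp
      qed (use wk in simp)
      then show ?thesis by auto
    qed
    ultimately show "c \<in> (\<Union>k. ?B k)" by blast
  qed
qed

section \<open>Hyperplanes tangent at prescribed points\<close>

text \<open>The unknown \<open>t\<close> encodes \<open>CARD('n)\<close> points close to the coordinate points other than
  \<open>None\<close>. The point number \<open>i\<close> is normalized by making its coordinate \<open>Some i\<close> equal to 1, and its
  coordinate \<open>None\<close> is stored as the diagonal entry of \<open>t\<close>.\<close>

definition point :: "('n \<times> 'n \<Rightarrow> complex) \<Rightarrow> 'n::finite \<Rightarrow> complex^('n option)" where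
  "point t i = (\<chi> k. case k of None \<Rightarrow> t (i, i) | Some j \<Rightarrow> if j = i then 1 else t (i, j))"

definition point_deriv :: "('n \<times> 'n \<Rightarrow> complex) \<Rightarrow> 'n::finite \<Rightarrow> complex^('n option)" where
  "point_deriv \<delta> i = (\<chi> k. case k of None \<Rightarrow> \<delta> (i, i) | Some j \<Rightarrow> if j = i then 0 else \<delta> (i, j))"

definition dot :: "complex^'v::finite \<Rightarrow> complex^'v \<Rightarrow> complex" where
  "dot x y = (\<Sum>k\<in>UNIV. x $ k * y $ k)"

text \<open>By Euler's formula, all entries of \<open>tangency f t\<close> vanish if and only if all \<open>point t i\<close> lie on \<open>f = 0\<close>
  and the tangent hyperplane at each of them contains all of them.\<close>

definition tangency :: "'n option cpoly \<Rightarrow> ('n \<times> 'n \<Rightarrow> complex) \<Rightarrow> complex^('n::finite \<times> 'n)" where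
  "tangency f t = (\<chi> r. dot (gradient f (point t (fst r))) (point t (snd r)))"

definition tangency_deriv ::
  "'n option cpoly \<Rightarrow> ('n \<times> 'n \<Rightarrow> complex) \<Rightarrow> complex^('n \<times> 'n) \<Rightarrow> complex^('n::finite \<times> 'n)" where
  "tangency_deriv f t \<delta> = (\<chi> r. dot (hessian f (point t (fst r)) *v point_deriv (($) \<delta>) (fst r)) (point t (snd r)) +
      dot (gradient f (point t (fst r))) (point_deriv (($) \<delta>) (snd r)))"

text \<open>For fixed points the tangency conditions are linear in the form; this is the matrix of
  that system, with rows \<open>(i, j)\<close> and columns \<open>m\<close>.\<close>

definition tangency_coeff ::
  "'n \<times> 'n \<Rightarrow> ('n option \<Rightarrow>\<^sub>0 nat) \<Rightarrow> ('n::finite \<times> 'n \<Rightarrow> complex) \<Rightarrow> complex" where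
  "tangency_coeff = (\<lambda>(i, j) m t. \<Sum>k\<in>UNIV. monom_deriv (($) (point t i)) k m * point t j $ k)"

text \<open>At the coordinate points, the condition \<open>(i, j)\<close> involves only the
  coefficient of \<open>x_i ^ (d - 1) x_j\<close>. The minor with these columns is therefore
  diagonal there.\<close>

definition node_monom :: "nat \<Rightarrow> 'n \<times> 'n \<Rightarrow> ('n option \<Rightarrow>\<^sub>0 nat)" where
  "node_monom d = (\<lambda>(i, j). single (Some i) (d - 1) + single (Some j) 1)"

abbreviation tangency_minor :: "nat \<Rightarrow> ('n::finite \<times> 'n \<Rightarrow> complex) \<Rightarrow> complex" where
  "tangency_minor d \<equiv> system_minor tangency_coeff (node_monom d)"

definition tangency_jacobian :: "'n option cpoly \<Rightarrow> ('n::finite \<times> 'n \<Rightarrow> complex) \<Rightarrow> complex" where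
  "tangency_jacobian f t = det (matrix (tangency_deriv f t))"

text \<open>Since \<open>d - 1 \<ge> 2\<close>, the variable with the large exponent can be
  recognized; for quadrics, \<open>x_i x_j\<close> could be read in two ways.\<close>

lemma single_add_single_inj:
  fixes i j i' j' :: 'v
  assumes "d \<ge> 3" "single i (d - 1) + single j 1 =
    single i' (d - 1) + single j' (1::nat)" (is "?l = ?r")
  shows "i = i' \<and> j = j'"
proof -
  have "lookup ?l i \<ge> 2" "i \<noteq> i' \<Longrightarrow> lookup ?r i \<le> 1"
    using assms(1) by (auto simp: lookup_add lookup_single when_def)
  then have i: "i = i'" using assms(2) by fastforce
  then have "single j (1::nat) = single j' 1"
    using assms(2) by simp
  then show ?thesis
    using i by (metis lookup_single_eq lookup_single_not_eq one_neq_zero)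
qed

lemma node_monom_inj:
  assumes "d \<ge> 3"
  shows "inj (node_monom d :: 'n::finite \<times> 'n \<Rightarrow> _)"
proof (rule injI)
  fix p q :: "'n \<times> 'n" assume "node_monom d p = node_monom d q"
  then have "Some (fst p) = Some (fst q) \<and> Some (snd p) = Some (snd q)"
    unfolding node_monom_def case_prod_beta by (rule single_add_single_inj[OF assms])
  then show "p = q" by (simp add: prod_eq_iff)
qed

lemma node_monom_in_monoms: "d \<ge> 1 \<Longrightarrow> range (node_monom d) \<subseteq> monoms d"
  by (auto simp: node_monom_def monoms_def monom_degree_add)

lemma tangency_coeff_sum:
  "(\<Sum>m\<in>monoms d. tangency_coeff r m t * c m) = tangency (form_of d c) t $ r"
proof (cases r)
  case (Pair i j)
  then show ?thesis
    by (simp add: tangency_coeff_def tangency_def dot_def gradient_form_of sum_distrib_left sum_distrib_right mult_ac)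
       (rule sum.swap)
qed

lemma pol_point: "(\<lambda>t. point t i $ k) \<in> pol UNIV"
proof (cases k)
  case (Some j)
  then show ?thesis by (cases "j = i") (auto simp: point_def intro: pol_var)
qed (auto simp: point_def intro: pol_var)

lemma pol_tangency_coeff: "tangency_coeff r m \<in> pol UNIV"
  unfolding tangency_coeff_def case_prod_beta
  by (intro pol_sum pol_mult pol_monom_deriv pol_point)

lemma linear_tangency_deriv:
  "Vector_Spaces.linear (*s) (*s) (tangency_deriv f (t :: 'n::finite \<times> 'n \<Rightarrow> complex))"
proof -
  have 1: "point_deriv (($) (x + y)) i = point_deriv (($) x) i + point_deriv (($) y) i"
    for x y :: "complex^('n \<times> 'n)" and i :: 'n
    by (auto simp: point_deriv_def vec_eq_iff split: option.splits)
  have 2: "point_deriv (($) (c *s x)) i = c *s point_deriv (($) x) i"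
    for x :: "complex^('n \<times> 'n)" and i c
    by (auto simp: point_deriv_def vec_eq_iff split: option.splits)
  show ?thesis
    by unfold_locales
       (auto simp: tangency_deriv_def vec_eq_iff 1 2 dot_def matrix_vector_mult_def algebra_simps sum.distrib sum_distrib_left)
qed

lemma tangency_jacobian_kernel:
  "tangency_jacobian f t \<noteq> 0 \<longleftrightarrow> (\<forall>\<delta>. tangency_deriv f t \<delta> = 0 \<longrightarrow> \<delta> = 0)"
proof -
  have "tangency_jacobian f t \<noteq> 0 \<longleftrightarrow> (\<forall>x. matrix (tangency_deriv f t) *v x = 0 \<longrightarrow> x = 0)"
    unfolding tangency_jacobian_def invertible_det_nz[symmetric] invertible_left_inverse
      matrix_left_invertible_ker by (rule refl)
  then show ?thesis
    by (simp add: matrix_works[OF linear_tangency_deriv])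
qed

lemma pol_tangency_jacobian:
  assumes "d \<ge> 2"
  shows "(\<lambda>\<tau>. tangency_jacobian (form_of d (\<lambda>m. \<tau> (Inr m))) (\<lambda>j. \<tau> (Inl j)))
     \<in> pol (Inl ` UNIV \<union> Inr ` monoms d)" (is "_ \<in> pol ?J")
  unfolding tangency_jacobian_def
proof (rule pol_det)
  fix r s :: "'a \<times> 'a"
  have pt: "(\<lambda>\<tau>. point (\<lambda>j. \<tau> (Inl j)) i $ k) \<in> pol ?J" for i :: 'a and k
    by (rule pol_compose[OF pol_point]) (auto intro: pol_var)
  have grad: "(\<lambda>\<tau>. gradient (form_of d (\<lambda>m. \<tau> (Inr m))) (point (\<lambda>j. \<tau> (Inl j)) i) $ k) \<in> pol ?J"
    for i :: 'a and k
    unfolding gradient_form_of by (intro pol_sum pol_mult pol_monom_deriv pt pol_var) auto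
  have hess: "(\<lambda>\<tau>. hessian (form_of d (\<lambda>m. \<tau> (Inr m))) (point (\<lambda>j. \<tau> (Inl j)) i) $ k $ l) \<in> pol ?J"
    for i :: 'a and k l
    unfolding hessian_form_of[OF assms]
  proof (intro pol_sum pol_mult pol_monom_eval pt pol_const pol_var)
    fix m :: "'a option \<Rightarrow>\<^sub>0 nat" assume "m \<in> monoms (d - 2)"
    then have "m + single l 1 + single k 1 \<in> monoms d"
      using assms by (simp add: monoms_def monom_degree_add)
    then show "Inr (m + single l 1 + single k 1) \<in> ?J" by blast
  qed
  obtain i j where r: "r = (i, j)" by (cases r)
  show "(\<lambda>\<tau>. matrix (tangency_deriv (form_of d (\<lambda>m. \<tau> (Inr m))) (\<lambda>j. \<tau> (Inl j))) $ r $ s) \<in> pol ?J"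
    unfolding matrix_def tangency_deriv_def dot_def matrix_vector_mult_def r vec_lambda_beta case_prod_conv
    by (intro pol_sum pol_mult pol_add hess grad pt pol_const)
qed

lemma point_zero: "point (\<lambda>_. 0) i = axis (Some i) 1"
  by (auto simp: point_def axis_def vec_eq_iff split: option.splits)

lemma tangency_minor_zero:
  assumes "d \<ge> 3"
  shows "tangency_minor d (\<lambda>_::'n::finite \<times> 'n. 0) \<noteq> 0"
proof -
  have ax: "($) (axis v (1::complex)) = (\<lambda>u. if u = v then 1 else 0)" for v :: "'n option"
    by (auto simp: axis_def)
  have *: "tangency_coeff r (node_monom d s) (\<lambda>_. 0) =
     (if r = s then of_nat (lookup (node_monom d r) (Some (snd r))) else 0)" for r s :: "'n \<times> 'n"
  proof -
    have mem: "node_monom d s \<in> monoms d"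
      using node_monom_in_monoms[of d] assms by auto
    obtain i j where r: "r = (i, j)" by (cases r)
    have "tangency_coeff r (node_monom d s) (\<lambda>_. 0) =
       monom_deriv (\<lambda>u. if u = Some i then 1 else 0) (Some j) (node_monom d s)"
      unfolding tangency_coeff_def r case_prod_conv point_zero ax
      by (simp add: if_distrib cong: if_cong)
    also have "\<dots> = (if node_monom d s = node_monom d r then of_nat (lookup (node_monom d s) (Some j)) else 0)"
      using assms by (subst monom_deriv_coordinate_point[OF mem]) (simp_all add: node_monom_def r)
    finally show ?thesis
      unfolding inj_eq[OF node_monom_inj[OF assms]] using r by (cases "r = s") auto
  qed
  have "tangency_minor d (\<lambda>_::'n \<times> 'n. 0) =
     (\<Prod>r\<in>UNIV. of_nat (lookup (node_monom d r) (Some (snd r :: 'n))) :: complex)"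
    unfolding * by (subst det_diagonal) simp_all
  also have "\<dots> \<noteq> 0"
    by (auto simp: node_monom_def lookup_add)
  finally show ?thesis .
qed

text \<open>\<open>tangency_coeff (i, j)\<close> is linear in the point number \<open>j\<close>. So
  a dependence of the points gives one between the rows \<open>(j0, j)\<close> of the minor.\<close>

lemma points_independent:
  fixes t :: "'n::finite \<times> 'n \<Rightarrow> complex"
  assumes "tangency_minor d t \<noteq> 0" "(\<Sum>i\<in>UNIV. y i *s point t i) = 0"
  shows "y = (\<lambda>_. 0)"
proof (rule ccontr)
  assume "y \<noteq> (\<lambda>_. 0)"
  then obtain j0 where j0: "y j0 \<noteq> 0" by auto
  let ?M = "(\<chi> r s. tangency_coeff r (node_monom d s) t) :: complex^('n \<times> 'n)^('n \<times> 'n)"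
  let ?z = "(\<chi> r. if fst r = j0 then y (snd r) else 0) :: complex^('n \<times> 'n)"
  have "?z v* ?M = 0"
  proof (unfold vec_eq_iff, intro allI)
    fix s :: "'n \<times> 'n"
    let ?m = "node_monom d s"
    have "(?z v* ?M) $ s = (\<Sum>r\<in>UNIV. (if fst r = j0 then y (snd r) else 0) * tangency_coeff r ?m t)"
      by (simp add: vector_matrix_mult_def mult.commute)
    also have "(\<Sum>r\<in>UNIV. (if fst r = j0 then y (snd r) else 0) * tangency_coeff r ?m t) =
       (\<Sum>i\<in>UNIV. \<Sum>j\<in>UNIV. (if i = j0 then y j else 0) * tangency_coeff (i, j) ?m t)"
      unfolding sum.cartesian_product UNIV_Times_UNIV by (intro sum.cong) auto
    also have "\<dots> = (\<Sum>j\<in>UNIV. y j * tangency_coeff (j0, j) ?m t)"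
      by (subst sum.swap) (simp add: if_distrib[of "\<lambda>x. x * _"] cong: if_cong)
    also have "\<dots> = (\<Sum>k\<in>UNIV. monom_deriv (($) (point t j0)) k ?m * (\<Sum>j\<in>UNIV. y j *s point t j) $ k)"
      by (simp add: tangency_coeff_def sum_distrib_left sum_distrib_right mult_ac) (rule sum.swap)
    also have "\<dots> = 0" using assms(2) by simp
    finally show "(?z v* ?M) $ s = 0 $ s" by simp
  qed
  then have "transpose ?M *v ?z = 0" by simp
  moreover have "invertible (transpose ?M)"
    using assms(1) by (simp add: invertible_det_nz)
  ultimately have "?z = 0"
    unfolding invertible_left_inverse matrix_left_invertible_ker by (simp only: simp_thms)
  then have "?z $ (j0, j0) = 0" by simp
  then show False using j0 by simp
qed

lemma sum_option_UNIV: "(\<Sum>k\<in>(UNIV :: 'a::finite option set). f k) = f None + (\<Sum>j\<in>UNIV. f (Some j))"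
  by (simp add: UNIV_option_conv sum.reindex)

text \<open>The monomials \<open>x\<^sub>0 x\<^sub>i ^ (d - 1)\<close>, where \<open>x\<^sub>0\<close> is the variable \<open>None\<close>, and all monomials in
  exactly three of the other variables. The form with these monomials restricts to the hyperplane
  \<open>x\<^sub>0 = 0\<close> with nondegenerate nodes at the coordinate points.\<close>

definition base_coeff :: "('n::finite option \<Rightarrow>\<^sub>0 nat) \<Rightarrow> complex" where
  "base_coeff m = (let T = {j. lookup m (Some j) \<noteq> 0} in
     if lookup m None = 1 \<and> card T = 1 \<or> lookup m None = 0 \<and> card T = 3 then 1 else 0)"

text \<open>Euler's formula turns the condition \<open>(i, i)\<close> into
  \<open>d * \<delta> $ (i, i) = 0\<close>. The rest splits into one block for each
  \<open>i\<close>, the all-ones matrix minus the identity in size \<open>CARD('n) - 1\<close>. It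
  is invertible because \<open>CARD('n) - 2 \<noteq> 0\<close>.\<close>

lemma base_form_tangency:
  fixes d :: nat
  assumes n: "CARD('n::finite) \<ge> 3" and d: "d \<ge> 3"
  defines "f \<equiv> form_of d base_coeff :: 'n option cpoly"
  shows "tangency f (\<lambda>_. 0) = 0" and "tangency_jacobian f (\<lambda>_. 0) \<noteq> 0"
proof -
  \<comment> \<open>All coordinate points other than \<open>None\<close> thus share the tangent
    hyperplane \<open>x_0 = 0\<close>.\<close>
  have grad: "gradient f (axis (Some i) 1) $ k = (if k = None then 1 else 0)" for i :: 'n and k
  proof (cases k)
    case None
    have "{j. lookup (single (Some i) (d - 1) + single None 1) (Some j) \<noteq> 0} = {i}"
      using d by (auto simp: lookup_add lookup_single when_def)
    then show ?thesis
      unfolding f_def using d None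
      by (subst gradient_coordinate_point) (simp_all add: base_coeff_def Let_def lookup_add lookup_single when_def)
  next
    case (Some j)
    have "{j'. lookup (single (Some i) (d - 1) + single (Some j) 1) (Some j') \<noteq> 0} = {i, j}"
      using d by (auto simp: lookup_add lookup_single when_def)
    moreover have "card {i, j} \<noteq> 3" by (cases "i = j") auto
    ultimately show ?thesis
      unfolding f_def using d Some
      by (subst gradient_coordinate_point) (simp_all add: base_coeff_def Let_def lookup_add lookup_single when_def)
  qed
  have hessNone: "hessian f (axis (Some i) 1) $ Some j $ None = 0" if "i \<noteq> j" for i j :: 'n
  proof -
    have "{j'. lookup (single (Some i) (d - 2) + single None 1 + single (Some j) 1) (Some j') \<noteq> 0} = {i, j}"
      using d by (auto simp: lookup_add lookup_single when_def)
    then show ?thesis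
      unfolding f_def using d that
      by (subst hessian_coordinate_point) (simp_all add: base_coeff_def Let_def lookup_add lookup_single when_def)
  qed
  have hessSome: "hessian f (axis (Some i) 1) $ Some j $ Some l = (if j = l then 0 else 1)"
    if "i \<noteq> j" "i \<noteq> l" for i j l :: 'n
  proof -
    have "{j'. lookup (single (Some i) (d - 2) + single (Some l) 1 + single (Some j) 1) (Some j') \<noteq> 0} = {i, j, l}"
      using d by (auto simp: lookup_add lookup_single when_def)
    moreover have "card {i, j, l} = (if j = l then 2 else 3)" using that by auto
    ultimately show ?thesis
      unfolding f_def using d that
      by (subst hessian_coordinate_point) (simp_all add: base_coeff_def Let_def lookup_add lookup_single when_def)
  qed
  have dot_axis: "dot x (axis v 1) = x $ v" for x :: "complex^'n option" and v
    by (simp add: dot_def axis_def if_distrib cong: if_cong)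
  have dot_grad: "dot (gradient f (axis (Some i) 1)) x = x $ None" for i :: 'n and x
    by (simp add: dot_def grad sum_option_UNIV)
  show "tangency f (\<lambda>_. 0) = 0"
    by (simp add: tangency_def point_zero dot_grad vec_eq_iff) (simp add: axis_def)
  show "tangency_jacobian f (\<lambda>_. 0) \<noteq> 0"
    unfolding tangency_jacobian_kernel
  proof (intro allI impI)
    fix \<delta> :: "complex^('n \<times> 'n)"
    assume "tangency_deriv f (\<lambda>_. 0) \<delta> = 0"
    then have \<delta>: "(hessian f (axis (Some i) 1) *v point_deriv (($) \<delta>) i) $ Some j + \<delta> $ (j, j) = 0" for i j
      by (simp add: tangency_deriv_def vec_eq_iff point_zero dot_axis dot_grad)
         (simp add: point_deriv_def)
    have diag: "\<delta> $ (i, i) = 0" for i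
    proof -
      have "hessian f (axis (Some i) 1) *v axis (Some i) 1 = of_nat (d - 1) *s gradient f (axis (Some i) 1)"
        unfolding f_def by (rule euler_hessian[OF form_of_in_forms])
      moreover have "(hessian f (axis (Some i) 1) *v axis (Some i) 1) $ k = hessian f (axis (Some i) 1) $ Some i $ k" for k
        using hessian_sym[of f "axis (Some i) 1" k "Some i"]
        by (simp add: matrix_vector_mult_def axis_def if_distrib cong: if_cong)
      ultimately have "hessian f (axis (Some i) 1) $ Some i $ k = (of_nat (d - 1) *s gradient f (axis (Some i) 1)) $ k" for k
        by simp
      then have "hessian f (axis (Some i) 1) $ Some i $ k = of_nat (d - 1) * (if k = None then 1 else 0)" for k
        by (simp only: vector_smult_component grad)
      then have "(hessian f (axis (Some i) 1) *v point_deriv (($) \<delta>) i) $ Some i = of_nat (d - 1) * \<delta> $ (i, i)"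
        by (simp add: matrix_vector_mult_def sum_option_UNIV) (simp add: point_deriv_def)
      then have "(of_nat (d - 1) + 1) * \<delta> $ (i, i) = 0"
        using \<delta>[of i i] by (simp add: algebra_simps)
      moreover have "of_nat (d - 1) + 1 = (of_nat d :: complex)"
        using d by (simp add: of_nat_diff)
      ultimately show ?thesis using d by simp
    qed
    have off: "\<delta> $ (i, j) = 0" if "i \<noteq> j" for i j
    proof -
      let ?S = "\<Sum>b\<in>UNIV - {i}. \<delta> $ (i, b)"
      have S: "\<delta> $ (i, j) = ?S" if "j \<noteq> i" for j
      proof -
        have "0 = (\<Sum>b\<in>UNIV. hessian f (axis (Some i) 1) $ Some j $ Some b * point_deriv (($) \<delta>) i $ Some b)"
          using \<delta>[of i j] diag that hessNone[of i j]
          by (simp add: matrix_vector_mult_def sum_option_UNIV)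
        also have "\<dots> = (\<Sum>b\<in>UNIV - {i}. hessian f (axis (Some i) 1) $ Some j $ Some b * point_deriv (($) \<delta>) i $ Some b)"
          by (rule sum.mono_neutral_right) (auto simp: point_deriv_def)
        also have "\<dots> = (\<Sum>b\<in>UNIV - {i}. \<delta> $ (i, b) - (if b = j then \<delta> $ (i, b) else 0))"
          using that by (intro sum.cong) (auto simp: hessSome point_deriv_def)
        also have "\<dots> = ?S - \<delta> $ (i, j)"
          using that by (simp add: sum_subtractf)
        finally show ?thesis by simp
      qed
      \<comment> \<open>Summing the \<open>CARD('n) - 1\<close> equal entries multiplies their sum
        by \<open>CARD('n) - 1\<close>.\<close>
      have "?S = (\<Sum>b\<in>UNIV - {i}. ?S)"
        by (rule sum.cong[OF refl]) (rule S, simp)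
      also have "\<dots> = of_nat (CARD('n) - 1) * ?S"
        by (simp add: card_Diff_singleton)
      finally have "(of_nat (CARD('n) - 1) - 1) * ?S = 0" by (simp add: algebra_simps)
      moreover have "of_nat (CARD('n) - 1) - 1 = (of_nat (CARD('n) - 2) :: complex)"
        using n by (simp add: of_nat_diff)
      moreover have "CARD('n) - 2 \<noteq> 0" using n by simp
      ultimately have "?S = 0" by (metis mult_eq_0_iff of_nat_eq_0_iff)
      then show ?thesis using S[of j] that by simp
    qed
    show "\<delta> = 0"
      using diag off by (auto simp: vec_eq_iff) (metis surj_pair)
  qed
qed

section \<open>Continuation of solutions along a complex line\<close>

text \<open>Cauchy's bound, with \<open>e\<close> as the effective degree: if
  \<open>norm z > 1\<close>, the leading term is compared with the others after bounding these by
  \<open>z ^ (e - 1)\<close>.\<close>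

lemma polynomial_root_bound:
  fixes z :: complex
  assumes "(\<Sum>k\<le>N. c k * z ^ k) = 0" "e \<le> N" "c e \<noteq> 0" "\<And>k. k > e \<Longrightarrow> c k = 0"
  shows "norm z \<le> 1 + (\<Sum>k\<le>N. norm (c k)) / norm (c e)"
proof (cases "norm z \<le> 1")
  case True
  then show ?thesis by (simp add: add_increasing2 divide_nonneg_nonneg sum_nonneg)
next
  case False
  let ?A = "\<Sum>k\<le>N. norm (c k)"
  have "(\<Sum>k\<le>N. c k * z ^ k) = (\<Sum>k\<le>e. c k * z ^ k)"
    using assms(2,4) by (intro sum.mono_neutral_right) auto
  then have *: "c e * z ^ e = - (\<Sum>k<e. c k * z ^ k)"
    using assms(1) by (simp add: lessThan_Suc_atMost[symmetric] eq_neg_iff_add_eq_0 add.commute)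
  obtain e' where e': "e = Suc e'" using * assms(3) by (cases e) auto
  have "norm (c e) * norm z ^ e = norm (\<Sum>k<e. c k * z ^ k)"
    using * by (metis norm_minus_cancel norm_mult norm_power)
  also have "\<dots> \<le> (\<Sum>k<e. norm (c k) * norm z ^ e')"
  proof (rule sum_norm_le)
    fix k assume "k \<in> {..<e}"
    then have "norm z ^ k \<le> norm z ^ e'" using False e' by (intro power_increasing) auto
    then show "norm (c k * z ^ k) \<le> norm (c k) * norm z ^ e'"
      by (simp add: norm_mult norm_power mult_left_mono)
  qed
  also have "\<dots> = (\<Sum>k<e. norm (c k)) * norm z ^ e'"
    by (simp add: sum_distrib_right)
  also have "\<dots> \<le> ?A * norm z ^ e'"
    using assms(2) by (intro mult_right_mono sum_mono2) auto
  finally have "norm (c e) * norm z * norm z ^ e' \<le> ?A * norm z ^ e'"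
    by (simp add: e')
  moreover have "norm z ^ e' > 0" using False by (intro zero_less_power) linarith
  ultimately have "norm (c e) * norm z \<le> ?A"
    by (rule mult_right_le_imp_le)
  then have "norm z \<le> ?A / norm (c e)"
    using assms(3) by (simp add: field_simps)
  then show ?thesis by simp
qed

text \<open>The relations for the coordinates bound the solutions, and the relation for \<open>G\<close>, with its
  vanishing low coefficients divided out, keeps \<open>G\<close> away from 0. So no solution is lost in a limit
  outside \<open>K\<close>.\<close>

lemma continuation_along_line:
  fixes E :: "complex \<Rightarrow> complex^'r::finite \<Rightarrow> complex^'r" and G :: "complex \<Rightarrow> complex^'r \<Rightarrow> complex"
  assumes K: "finite K"
    and contE: "continuous_on UNIV (\<lambda>p. E (fst p) (snd p))"
    and contG: "continuous_on UNIV (\<lambda>p. G (fst p) (snd p))"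
    and start: "E s0 q0 = 0" "G s0 q0 \<noteq> 0"
    and local: "\<And>s q N. \<lbrakk>E s q = 0; G s q \<noteq> 0; open N; (s, q) \<in> N\<rbrakk> \<Longrightarrow>
      \<forall>\<^sub>F s' in nhds s. \<exists>q'. (s', q') \<in> N \<and> E s' q' = 0"
    and relq: "\<And>r. \<exists>N c e. (\<forall>k. continuous_on UNIV (c k)) \<and> (\<forall>s. s \<notin> K \<longrightarrow> c e s \<noteq> 0) \<and> e \<le> N \<and>
      (\<forall>k s. k > e \<longrightarrow> c k s = 0) \<and> (\<forall>s q. E s q = 0 \<longrightarrow> G s q \<noteq> 0 \<longrightarrow> (\<Sum>k\<le>N. c k s * (q $ r) ^ k) = 0)"
    and relG: "\<exists>N c e. (\<forall>k. continuous_on UNIV (c k)) \<and> (\<forall>s. s \<notin> K \<longrightarrow> c e s \<noteq> 0) \<and> e \<le> N \<and>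
      (\<forall>k s. k < e \<longrightarrow> c k s = 0) \<and> (\<forall>s q. E s q = 0 \<longrightarrow> G s q \<noteq> 0 \<longrightarrow> (\<Sum>k\<le>N. c k s * G s q ^ k) = 0)"
    and s1: "s1 \<notin> K"
  shows "\<exists>q. E s1 q = 0 \<and> G s1 q \<noteq> 0"
proof -
  define X where "X = {s. s \<notin> K \<and> (\<exists>q. E s q = 0 \<and> G s q \<noteq> 0)}"
  let ?N = "{p. G (fst p) (snd p) \<noteq> 0}"
  have oN: "open ?N"
    using open_Collect_neq[OF contG continuous_on_const[of _ 0]] by simp
  have oK: "open (- K)" using K by (simp add: finite_imp_closed open_closed)
  have near: "\<forall>\<^sub>F s' in nhds s. \<exists>q'. E s' q' = 0 \<and> G s' q' \<noteq> 0" if "E s q = 0" "G s q \<noteq> 0" for s q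
    using local[OF that oN] that by (auto elim: eventually_mono)
  have "open X"
  proof (subst open_subopen, rule ballI)
    fix s assume s: "s \<in> X"
    then have "\<forall>\<^sub>F s' in nhds s. \<exists>q'. E s' q' = 0 \<and> G s' q' \<noteq> 0"
      using near unfolding X_def by blast
    moreover have "\<forall>\<^sub>F s' in nhds s. s' \<in> - K"
      using s oK unfolding X_def by (intro eventually_nhds_in_open) auto
    ultimately have "\<forall>\<^sub>F s' in nhds s. s' \<in> X"
      by eventually_elim (auto simp: X_def)
    then show "\<exists>T. open T \<and> s \<in> T \<and> T \<subseteq> X"
      unfolding eventually_nhds by blast
  qed
  \<comment> \<open>The start \<open>s0\<close> may lie in \<open>K\<close>, but its solution
    persists nearby, and points outside the finite set \<open>K\<close> exist arbitrarily
    close.\<close>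
  moreover have "X \<noteq> {}"
  proof -
    have "\<forall>\<^sub>F s' in at s0. \<exists>q'. E s' q' = 0 \<and> G s' q' \<noteq> 0"
      using near[OF start] by (simp add: eventually_nhds_conv_at)
    moreover have "\<forall>\<^sub>F s' in at s0. s' \<notin> K"
    proof -
      have "open (- (K - {s0}))" using K by (intro open_Compl finite_imp_closed) simp
      then have "\<forall>\<^sub>F s' in nhds s0. s' \<in> - (K - {s0})"
        by (intro eventually_nhds_in_open) auto
      then show ?thesis
        unfolding eventually_at_filter by (auto elim: eventually_mono)
    qed
    ultimately have "\<forall>\<^sub>F s' in at s0. s' \<in> X"
      by eventually_elim (auto simp: X_def)
    then show ?thesis using eventually_happens[of _ "at s0"] by auto
  qed
  moreover have limit: "l \<in> X" if x: "\<And>i. x i \<in> X" and lim: "x \<longlonglongrightarrow> l" and l: "l \<notin> K" for x l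
  proof -
    obtain q where q: "\<And>i. E (x i) (q i) = 0" "\<And>i. G (x i) (q i) \<noteq> 0"
    proof -
      have "\<forall>i. \<exists>q. E (x i) q = 0 \<and> G (x i) q \<noteq> 0" using x unfolding X_def by blast
      then show ?thesis using that by metis
    qed
    have xK: "x i \<notin> K" for i using x unfolding X_def by blast
    have "\<exists>B. \<forall>i. norm (q i $ r) \<le> B" for r
    proof -
      from relq[of r] obtain N c e where c: "\<forall>k. continuous_on UNIV (c k)" "\<forall>s. s \<notin> K \<longrightarrow> c e s \<noteq> 0" "e \<le> N"
        "\<forall>k s. k > e \<longrightarrow> c k s = 0"
        "\<forall>s q. E s q = 0 \<longrightarrow> G s q \<noteq> 0 \<longrightarrow> (\<Sum>k\<le>N. c k s * (q $ r) ^ k) = 0"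
        by (elim exE conjE)
      have ck: "(\<lambda>i. c k (x i)) \<longlonglongrightarrow> c k l" for k
        by (rule continuous_on_tendsto_compose[OF c(1)[rule_format] lim]) simp_all
      let ?b = "\<lambda>s. 1 + (\<Sum>k\<le>N. norm (c k s)) / norm (c e s)"
      have "(\<lambda>i. ?b (x i)) \<longlonglongrightarrow> ?b l"
        using c(2) l by (intro tendsto_intros ck) simp
      then have "Bseq (\<lambda>i. ?b (x i))"
        by (rule convergent_imp_Bseq[OF convergentI])
      then obtain B where B: "\<And>i. norm (?b (x i)) \<le> B"
        unfolding Bseq_def by blast
      have "norm (q i $ r) \<le> B" for i
      proof -
        have "norm (q i $ r) \<le> ?b (x i)"
          using c(2-5) q xK by (intro polynomial_root_bound) auto
        then show ?thesis using B[of i] by simp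
      qed
      then show ?thesis by blast
    qed
    then obtain B where B: "\<And>r i. norm (q i $ r) \<le> B r" by metis
    have "norm (q i) \<le> (\<Sum>r\<in>UNIV. B r)" for i
      unfolding norm_vec_def by (intro order_trans[OF L2_set_le_sum] sum_mono B) simp
    then have "bounded (range q)"
      unfolding bounded_iff by blast
    then obtain q' \<rho> where \<rho>: "strict_mono \<rho>" "(q \<circ> \<rho>) \<longlonglongrightarrow> q'"
      using bounded_imp_convergent_subsequence by blast
    have xl: "(\<lambda>i. x (\<rho> i)) \<longlonglongrightarrow> l"
      using LIMSEQ_subseq_LIMSEQ[OF lim \<rho>(1)] by (simp add: o_def)
    have pl: "(\<lambda>i. (x (\<rho> i), q (\<rho> i))) \<longlonglongrightarrow> (l, q')"
      using xl \<rho>(2) by (intro tendsto_Pair) (simp_all add: o_def)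
    have El: "(\<lambda>i. E (x (\<rho> i)) (q (\<rho> i))) \<longlonglongrightarrow> E l q'"
      using continuous_on_tendsto_compose[OF contE pl] by simp
    have Gl: "(\<lambda>i. G (x (\<rho> i)) (q (\<rho> i))) \<longlonglongrightarrow> G l q'"
      using continuous_on_tendsto_compose[OF contG pl] by simp
    have E0: "E l q' = 0"
      using El q(1) by (simp add: LIMSEQ_const_iff)
    have "G l q' \<noteq> 0"
    proof
      assume G0: "G l q' = 0"
      from relG obtain N c e where c: "\<forall>k. continuous_on UNIV (c k)" "\<forall>s. s \<notin> K \<longrightarrow> c e s \<noteq> 0" "e \<le> N"
        "\<forall>k s. k < e \<longrightarrow> c k s = 0"
        "\<forall>s q. E s q = 0 \<longrightarrow> G s q \<noteq> 0 \<longrightarrow> (\<Sum>k\<le>N. c k s * G s q ^ k) = 0"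
        by (elim exE conjE)
      have ck: "(\<lambda>i. c k (x (\<rho> i))) \<longlonglongrightarrow> c k l" for k
        by (rule continuous_on_tendsto_compose[OF c(1)[rule_format] xl]) simp_all
      let ?h = "\<lambda>s g. \<Sum>k\<in>{e..N}. c k s * g ^ (k - e)"
      have "?h s (G s q) = 0" if "E s q = 0" "G s q \<noteq> 0" for s q
      proof -
        have "0 = (\<Sum>k\<le>N. c k s * G s q ^ k)" using c(5) that by simp
        also have "\<dots> = (\<Sum>k\<in>{e..N}. c k s * G s q ^ k)"
          using c(4) by (intro sum.mono_neutral_right) auto
        also have "\<dots> = G s q ^ e * ?h s (G s q)"
          unfolding sum_distrib_left by (intro sum.cong) (auto simp: mult_ac simp flip: power_add)
        finally show ?thesis using that by simp
      qed
      then have "?h (x (\<rho> i)) (G (x (\<rho> i)) (q (\<rho> i))) = 0" for i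
        using q by blast
      moreover have "(\<lambda>i. ?h (x (\<rho> i)) (G (x (\<rho> i)) (q (\<rho> i)))) \<longlonglongrightarrow> ?h l (G l q')"
        by (intro tendsto_intros ck Gl)
      ultimately have "?h l 0 = 0"
        using G0 by (simp add: LIMSEQ_const_iff)
      moreover have "?h l 0 = c e l"
        using c(3) by (subst sum.remove[of _ e]) (auto intro!: sum.neutral)
      ultimately show False using c(2) l by simp
    qed
    then show ?thesis using E0 l unfolding X_def by blast
  qed
  then have "closedin (top_of_set (- K)) X"
    unfolding closedin_limpt islimpt_sequential
  proof (intro conjI allI impI)
    fix l assume "(\<exists>x. (\<forall>n. x n \<in> X - {l}) \<and> x \<longlonglongrightarrow> l) \<and> l \<in> - K"
    then obtain x where "\<And>n. x n \<in> X" "x \<longlonglongrightarrow> l" "l \<notin> K" by auto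
    then show "l \<in> X" by (rule limit)
  qed (auto simp: X_def)
  moreover have "connected (- K)"
  proof -
    have "connected (UNIV - K)"
      by (rule connected_open_delete_finite) (use K in auto)
    then show ?thesis by (simp add: Compl_eq_Diff_UNIV)
  qed
  moreover have "openin (top_of_set (- K)) X"
    using \<open>open X\<close> by (intro open_subset) (auto simp: X_def)
  ultimately have "X = - K"
    unfolding connected_clopen by blast
  then show ?thesis using s1 unfolding X_def by blast
qed

section \<open>The tangency system along a line of forms\<close>

lemma pol_continuous:
  assumes "F \<in> pol J" "\<And>j. j \<in> J \<Longrightarrow> continuous_on S (\<lambda>p. h p j)"
  shows "continuous_on S (\<lambda>p. F (h p))"
  using assms by (induction rule: pol.induct) (auto intro: continuous_intros)

lemma point_has_derivative:
  "((\<lambda>q. point (($) q) i) has_derivative (\<lambda>\<delta>. point_deriv (($) \<delta>) i)) (at (q :: complex^('n::finite \<times> 'n)))"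
  unfolding point_def point_deriv_def
proof (rule has_derivative_vec_lambda)
  fix k :: "'n option"
  show "((\<lambda>q. case k of None \<Rightarrow> q $ (i, i) | Some j \<Rightarrow> if j = i then 1 else q $ (i, j)) has_derivative
     (\<lambda>\<delta>. case k of None \<Rightarrow> \<delta> $ (i, i) | Some j \<Rightarrow> if j = i then 0 else \<delta> $ (i, j))) (at q)"
  proof (cases k)
    case (Some j)
    then show ?thesis by (cases "j = i") (simp_all add: has_derivative_vec_nth)
  qed (simp add: has_derivative_vec_nth)
qed

lemma has_derivative_dot:
  assumes "(f has_derivative f') (at x)" "(g has_derivative g') (at x)"
  shows "((\<lambda>x. dot (f x) (g x)) has_derivative (\<lambda>v. dot (f' v) (g x) + dot (f x) (g' v))) (at x)"
proof -
  have "((\<lambda>x. \<Sum>k\<in>UNIV. f x $ k * g x $ k) has_derivative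
     (\<lambda>v. \<Sum>k\<in>UNIV. f x $ k * g' v $ k + f' v $ k * g x $ k)) (at x)"
    by (intro has_derivative_sum has_derivative_mult bounded_linear.has_derivative[OF bounded_linear_vec_nth] assms)
  then show ?thesis by (simp add: dot_def sum.distrib add.commute)
qed

lemma tangency_has_derivative:
  "((\<lambda>q. tangency f (($) q)) has_derivative tangency_deriv f (($) q)) (at (q :: complex^('n::finite \<times> 'n)))"
  unfolding tangency_def tangency_deriv_def[abs_def]
  by (intro has_derivative_vec_lambda has_derivative_dot point_has_derivative
      has_derivative_compose[OF point_has_derivative gradient_has_derivative])

lemma tangency_form_line:
  "tangency (form_of d (\<lambda>m. a m + s * (b m - a m))) t =
    tangency (form_of d a) t + s *s tangency (form_of d (\<lambda>m. b m - a m)) t"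
  by (simp add: vec_eq_iff flip: tangency_coeff_sum)
     (simp add: distrib_left sum.distrib sum_distrib_left mult_ac)

text \<open>The map sending \<open>(s, q)\<close> to \<open>(s, tangency (f s) q)\<close> has at the
  solution a derivative with a right inverse, so the image of a neighbourhood contains all
  \<open>(s', 0)\<close> with \<open>s'\<close> near \<open>s\<close>.\<close>

lemma tangency_local_solutions:
  fixes a b :: "('n::finite option \<Rightarrow>\<^sub>0 nat) \<Rightarrow> complex" and q :: "complex^('n \<times> 'n)" and d :: nat
  defines "f \<equiv> \<lambda>s. form_of d (\<lambda>m. a m + s * (b m - a m))"
  assumes E: "tangency (f s) (($) q) = 0" and J: "tangency_jacobian (f s) (($) q) \<noteq> 0"
    and N: "open N" "(s, q) \<in> N"
  shows "\<forall>\<^sub>F s' in nhds s. \<exists>q'. (s', q') \<in> N \<and> tangency (f s') (($) q') = 0"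
proof -
  define T0 where "T0 = (\<lambda>q :: complex^('n \<times> 'n). tangency (form_of d a) (($) q))"
  define T1 where "T1 = (\<lambda>q :: complex^('n \<times> 'n). tangency (form_of d (\<lambda>m. b m - a m)) (($) q))"
  define D where "D = tangency_deriv (f s) (($) q)"
  have line: "tangency (f s) (($) q) = T0 q + s *s T1 q" for s q
    by (simp add: f_def T0_def T1_def tangency_form_line)
  have smul: "c *s x = (\<chi> k. c * x $ k)" for c and x :: "complex^('n \<times> 'n)"
    by (simp add: vec_eq_iff)
  let ?D0 = "tangency_deriv (form_of d a) (($) q)"
  let ?D1 = "tangency_deriv (form_of d (\<lambda>m. b m - a m)) (($) q)"
  have d0: "(T0 has_derivative ?D0) (at q)" and d1: "(T1 has_derivative ?D1) (at q)"
    unfolding T0_def T1_def by (rule tangency_has_derivative)+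
  have "((\<lambda>q. T0 q + s *s T1 q) has_derivative (\<lambda>\<delta>. ?D0 \<delta> + s *s ?D1 \<delta>)) (at q)"
    unfolding smul
    by (intro has_derivative_add d0 has_derivative_vec_lambda has_derivative_mult_right
        bounded_linear.has_derivative[OF bounded_linear_vec_nth] d1)
  moreover have "((\<lambda>q. T0 q + s *s T1 q) has_derivative D) (at q)"
    using tangency_has_derivative[of "f s" q] by (simp add: line D_def)
  ultimately have D: "D = (\<lambda>\<delta>. ?D0 \<delta> + s *s ?D1 \<delta>)"
    by (rule has_derivative_unique[rotated])
  let ?F = "\<lambda>p. (fst p, T0 (snd p) + fst p *s T1 (snd p))"
  let ?F' = "\<lambda>p. (fst p, D (snd p) + fst p *s T1 q)"
  have sndd: "((\<lambda>p. T0 (snd p)) has_derivative (\<lambda>p. ?D0 (snd p))) (at (s, q))"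
    "((\<lambda>p. T1 (snd p)) has_derivative (\<lambda>p. ?D1 (snd p))) (at (s, q))"
    by (rule has_derivative_compose[OF has_derivative_snd[OF has_derivative_ident]], simp add: d0 d1)+
  have "((\<lambda>p. T0 (snd p) + fst p *s T1 (snd p)) has_derivative
      (\<lambda>p. ?D0 (snd p) + (\<chi> k. fst (s, q) * ?D1 (snd p) $ k + fst p * T1 (snd (s, q)) $ k))) (at (s, q))"
    unfolding smul
    by (intro has_derivative_add sndd has_derivative_vec_lambda has_derivative_mult
        bounded_linear.has_derivative[OF bounded_linear_vec_nth] has_derivative_fst has_derivative_ident)
  moreover have "(\<lambda>p. ?D0 (snd p) + (\<chi> k. fst (s, q) * ?D1 (snd p) $ k + fst p * T1 (snd (s, q)) $ k)) =
      (\<lambda>p. D (snd p) + fst p *s T1 q)"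
    by (auto simp: D vec_eq_iff)
  ultimately have "((\<lambda>p. T0 (snd p) + fst p *s T1 (snd p)) has_derivative (\<lambda>p. D (snd p) + fst p *s T1 q)) (at (s, q))"
    by simp
  then have derF: "(?F has_derivative ?F') (at (s, q))"
    by (intro has_derivative_Pair has_derivative_fst has_derivative_ident)
  have "invertible (matrix D)"
    using J unfolding tangency_jacobian_def D_def by (simp add: invertible_det_nz)
  then obtain R where R: "matrix D ** R = mat 1"
    unfolding invertible_def by blast
  have DR: "D (R *v x) = x" for x
  proof -
    have "D (R *v x) = matrix D *v (R *v x)"
      unfolding D_def by (simp add: matrix_works[OF linear_tangency_deriv])
    then show ?thesis by (simp add: matrix_vector_mul_assoc R)
  qed
  \<comment> \<open>A right inverse of \<open>?F'\<close>: the first component is kept, and its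
    contribution \<open>T1 q\<close> is subtracted before \<open>D\<close> is inverted.\<close>
  let ?g = "\<lambda>p. (fst p, R *v (snd p - fst p *s T1 q))"
  have lin: "bounded_linear ?g"
    unfolding linear_conv_bounded_linear[symmetric]
    by (rule linearI)
       (auto simp: vec_eq_iff matrix_vector_mult_def sum.distrib scaleR_sum_right algebra_simps
        simp flip: sum.distrib sum_subtractf)
  have inv: "?F' \<circ> ?g = id"
    by (auto simp: DR)
  have contT: "continuous_on UNIV (\<lambda>q. tangency g (($) q))" for g :: "'n option cpoly"
    by (intro continuous_at_imp_continuous_on ballI has_derivative_continuous[OF tangency_has_derivative])
  have contF: "continuous_on UNIV ?F"
    unfolding smul T0_def T1_def
    by (intro continuous_intros continuous_on_compose2[OF contT] continuous_on_vec_lambda) auto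
  have "?F (s, q) \<in> interior (?F ` N)"
    by (rule sussmann_open_mapping[OF open_UNIV contF UNIV_I derF lin inv subset_UNIV])
       (use N in \<open>simp add: interior_open\<close>)
  then have "(s, 0) \<in> interior (?F ` N)"
    using E line by simp
  then have "\<forall>\<^sub>F p in nhds (s, 0). p \<in> interior (?F ` N)"
    by (intro eventually_nhds_in_open) auto
  moreover have "filterlim (\<lambda>s'. (s', 0 :: complex^('n \<times> 'n))) (nhds (s, 0)) (nhds s)"
    by (intro tendsto_Pair tendsto_const filterlim_ident)
  ultimately have "\<forall>\<^sub>F s' in nhds s. (s', 0) \<in> interior (?F ` N)"
    by (rule eventually_compose_filterlim)
  then show ?thesis
  proof (rule eventually_mono)
    fix s' assume "(s', 0) \<in> interior (?F ` N)"
    then have "(s', 0) \<in> ?F ` N" using interior_subset by blast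
    then show "\<exists>q'. (s', q') \<in> N \<and> tangency (f s') (($) q') = 0"
      by (auto simp: line)
  qed
qed

text \<open>The borderline case of the count: as many point parameters as equations. Coefficients
  beyond \<open>N\<close> are made 0, so that a lowest and a highest nonzero coefficient can be
  selected.\<close>

lemma tangency_algebraic_relation:
  fixes G :: "('n::finite \<times> 'n + ('n option \<Rightarrow>\<^sub>0 nat) \<Rightarrow> complex) \<Rightarrow> complex"
  assumes d: "d \<ge> 3" and G: "G \<in> pol (Inl ` UNIV \<union> Inr ` monoms d)"
  shows "\<exists>N c. (\<forall>k. c k \<in> pol (monoms d)) \<and> (\<forall>k>N. c k = (\<lambda>_. 0)) \<and> (\<exists>k x. c k x \<noteq> 0) \<and>
    (\<forall>t x. tangency_minor d t \<noteq> 0 \<longrightarrow> tangency (form_of d x) t = 0 \<longrightarrow>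
       (\<Sum>k\<le>N. c k x * G (case_sum t x) ^ k) = 0)"
proof -
  have "\<exists>N c. (\<forall>k. c k \<in> pol (monoms d)) \<and> (\<exists>k\<le>N. \<exists>x. c k x \<noteq> 0) \<and>
    (\<forall>t x. tangency_minor d t \<noteq> 0 \<longrightarrow> (\<forall>r. (\<Sum>m\<in>monoms d. tangency_coeff r m t * x m) = 0) \<longrightarrow>
       (\<Sum>k\<le>N. c k x * G (case_sum t x) ^ k) = 0)"
    by (rule system_algebraic_relation[where J = UNIV])
       (use d node_monom_in_monoms[of d] in \<open>auto simp: finite_monoms pol_tangency_coeff node_monom_inj G\<close>)
  then obtain N c where c: "\<And>k. c k \<in> pol (monoms d)" "\<exists>k\<le>N. \<exists>x. c k x \<noteq> 0"
    "\<And>t x. \<lbrakk>tangency_minor d t \<noteq> 0; \<forall>r. (\<Sum>m\<in>monoms d. tangency_coeff r m t * x m) = 0\<rbrakk> \<Longrightarrow>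
       (\<Sum>k\<le>N. c k x * G (case_sum t x) ^ k) = 0"
    by blast
  show ?thesis
  proof (rule exI[of _ N], rule exI[of _ "\<lambda>k. if k \<le> N then c k else (\<lambda>_. 0)"], intro conjI allI impI)
    show "(if k \<le> N then c k else (\<lambda>_. 0)) \<in> pol (monoms d)" for k
      using c(1) by auto
    from c(2) obtain k x where "k \<le> N" "c k x \<noteq> 0" by blast
    then show "\<exists>k x. (if k \<le> N then c k else (\<lambda>_. 0)) x \<noteq> 0"
      by (intro exI[of _ k] exI[of _ x]) simp
  next
    fix t :: "'n \<times> 'n \<Rightarrow> complex" and x
    assume "tangency_minor d t \<noteq> 0" "tangency (form_of d x) t = 0"
    then show "(\<Sum>k\<le>N. (if k \<le> N then c k else (\<lambda>_. 0)) x * G (case_sum t x) ^ k) = 0"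
      using c(3)[of t x] by (simp add: tangency_coeff_sum)
  qed auto
qed

lemma generic_multitangent_hyperplane:
  fixes d :: nat
  assumes n: "CARD('n::finite) \<ge> 3" and d: "d \<ge> 3"
  shows "\<exists>B. thin (monoms d) B \<and> (\<forall>c. c \<notin> B \<longrightarrow>
    (\<exists>t :: 'n \<times> 'n \<Rightarrow> complex. tangency (form_of d c) t = 0 \<and> tangency_minor d t \<noteq> 0 \<and>
      tangency_jacobian (form_of d c) t \<noteq> 0))"
proof -
  let ?I = "monoms d :: ('n option \<Rightarrow>\<^sub>0 nat) set"
  define J where "J = (Inl ` UNIV \<union> Inr ` ?I :: ('n \<times> 'n + ('n option \<Rightarrow>\<^sub>0 nat)) set)"
  \<comment> \<open>The product, so that keeping \<open>G\<close> away from 0 preserves the minor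
    and the Jacobian at once.\<close>
  define G where "G = (\<lambda>\<tau> :: 'n \<times> 'n + ('n option \<Rightarrow>\<^sub>0 nat) \<Rightarrow> complex. tangency_minor d (\<lambda>j. \<tau> (Inl j)) *
     tangency_jacobian (form_of d (\<lambda>m. \<tau> (Inr m))) (\<lambda>j. \<tau> (Inl j)))"
  have sI: "node_monom d s \<in> ?I" for s using node_monom_in_monoms[of d] d by auto
  have "(\<lambda>\<tau>. tangency_minor d (\<lambda>j. \<tau> (Inl j))) \<in> pol J"
    by (rule pol_compose[where h = "\<lambda>\<tau> j. \<tau> (Inl j)" and I = UNIV], rule pol_det)
       (auto simp: pol_tangency_coeff J_def intro: pol_var)
  moreover have "(\<lambda>\<tau>. tangency_jacobian (form_of d (\<lambda>m. \<tau> (Inr m))) (\<lambda>j. \<tau> (Inl j))) \<in> pol J"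
    unfolding J_def using d by (intro pol_tangency_jacobian) simp
  ultimately have GJ: "G \<in> pol J" unfolding G_def by (rule pol_mult)
  have "\<exists>N c. (\<forall>k. c k \<in> pol ?I) \<and> (\<forall>k>N. c k = (\<lambda>_. 0)) \<and> (\<exists>k x. c k x \<noteq> 0) \<and>
    (\<forall>t x. tangency_minor d t \<noteq> 0 \<longrightarrow> tangency (form_of d x) t = 0 \<longrightarrow>
       (\<Sum>k\<le>N. c k x * G (case_sum t x) ^ k) = 0)"
    by (rule tangency_algebraic_relation[OF d]) (use GJ in \<open>simp add: J_def\<close>)
  then obtain N c where c: "\<And>k. c k \<in> pol ?I" "\<forall>k>N. c k = (\<lambda>_. 0)" "\<exists>k x. c k x \<noteq> 0"
    "\<And>t x. tangency_minor d t \<noteq> 0 \<Longrightarrow> tangency (form_of d x) t = 0 \<Longrightarrow>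
       (\<Sum>k\<le>N. c k x * G (case_sum t x) ^ k) = 0"
    by (elim exE conjE) blast
  \<comment> \<open>The lowest coefficient for \<open>G\<close>, which must stay away from 0. For
    the coordinates, which must stay bounded, the highest one is taken below.\<close>
  define e where "e = (LEAST k. \<exists>x. c k x \<noteq> 0)"
  have e1: "\<exists>x. c e x \<noteq> 0"
    unfolding e_def using c(3) by (rule LeastI_ex)
  have e2: "c k x = 0" if "k < e" for k x
    using not_less_Least that unfolding e_def by blast
  have eN: "e \<le> N"
    using c(2) e1 by (metis not_le)
  define P where "P r N c \<longleftrightarrow> (\<forall>k. c k \<in> pol ?I) \<and> (\<forall>k>N. c k = (\<lambda>_. 0)) \<and> (\<exists>k x. c k x \<noteq> 0) \<and>
    (\<forall>t x. tangency_minor d t \<noteq> 0 \<longrightarrow> tangency (form_of d x) t = 0 \<longrightarrow>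
       (\<Sum>k\<le>N. c k x * t r ^ k) = 0)" for r :: "'n \<times> 'n" and N and c :: "nat \<Rightarrow> (('n option \<Rightarrow>\<^sub>0 nat) \<Rightarrow> complex) \<Rightarrow> complex"
  have "\<exists>N c. P r N c" for r
    using tangency_algebraic_relation[OF d, of "\<lambda>\<tau>. \<tau> (Inl r)"]
    unfolding P_def by (simp add: pol_var)
  then obtain N' c' where P: "\<And>r. P r (N' r) (c' r)"
    by metis
  have c': "\<And>r k. c' r k \<in> pol ?I" "\<And>r. \<forall>k>N' r. c' r k = (\<lambda>_. 0)" "\<And>r. \<exists>k x. c' r k x \<noteq> 0"
    "\<And>r t x. tangency_minor d t \<noteq> 0 \<Longrightarrow> tangency (form_of d x) t = 0 \<Longrightarrow>
       (\<Sum>k\<le>N' r. c' r k x * (t :: 'n \<times> 'n \<Rightarrow> complex) r ^ k) = 0"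
    using P unfolding P_def by auto
  define e' where "e' r = (GREATEST k. \<exists>x. c' r k x \<noteq> 0)" for r
  have bound: "k \<le> N' r" if "\<exists>x. c' r k x \<noteq> 0" for r k
    using c'(2)[of r] that by (metis not_le)
  have e'1: "\<exists>x. c' r (e' r) x \<noteq> 0" for r
    unfolding e'_def by (rule GreatestI_ex_nat[OF c'(3) bound])
  have e'2: "c' r k x = 0" if "k > e' r" for k x r
    using Greatest_le_nat[of "\<lambda>k. \<exists>x. c' r k x \<noteq> 0" k "N' r"] bound that unfolding e'_def
    by (meson leD)
  have e'N: "e' r \<le> N' r" for r
    using bound e'1 by blast
  define B where "B = {x. c e x = 0} \<union> (\<Union>r. {x. c' r (e' r) x = 0})"
  have "thin ?I B"
    unfolding B_def
  proof (intro thin_Un thin_UN)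
    show "thin ?I {x. c e x = 0}" using e1 thin_zeros[OF c(1)] by blast
    show "thin ?I {x. c' r (e' r) x = 0}" for r using e'1[of r] thin_zeros[OF c'(1)] by blast
  qed auto
  moreover have "\<exists>t :: 'n \<times> 'n \<Rightarrow> complex. tangency (form_of d x) t = 0 \<and> tangency_minor d t \<noteq> 0 \<and>
      tangency_jacobian (form_of d x) t \<noteq> 0" if x: "x \<notin> B" for x
  proof -
    define l where "l = (\<lambda>s m. base_coeff m + s * (x m - base_coeff m))"
    define E where "E = (\<lambda>s (q :: complex^('n \<times> 'n)). tangency (form_of d (l s)) (($) q))"
    define g where "g = (\<lambda>s (q :: complex^('n \<times> 'n)). G (case_sum (($) q) (l s)))"
    have g: "g s q = tangency_minor d (($) q) * tangency_jacobian (form_of d (l s)) (($) q)" for s q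
      by (simp add: g_def G_def)
    \<comment> \<open>Finite because none of these polynomials vanishes at the end point
      \<open>x\<close> of the line.\<close>
    define K where "K = {s. c e (l s) = 0} \<union> (\<Union>r. {s. c' r (e' r) (l s) = 0})"
    have "c e x \<noteq> 0" "\<And>r. c' r (e' r) x \<noteq> 0" using x unfolding B_def by auto
    then have K: "finite K"
      unfolding K_def l_def
      by (intro finite_UnI finite_UN_I pol_finite_zeros_on_line[OF c(1)] pol_finite_zeros_on_line[OF c'(1)]) auto
    have l0: "l 0 = base_coeff" and l1: "l 1 = x" by (auto simp: l_def)
    have contl: "continuous_on S (\<lambda>s. l (h s) m)" if "continuous_on S h" for S :: "'b::topological_space set" and h m
      unfolding l_def using that by (intro continuous_intros)
    have polcont: "continuous_on UNIV (\<lambda>s. F (l s))" if "F \<in> pol ?I" for F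
      using that by (rule pol_continuous) (intro contl continuous_intros)
    have "\<exists>q. E 1 q = 0 \<and> g 1 q \<noteq> 0"
    proof (rule continuation_along_line[OF K, where ?s0.0 = 0 and ?q0.0 = 0])
      have "tangency (form_of d (l s)) (($) q) = (\<chi> r. \<Sum>m\<in>?I. tangency_coeff r m (($) q) * l s m)" for s q
        by (simp add: vec_eq_iff tangency_coeff_sum)
      then show "continuous_on UNIV (\<lambda>p. E (fst p) (snd p))"
        unfolding E_def
        by (auto intro!: continuous_on_vec_lambda continuous_on_sum continuous_on_mult contl
            pol_continuous[OF pol_tangency_coeff] continuous_intros)
      show "continuous_on UNIV (\<lambda>p. g (fst p) (snd p))"
        unfolding g_def
      proof (rule pol_continuous[OF GJ])
        fix j assume "j \<in> J"
        show "continuous_on UNIV (\<lambda>p. case_sum (($) (snd p :: complex^('n \<times> 'n))) (l (fst p)) j)"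
          by (cases j) (auto intro!: contl continuous_intros)
      qed
      have z: "($) (0 :: complex^('n \<times> 'n)) = (\<lambda>_. 0)" by auto
      show "E 0 0 = 0" "g 0 0 \<noteq> 0"
        unfolding g E_def l0 z using base_form_tangency[OF n d] tangency_minor_zero[OF d] by auto
      show "\<forall>\<^sub>F s' in nhds s. \<exists>q'. (s', q') \<in> N \<and> E s' q' = 0"
        if "E s q = 0" "g s q \<noteq> 0" "open N" "(s, q) \<in> N" for s q N
        using that unfolding E_def g l_def by (intro tangency_local_solutions) auto
      show "1 \<notin> K"
        unfolding K_def using x l1 by (auto simp: B_def)
      have pos: "tangency_minor d (($) q) \<noteq> 0" if "g s q \<noteq> 0" for s q
        using that unfolding g by auto
      have nz: "c' r (e' r) (l s) \<noteq> 0" if "s \<notin> K" for r s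
        using that unfolding K_def by blast
      show "\<exists>N c e. (\<forall>k. continuous_on UNIV (c k)) \<and> (\<forall>s. s \<notin> K \<longrightarrow> c e s \<noteq> 0) \<and> e \<le> N \<and>
        (\<forall>k s. k > e \<longrightarrow> c k s = 0) \<and> (\<forall>s q. E s q = 0 \<longrightarrow> g s q \<noteq> 0 \<longrightarrow> (\<Sum>k\<le>N. c k s * (q $ r) ^ k) = 0)" for r
        by (rule exI[of _ "N' r"], rule exI[of _ "\<lambda>k s. c' r k (l s)"], rule exI[of _ "e' r"], intro conjI allI impI)
           (use e'N e'2 c'(4) pos nz in \<open>auto simp: E_def intro: polcont c'(1)\<close>)
      show "\<exists>N c e. (\<forall>k. continuous_on UNIV (c k)) \<and> (\<forall>s. s \<notin> K \<longrightarrow> c e s \<noteq> 0) \<and> e \<le> N \<and>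
        (\<forall>k s. k < e \<longrightarrow> c k s = 0) \<and> (\<forall>s q. E s q = 0 \<longrightarrow> g s q \<noteq> 0 \<longrightarrow> (\<Sum>k\<le>N. c k s * g s q ^ k) = 0)"
        by (rule exI[of _ N], rule exI[of _ "\<lambda>k s. c k (l s)"], rule exI[of _ e], intro conjI allI impI)
           (use eN e2 c(4) pos in \<open>auto simp: K_def E_def g_def intro: polcont c(1)\<close>)
    qed
    then show ?thesis
      unfolding E_def g l1 by auto
  qed
  ultimately show ?thesis by blast
qed

section \<open>Absence of further tangencies\<close>

definition span_point :: "('n \<times> 'n \<Rightarrow> complex) \<Rightarrow> ('n::finite \<Rightarrow> complex) \<Rightarrow> complex^('n option)" where
  "span_point t y = (\<Sum>i\<in>UNIV. y i *s point t i)"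

lemma span_point_nth: "span_point t y $ k = (\<Sum>i\<in>UNIV. y i * point t i $ k)"
  by (simp add: span_point_def)

lemma span_point_coordinate: "span_point t (\<lambda>u. if u = i then 1 else 0) = point t i"
  by (simp add: vec_eq_iff span_point_nth if_distrib[of "\<lambda>x. x * _"] cong: if_cong)

text \<open>Chain rule, read off by differentiating both sides along the line through
  \<open>y\<close> in direction \<open>j\<close>.\<close>

lemma gradient_linear_substitution:
  fixes f :: "'n::finite option cpoly" and g :: "'n cpoly"
  assumes "\<And>y. cpoly_eval y g = cpoly_eval (($) (span_point t y)) f"
  shows "gradient g y $ j = dot (gradient f (span_point t (($) y))) (point t j)"
proof -
  have eq: "cpoly_eval (($) (y + z *s axis j 1)) g = cpoly_eval (($) (span_point t (($) y) + z *s point t j)) f" for z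
  proof -
    have "span_point t (($) (y + z *s axis j 1)) = span_point t (($) y) + z *s point t j"
      by (simp add: vec_eq_iff span_point_nth distrib_right sum.distrib)
         (simp add: axis_def if_distrib[of "\<lambda>x. x * _"] if_distrib[of "\<lambda>x. _ * x"] cong: if_cong)
    then show ?thesis by (simp add: assms)
  qed
  have "((\<lambda>z. cpoly_eval (($) (y + z *s axis j 1)) g) has_field_derivative gradient g y $ j) (at 0)"
    using directional_derivative[of y "axis j 1" g]
    by (simp add: axis_def if_distrib cong: if_cong)
  moreover have "((\<lambda>z. cpoly_eval (($) (y + z *s axis j 1)) g) has_field_derivative
      dot (gradient f (span_point t (($) y))) (point t j)) (at 0)"
    unfolding eq dot_def by (rule directional_derivative)
  ultimately show ?thesis by (rule DERIV_unique)
qed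

text \<open>The points are independent, so dual linear forms exist; the product with exponents
  \<open>m\<close> restricts to the monomial \<open>m\<close> on their span. Pairing with these
  forms reduces independence of conditions on \<open>f\<close> to statements about monomials in
  \<open>y\<close>.\<close>

lemma ex_test_form:
  fixes t :: "'n::finite \<times> 'n \<Rightarrow> complex" and m :: "'n \<Rightarrow>\<^sub>0 nat"
  assumes "tangency_minor d0 t \<noteq> 0" "m \<in> monoms d"
  shows "\<exists>f\<in>forms d. \<forall>y j. dot (gradient f (span_point t y)) (point t j) = monom_deriv y j m"
proof -
  let ?A = "(\<chi> k j. point t j $ k) :: complex^'n^('n option)"
  have "x = 0" if "?A *v x = 0" for x
  proof -
    have "(\<Sum>i\<in>UNIV. x $ i *s point t i) = 0"
      using that by (simp add: vec_eq_iff matrix_vector_mult_def mult.commute)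
    then have "($) x = (\<lambda>_. 0)" by (rule points_independent[OF assms(1)])
    then show ?thesis by (simp add: vec_eq_iff fun_eq_iff)
  qed
  then obtain L :: "complex^('n option)^'n" where L: "L ** ?A = mat 1"
    using matrix_left_invertible_ker by blast
  have dual: "(\<Sum>k\<in>UNIV. L $ i $ k * span_point t y $ k) = y i" for i y
  proof -
    have "L *v span_point t y = L *v (?A *v (\<chi> i. y i))"
      by (rule arg_cong[of _ _ "\<lambda>x. L *v x"]) (simp add: vec_eq_iff matrix_vector_mult_def span_point_nth mult.commute)
    also have "\<dots> = (\<chi> i. y i)" by (simp add: matrix_vector_mul_assoc L)
    finally show ?thesis by (simp add: vec_eq_iff matrix_vector_mult_def)
  qed
  obtain f where f: "f \<in> forms (\<Sum>i\<in>UNIV. lookup m i)"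
    "\<And>x. cpoly_eval x f = (\<Prod>i\<in>UNIV. (\<Sum>k\<in>UNIV. L $ i $ k * x k) ^ lookup m i)"
    using ex_product_form[of "lookup m" "\<lambda>i k. L $ i $ k"] by blast
  have fd: "f \<in> forms d"
    using f(1) assms(2) by (simp add: monoms_def monom_degree_UNIV)
  have "cpoly_eval y (single m 1) = cpoly_eval (($) (span_point t y)) f" for y
    unfolding f(2) dual by (simp add: monom_eval_UNIV)
  then have "gradient (single m 1) y $ j = dot (gradient f (span_point t (($) y))) (point t j)" for y j
    by (rule gradient_linear_substitution)
  moreover have "gradient (single m 1) y $ j = monom_deriv (($) y) j m" for y j
    by (simp add: gradient_def cpoly_eval_partial_deriv)
  ultimately have "dot (gradient f (span_point t (($) (\<chi> i. y i)))) (point t j) = monom_deriv (($) (\<chi> i. y i)) j m" for y j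
    by simp
  then show ?thesis using fd by (intro bexI[of _ f]) (simp_all add: vec_lambda_inverse)
qed

lemma sum_tangency_coeff_lookup:
  assumes "f \<in> forms d"
  shows "(\<Sum>m\<in>monoms d. lookup f m * tangency_coeff (i, j) m t) = dot (gradient f (point t i)) (point t j)"
  using tangency_coeff_sum[where d = d and r = "(i, j)" and t = t and c = "lookup f"] form_of_lookup[OF assms]
  by (simp add: tangency_def mult.commute)

text \<open>The analogue of \<open>tangency_coeff\<close> for the point
  \<open>span_point t y\<close>.\<close>

definition mixed_coeff :: "('n \<times> 'n \<Rightarrow> complex) \<Rightarrow> ('n \<Rightarrow> complex) \<Rightarrow> 'n \<Rightarrow> ('n::finite option \<Rightarrow>\<^sub>0 nat) \<Rightarrow> complex" where
  "mixed_coeff t y j m = (\<Sum>k\<in>UNIV. monom_deriv (($) (span_point t y)) k m * point t j $ k)"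

lemma sum_mixed_coeff_lookup:
  assumes "f \<in> forms d"
  shows "(\<Sum>m\<in>monoms d. lookup f m * mixed_coeff t y j m) = dot (gradient f (span_point t y)) (point t j)"
  unfolding mixed_coeff_def dot_def gradient_form[OF assms]
  by (simp add: sum_distrib_left sum_distrib_right mult_ac) (rule sum.swap)

lemma sum_node_terms:
  fixes w :: "'n::finite \<times> 'n \<Rightarrow> complex"
  assumes "d \<ge> 3" "m \<in> monoms d"
  shows "(\<Sum>i\<in>UNIV. \<Sum>j\<in>UNIV. w (i, j) * monom_deriv (\<lambda>u. if u = i then 1 else 0) j m) =
    (\<Sum>(i, j)\<in>UNIV. if m = single i (d - 1) + single j 1
      then w (i, j) * of_nat (lookup m j) else 0)"
  using assms
  by (simp add: monom_deriv_coordinate_point sum.cartesian_product if_distrib[of "\<lambda>x. _ * x"] cong: if_cong)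

text \<open>The node conditions see only monomials with an exponent of at least
  \<open>d - 1\<close>. All others test the additional point alone.\<close>

lemma sum_node_terms_zero:
  fixes w :: "'n::finite \<times> 'n \<Rightarrow> complex"
  assumes "d \<ge> 3" "m \<in> monoms d" "\<And>i. lookup m i \<le> d - 2"
  shows "(\<Sum>i\<in>UNIV. \<Sum>j\<in>UNIV. w (i, j) * monom_deriv (\<lambda>u. if u = i then 1 else 0) j m) = 0"
proof -
  have "m \<noteq> single i (d - 1) + single j 1" for i j
  proof
    assume "m = single i (d - 1) + single j 1"
    then have "lookup m i \<ge> d - 1" by (simp add: lookup_add)
    then show False using assms(1) assms(3)[of i] by linarith
  qed
  then show ?thesis unfolding sum_node_terms[OF assms(1,2)] by (intro sum.neutral) auto
qed

text \<open>Each monomial \<open>x_i ^ (d - 1) x_j\<close> occurs in the single node condition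
  \<open>(i, j)\<close> and so isolates its weight.\<close>

lemma node_weights_zero:
  fixes w :: "'n::finite \<times> 'n \<Rightarrow> complex"
  assumes "d \<ge> 3"
    and "\<And>m. m \<in> monoms d \<Longrightarrow>
      (\<Sum>i\<in>UNIV. \<Sum>j\<in>UNIV. w (i, j) * monom_deriv (\<lambda>u. if u = i then 1 else 0) j m) = 0"
  shows "w = (\<lambda>_. 0)"
proof
  fix r :: "'n \<times> 'n"
  obtain i j where r: "r = (i, j)" by (cases r)
  let ?m = "single i (d - 1) + single j 1"
  have m: "?m \<in> monoms d" using assms(1) by (simp add: monoms_def monom_degree_add)
  have "0 = (\<Sum>(i', j')\<in>UNIV. if ?m = single i' (d - 1) + single j' 1
      then w (i', j') * of_nat (lookup ?m j') else 0)"
    using assms(2)[OF m] unfolding sum_node_terms[OF assms(1) m] by simp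
  also have "\<dots> = (\<Sum>r'\<in>UNIV. if r' = (i, j) then w (i, j) * of_nat (lookup ?m j) else 0)"
  proof (rule sum.cong[OF refl])
    fix r' :: "'n \<times> 'n"
    obtain i' j' where r': "r' = (i', j')" by (cases r')
    have "?m = single i' (d - 1) + single j' 1 \<longleftrightarrow> r' = (i, j)"
      using single_add_single_inj[OF assms(1), of i j i' j'] r' by auto
    then show "(case r' of (i', j') \<Rightarrow> if ?m = single i' (d - 1) + single j' 1
      then w (i', j') * of_nat (lookup ?m j') else 0) = (if r' = (i, j) then w (i, j) * of_nat (lookup ?m j) else 0)"
      using r' by auto
  qed
  also have "\<dots> = w (i, j) * of_nat (lookup ?m j)" by simp
  finally have "w (i, j) * of_nat (lookup ?m j) = 0" by simp
  moreover have "lookup ?m j \<noteq> 0" by (simp add: lookup_add)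
  ultimately show "w r = 0" using r by simp
qed

lemma ex_distinct_pair: "card K \<ge> 2 \<Longrightarrow> \<exists>a\<in>K. \<exists>b\<in>K. a \<noteq> b"
proof (rule ccontr)
  assume *: "card K \<ge> 2" "\<not> (\<exists>a\<in>K. \<exists>b\<in>K. a \<noteq> b)"
  then have "finite K" by (intro card_ge_0_finite) simp
  then have "card K \<le> Suc 0" using *(2) by (simp add: card_le_Suc0_iff_eq)
  then show False using *(1) by simp
qed

text \<open>After division by \<open>y\<close>, the conditions at a point with support \<open>K\<close> pair the weights with
  the exponent vectors of the available monomials. These vectors span when they contain all
  differences of basis vectors.\<close>

lemma support_weights_zero:
  fixes v y :: "'n::finite \<Rightarrow> complex"
  assumes d: "d \<ge> 3"
    and K: "K = {i. y i \<noteq> 0}" "card K \<ge> 2" "d \<ge> 5 \<or> d = 4 \<and> card K \<ge> 3 \<or> d = 3 \<and> card K \<ge> 4"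
    and v: "\<And>m. \<lbrakk>m \<in> monoms d; \<And>i. lookup m i \<le> d - 2\<rbrakk> \<Longrightarrow> (\<Sum>j\<in>UNIV. v j * monom_deriv y j m) = 0"
  shows "v = (\<lambda>_. 0)"
proof -
  have Kiff: "i \<in> K \<longleftrightarrow> y i \<noteq> 0" for i using K(1) by simp
  define u where "u j = (if y j = 0 then 0 else v j / y j)" for j
  from ex_distinct_pair[OF K(2)] obtain a b where ab: "a \<in> K" "b \<in> K" "a \<noteq> b"
    by (elim bexE)
  have out: "v j = 0" if "j \<notin> K" for j
  proof -
    \<comment> \<open>As \<open>y j = 0\<close>, only the derivative by \<open>x_j\<close> of this
      monomial survives at \<open>y\<close>; all its exponents are at most
      \<open>d - 2\<close>.\<close>
    let ?m = "single a 1 + single b (d - 2) + single j 1"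
    have ne: "j \<noteq> a" "j \<noteq> b" and yj: "y j = 0" using that ab by (auto simp: Kiff)
    have "v l * monom_deriv y l ?m = (if l = j then v j * (y a * y b ^ (d - 2)) else 0)" for l
    proof (cases "l = j")
      case True
      then show ?thesis using ne by (simp add: monom_deriv_def lookup_add lookup_single monom_eval_add)
    next
      case False
      have "monom_eval y (?m - single l 1) = 0"
        unfolding monom_eval_UNIV
        by (rule prod_zero) (use yj False ne in \<open>auto simp: lookup_minus lookup_add lookup_single when_def intro!: bexI[of _ j]\<close>)
      then show ?thesis using False by (simp add: monom_deriv_def)
    qed
    moreover have "(\<Sum>l\<in>UNIV. v l * monom_deriv y l ?m) = 0"
      by (rule v) (use d ab ne in \<open>auto simp: monoms_def monom_degree_add lookup_add lookup_single when_def\<close>)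
    ultimately have "v j * (y a * y b ^ (d - 2)) = 0" by simp
    then show ?thesis using ab by (simp add: Kiff)
  qed
  have pair: "(\<Sum>j\<in>UNIV. u j * of_nat (lookup m j)) = 0"
    if "m \<in> monoms d" "\<And>i. lookup m i \<le> d - 2" "\<And>i. i \<notin> K \<Longrightarrow> lookup m i = 0" for m
  proof -
    have "v j * monom_deriv y j m = monom_eval y m * (u j * of_nat (lookup m j))" for j
    proof (cases "lookup m j = 0")
      case False
      have "j \<in> K"
      proof (rule ccontr)
        assume "j \<notin> K"
        then show False using that(3) False by simp
      qed
      then have yj: "y j \<noteq> 0" by (simp add: Kiff)
      have "m = single j 1 + (m - single j 1)"
        using False by (intro poly_mapping_eqI) (auto simp: lookup_add lookup_minus lookup_single when_def)
      then have "monom_eval y m = y j * monom_eval y (m - single j 1)"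
        by (metis monom_eval_add monom_eval_single power_one_right)
      then show ?thesis using yj by (simp add: u_def monom_deriv_def)
    qed (simp add: monom_deriv_def)
    then have "monom_eval y m * (\<Sum>j\<in>UNIV. u j * of_nat (lookup m j)) = 0"
      using v[OF that(1,2)] by (simp add: sum_distrib_left)
    moreover have "monom_eval y m \<noteq> 0"
    proof -
      have "y i ^ lookup m i \<noteq> 0" for i using that(3)[of i] by (cases "i \<in> K") (auto simp: Kiff)
      then show ?thesis unfolding monom_eval_UNIV by simp
    qed
    ultimately show ?thesis by simp
  qed
  \<comment> \<open>Comparing the pairings with the two monomials obtained from \<open>m\<close> by
    adding the variable \<open>i\<close> or \<open>j\<close>.\<close>
  have shift: "u i = u j"
    if "m \<in> monoms (d - 1)" "\<And>l. lookup (m + single i 1) l \<le> d - 2"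
      "\<And>l. lookup (m + single j 1) l \<le> d - 2"
      "\<And>l. l \<notin> K \<Longrightarrow> lookup m l = 0" "i \<in> K" "j \<in> K" for m i j
  proof -
    have "(\<Sum>l\<in>UNIV. u l * of_nat (lookup m l)) + u k = 0"
      if k: "k \<in> K" "\<And>l. lookup (m + single k 1) l \<le> d - 2" for k
    proof -
      have "(\<Sum>l\<in>UNIV. u l * of_nat (lookup (m + single k 1) l)) = 0"
        using \<open>m \<in> monoms (d - 1)\<close> \<open>\<And>l. l \<notin> K \<Longrightarrow> lookup m l = 0\<close> k d
        by (intro pair) (auto simp: monoms_def monom_degree_add lookup_add lookup_single when_def)
      moreover have "u l * of_nat (lookup (m + single k 1) l) =
          u l * of_nat (lookup m l) + (if l = k then u k else 0)" for l
        by (simp add: lookup_add lookup_single when_def distrib_left)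
      ultimately show ?thesis by (simp add: sum.distrib)
    qed
    from this[OF that(5,2)] this[OF that(6,3)] show ?thesis
      by (metis add_left_cancel)
  qed
  have equal: "u i = u j" if ij: "i \<in> K" "j \<in> K" "i \<noteq> j" for i j
  proof -
    \<comment> \<open>A monomial of degree \<open>d - 1\<close> is needed that stays within
      exponents \<open>d - 2\<close> when \<open>i\<close> or \<open>j\<close> is added. For
      \<open>d \<ge> 5\<close> it can be built from \<open>i\<close> and \<open>j\<close>; for
      \<open>d = 4\<close> it uses one further element of the support, for \<open>d = 3\<close>
      two.\<close>
    consider "d \<ge> 5" | "d \<ge> 4" "card K \<ge> 3" | "d = 3" "card K \<ge> 4" using K(3) by linarith
    then show ?thesis
    proof cases
      case 1
      then show ?thesis
        using ij by (intro shift[of "single i (d - 3) + single j 2"])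
          (auto simp: monoms_def monom_degree_add lookup_add lookup_single when_def)
    next
      case 2
      have "card (K - {i, j}) \<ge> 1" using 2 ij by (simp add: card_Diff_subset)
      then have "K - {i, j} \<noteq> {}" by (metis card.empty not_one_le_zero)
      then obtain l where l: "l \<in> K" "l \<noteq> i" "l \<noteq> j" by blast
      then show ?thesis
        using ij 2 by (intro shift[of "single l (d - 2) + single j 1"])
          (auto simp: monoms_def monom_degree_add lookup_add lookup_single when_def)
    next
      case 3
      have "card (K - {i, j}) \<ge> 2" using 3 ij by (simp add: card_Diff_subset)
      then obtain l l' where l: "l \<in> K - {i, j}" "l' \<in> K - {i, j}" "l \<noteq> l'"
        using ex_distinct_pair by blast
      then show ?thesis
        using ij 3 by (intro shift[of "single l 1 + single l' 1"])
          (auto simp: monoms_def monom_degree_add lookup_add lookup_single when_def)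
    qed
  qed
  \<comment> \<open>With \<open>u\<close> constant on \<open>K\<close>, the pairing with any
    admissible monomial supported on \<open>K\<close> is \<open>d\<close> times this
    constant.\<close>
  have "u a = 0"
  proof -
    obtain m where m: "m \<in> monoms d" "\<And>i. lookup m i \<le> d - 2" "\<And>i. i \<notin> K \<Longrightarrow> lookup m i = 0"
    proof -
      consider "d \<ge> 4" | "d = 3" "card K \<ge> 4" using K(3) by linarith
      then show ?thesis
      proof cases
        case 1
        show ?thesis
          by (rule that[of "single a (d - 2) + single b 2"])
             (use 1 ab in \<open>auto simp: monoms_def monom_degree_add lookup_add lookup_single when_def\<close>)
      next
        case 2
        have "card (K - {a, b}) \<ge> 2" using 2 ab by (simp add: card_Diff_subset)
        then obtain l where l: "l \<in> K - {a, b}" using ex_distinct_pair by blast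
        show ?thesis
          by (rule that[of "single a 1 + single b 1 + single l 1"])
             (use 2 ab l in \<open>auto simp: monoms_def monom_degree_add lookup_add lookup_single when_def\<close>)
      qed
    qed
    have eq: "u j * of_nat (lookup m j) = u a * of_nat (lookup m j)" for j
      using m(3)[of j] equal[of j a] ab by (cases "j \<in> K"; cases "j = a") auto
    have "(\<Sum>j\<in>UNIV. u j * of_nat (lookup m j)) = 0"
      by (rule pair) (fact m)+
    then have "u a * of_nat (\<Sum>j\<in>UNIV. lookup m j) = 0"
      unfolding eq by (simp add: sum_distrib_left)
    moreover have "(\<Sum>j\<in>UNIV. lookup m j) = d"
      using m(1) by (simp add: monoms_def monom_degree_UNIV)
    ultimately have "u a * of_nat d = 0" by (simp only:)
    then show ?thesis using d by simp
  qed
  then have "u j = 0" if "j \<in> K" for j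
    using equal[OF that ab(1)] by (cases "j = a") auto
  then have "v j = 0" for j
    using out[of j] unfolding u_def Kiff by (cases "y j = 0") auto
  then show ?thesis by auto
qed

lemma sum_UNIV_Plus: "(\<Sum>x\<in>(UNIV :: ('a::finite + 'b::finite) set). h x) = (\<Sum>x\<in>UNIV. h (Inl x)) + (\<Sum>x\<in>UNIV. h (Inr x))"
  unfolding UNIV_sum by (subst sum.union_disjoint) (auto simp: sum.reindex)

lemma sum_UNIV_prod: "(\<Sum>r\<in>(UNIV :: ('a::finite \<times> 'b::finite) set). h r) = (\<Sum>i\<in>UNIV. \<Sum>j\<in>UNIV. h (i, j))"
  unfolding sum.cartesian_product UNIV_Times_UNIV by (intro sum.cong) auto

lemma pol_span_point:
  assumes "\<And>i. (\<lambda>\<tau>. y \<tau> i) \<in> pol J" "\<And>i. (\<lambda>\<tau>. t \<tau> i) \<in> pol J"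
  shows "(\<lambda>\<tau>. span_point (t \<tau>) (y \<tau>) $ k) \<in> pol J"
  unfolding span_point_nth
  by (intro pol_sum pol_mult assms(1) pol_compose[OF pol_point assms(2)])

lemma pol_mixed_coeff:
  assumes "\<And>i. (\<lambda>\<tau>. y \<tau> i) \<in> pol J" "\<And>i. (\<lambda>\<tau>. t \<tau> i) \<in> pol J"
  shows "(\<lambda>\<tau>. mixed_coeff (t \<tau>) (y \<tau>) j m) \<in> pol J"
  unfolding mixed_coeff_def
  by (intro pol_sum pol_mult pol_monom_deriv pol_span_point assms pol_compose[OF pol_point assms(2)])

lemma sum_mixed_coeff:
  "(\<Sum>m\<in>monoms d. mixed_coeff t y j m * c m) = dot (gradient (form_of d c) (span_point t y)) (point t j)"
  using sum_mixed_coeff_lookup[OF form_of_in_forms, of d c t y j]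
  by (simp add: lookup_form_of mult.commute)

lemma dot_test_form_point:
  assumes "\<And>y j. dot (gradient f (span_point t y)) (point t j) = monom_deriv y j m"
  shows "dot (gradient f (point t i)) (point t j) = monom_deriv (\<lambda>u. if u = i then 1 else 0) j m"
  using assms[of "\<lambda>u. if u = i then 1 else 0" j] by (simp only: span_point_coordinate)

text \<open>Under \<open>tangency f t = 0\<close>, multiples of the given points qualify as well.
  This is why at least two nonzero coordinates of \<open>y\<close> are required where such
  tangencies are excluded.\<close>

definition extra_tangency :: "'n::finite option cpoly \<Rightarrow> ('n \<times> 'n \<Rightarrow> complex) \<Rightarrow> ('n \<Rightarrow> complex) \<Rightarrow> bool" where
  "extra_tangency f t y \<longleftrightarrow> (\<forall>j. dot (gradient f (span_point t y)) (point t j) = 0)"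

text \<open>The point \<open>y\<close> brings \<open>CARD('n)\<close> equations but, normalized at
  \<open>i0\<close>, one parameter less. The bounds on the support make the equations
  independent.\<close>

lemma thin_extra_tangency_general:
  fixes i0 :: "'n::finite"
  assumes d: "d \<ge> 3"
  shows "thin (monoms d) {c. \<exists>(t :: 'n \<times> 'n \<Rightarrow> complex) y. tangency_minor d t \<noteq> 0 \<and> tangency (form_of d c) t = 0 \<and>
    y i0 = 1 \<and> extra_tangency (form_of d c) t y \<and> card {i. y i \<noteq> 0} \<ge> 2 \<and>
    (d \<ge> 5 \<or> d = 4 \<and> card {i. y i \<noteq> 0} \<ge> 3 \<or> d = 3 \<and> card {i. y i \<noteq> 0} \<ge> 4)}"
proof -
  let ?J = "Inl ` UNIV \<union> Inr ` (- {i0}) :: ('n \<times> 'n + 'n) set"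
  define tt where "tt \<tau> = (\<lambda>r. \<tau> (Inl r))" for \<tau> :: "'n \<times> 'n + 'n \<Rightarrow> complex"
  define yy where "yy \<tau> = (\<lambda>i. if i = i0 then 1 else \<tau> (Inr i))" for \<tau> :: "'n \<times> 'n + 'n \<Rightarrow> complex"
  define A where "A r m \<tau> = (case r of Inl s \<Rightarrow> tangency_coeff s m (tt \<tau>) | Inr j \<Rightarrow> mixed_coeff (tt \<tau>) (yy \<tau>) j m)"
    for r :: "'n \<times> 'n + 'n" and m \<tau>
  have card: "card ?J < CARD('n \<times> 'n + 'n)"
    by (intro psubset_card_mono) auto
  have tp: "(\<lambda>\<tau>. tt \<tau> r) \<in> pol ?J" for r unfolding tt_def by (rule pol_var) auto
  have yp: "(\<lambda>\<tau>. yy \<tau> i) \<in> pol ?J" for i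
    unfolding yy_def by (cases "i = i0") (auto intro: pol_var)
  have A: "A r m \<in> pol ?J" for r m
  proof (cases r)
    case (Inl s)
    then show ?thesis unfolding A_def using pol_compose[OF pol_tangency_coeff tp] by simp
  next
    case (Inr j)
    then show ?thesis unfolding A_def using pol_mixed_coeff[OF yp tp] by simp
  qed
  have "thin (monoms d) {c. \<exists>\<tau>. (\<forall>r. (\<Sum>m\<in>monoms d. A r m \<tau> * c m) = 0) \<and>
    (\<forall>w. (\<forall>m\<in>monoms d. (\<Sum>r\<in>UNIV. w r * A r m \<tau>) = 0) \<longrightarrow> w = (\<lambda>_. 0))}"
    by (rule thin_linear_family[OF finite_monoms _ card A]) auto
  then show ?thesis
  proof (rule thin_subset, intro subsetI CollectI, elim CollectE exE conjE)
    fix c t and y :: "'n \<Rightarrow> complex"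
    assume t: "tangency_minor d t \<noteq> 0" "tangency (form_of d c) t = 0"
      and y: "y i0 = 1" "extra_tangency (form_of d c) t y" "card {i. y i \<noteq> 0} \<ge> 2"
      and kd: "d \<ge> 5 \<or> d = 4 \<and> card {i. y i \<noteq> 0} \<ge> 3 \<or> d = 3 \<and> card {i. y i \<noteq> 0} \<ge> 4"
    define \<tau> where "\<tau> = case_sum t y"
    have ty: "tt \<tau> = t" "yy \<tau> = y" using y(1) by (auto simp: tt_def yy_def \<tau>_def)
    show "\<exists>\<tau>. (\<forall>r. (\<Sum>m\<in>monoms d. A r m \<tau> * c m) = 0) \<and>
      (\<forall>w. (\<forall>m\<in>monoms d. (\<Sum>r\<in>UNIV. w r * A r m \<tau>) = 0) \<longrightarrow> w = (\<lambda>_. 0))"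
    proof (intro exI[of _ \<tau>] conjI allI impI)
      show "(\<Sum>m\<in>monoms d. A r m \<tau> * c m) = 0" for r
        using t(2) y(2) by (cases r) (simp_all add: A_def ty tangency_coeff_sum sum_mixed_coeff extra_tangency_def)
    next
      fix w assume w: "\<forall>m\<in>monoms d. (\<Sum>r\<in>UNIV. w r * A r m \<tau>) = 0"
      \<comment> \<open>The relation between the rows is paired with the coefficients of a form that
        restricts to the monomial \<open>m\<close>.\<close>
      have test: "(\<Sum>i\<in>UNIV. \<Sum>j\<in>UNIV. w (Inl (i, j)) * monom_deriv (\<lambda>u. if u = i then 1 else 0) j m) +
          (\<Sum>j\<in>UNIV. w (Inr j) * monom_deriv y j m) = 0" if m: "m \<in> monoms d" for m
      proof -
        from ex_test_form[OF t(1) m] obtain f where f: "f \<in> forms d"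
          and fd: "\<And>y j. dot (gradient f (span_point t y)) (point t j) = monom_deriv y j m" by blast
        have "0 = (\<Sum>m\<in>monoms d. lookup f m * (\<Sum>r\<in>UNIV. w r * A r m \<tau>))"
          using w by simp
        also have "\<dots> = (\<Sum>r\<in>UNIV. w r * (\<Sum>m\<in>monoms d. lookup f m * A r m \<tau>))"
          by (simp add: sum_distrib_left mult_ac) (rule sum.swap)
        also have "\<dots> = (\<Sum>i\<in>UNIV. \<Sum>j\<in>UNIV. w (Inl (i, j)) * dot (gradient f (point t i)) (point t j)) +
            (\<Sum>j\<in>UNIV. w (Inr j) * dot (gradient f (span_point t y)) (point t j))"
          by (simp add: sum_UNIV_Plus sum_UNIV_prod A_def ty sum_tangency_coeff_lookup[OF f] sum_mixed_coeff_lookup[OF f])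
        finally show ?thesis
          unfolding dot_test_form_point[OF fd] fd by simp
      qed
      \<comment> \<open>Monomials with exponents at most \<open>d - 2\<close> do not see the nodes,
        so they settle the weights at \<open>y\<close>.\<close>
      have "(\<lambda>j. w (Inr j)) = (\<lambda>_. 0)"
      proof (rule support_weights_zero[OF d refl y(3) kd])
        fix m :: "'n \<Rightarrow>\<^sub>0 nat" assume m: "m \<in> monoms d" "\<And>i. lookup m i \<le> d - 2"
        show "(\<Sum>j\<in>UNIV. w (Inr j) * monom_deriv y j m) = 0"
          using test[OF m(1)] sum_node_terms_zero[OF d m, of "\<lambda>r. w (Inl r)"] by simp
      qed
      then have v: "w (Inr j) = 0" for j by (metis)
      have "(\<lambda>r. w (Inl r)) = (\<lambda>_. 0)"
        by (rule node_weights_zero[OF d]) (use test v in simp)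
      then have "w (Inl r) = 0" for r by metis
      with v show "w = (\<lambda>_. 0)"
        by (intro ext) (metis sum.exhaust)
    qed
  qed
qed

text \<open>For small supports the conditions at \<open>y\<close> are dependent, but then they force a single
  coefficient of the restricted form to vanish, whatever the values of \<open>y\<close> on its support. This is
  one condition without any parameter.\<close>

lemma thin_extra_tangency_special:
  fixes a b e :: "'n::finite"
  assumes d: "d \<ge> 3" and ab: "a \<noteq> b" and m0: "d = 3 \<and> e \<noteq> a \<and> e \<noteq> b \<or> d = 4 \<and> e = a"
  defines "y0 \<equiv> \<lambda>i. if i = a \<or> i = b then 1 else 0"
  shows "thin (monoms d) {c. \<exists>t :: 'n \<times> 'n \<Rightarrow> complex. tangency_minor d t \<noteq> 0 \<and> tangency (form_of d c) t = 0 \<and>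
    dot (gradient (form_of d c) (span_point t y0)) (point t e) = 0}"
proof -
  define A where "A r m t = (case r of Some s \<Rightarrow> tangency_coeff s m t | None \<Rightarrow> mixed_coeff t y0 e m)"
    for r :: "('n \<times> 'n) option" and m t
  have card: "card (UNIV :: ('n \<times> 'n) set) < CARD(('n \<times> 'n) option)"
    by (simp add: card_option)
  have A: "A r m \<in> pol UNIV" for r m
  proof (cases r)
    case (Some s)
    then show ?thesis unfolding A_def by (simp add: pol_tangency_coeff)
  next
    case None
    have "(\<lambda>t. mixed_coeff t y0 e m) \<in> pol UNIV"
      by (rule pol_mixed_coeff) (auto intro: pol_var)
    then show ?thesis unfolding A_def using None by simp
  qed
  have "thin (monoms d) {c. \<exists>\<tau>. (\<forall>r. (\<Sum>m\<in>monoms d. A r m \<tau> * c m) = 0) \<and>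
    (\<forall>w. (\<forall>m\<in>monoms d. (\<Sum>r\<in>UNIV. w r * A r m \<tau>) = 0) \<longrightarrow> w = (\<lambda>_. 0))}"
    by (rule thin_linear_family[OF finite_monoms _ card A]) auto
  then show ?thesis
  proof (rule thin_subset, intro subsetI CollectI, elim CollectE exE conjE)
    fix c t
    assume t: "tangency_minor d t \<noteq> 0" "tangency (form_of d c) t = 0"
      and y: "dot (gradient (form_of d c) (span_point t y0)) (point t e) = 0"
    show "\<exists>\<tau>. (\<forall>r. (\<Sum>m\<in>monoms d. A r m \<tau> * c m) = 0) \<and>
      (\<forall>w. (\<forall>m\<in>monoms d. (\<Sum>r\<in>UNIV. w r * A r m \<tau>) = 0) \<longrightarrow> w = (\<lambda>_. 0))"
    proof (intro exI[of _ t] conjI allI impI)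
      show "(\<Sum>m\<in>monoms d. A r m t * c m) = 0" for r
        using t(2) y by (cases r) (simp_all add: A_def tangency_coeff_sum sum_mixed_coeff)
    next
      fix w assume w: "\<forall>m\<in>monoms d. (\<Sum>r\<in>UNIV. w r * A r m t) = 0"
      have test: "(\<Sum>i\<in>UNIV. \<Sum>j\<in>UNIV. w (Some (i, j)) * monom_deriv (\<lambda>u. if u = i then 1 else 0) j m) +
          w None * monom_deriv y0 e m = 0" if m: "m \<in> monoms d" for m
      proof -
        from ex_test_form[OF t(1) m] obtain f where f: "f \<in> forms d"
          and fd: "\<And>y j. dot (gradient f (span_point t y)) (point t j) = monom_deriv y j m" by blast
        have "0 = (\<Sum>m\<in>monoms d. lookup f m * (\<Sum>r\<in>UNIV. w r * A r m t))"
          using w by simp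
        also have "\<dots> = (\<Sum>r\<in>UNIV. w r * (\<Sum>m\<in>monoms d. lookup f m * A r m t))"
          by (simp add: sum_distrib_left mult_ac) (rule sum.swap)
        also have "\<dots> = (\<Sum>i\<in>UNIV. \<Sum>j\<in>UNIV. w (Some (i, j)) * dot (gradient f (point t i)) (point t j)) +
            w None * dot (gradient f (span_point t y0)) (point t e)"
          by (simp add: sum_option_UNIV sum_UNIV_prod A_def sum_tangency_coeff_lookup[OF f] sum_mixed_coeff_lookup[OF f])
        finally show ?thesis
          unfolding dot_test_form_point[OF fd] fd by simp
      qed
      have v: "w None = 0"
      proof -
        \<comment> \<open>\<open>x_a x_b x_e\<close> for \<open>d = 3\<close> and
          \<open>x_a ^ 2 x_b ^ 2\<close> for \<open>d = 4\<close>: invisible at the nodes, with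
          nonzero derivative by \<open>x_e\<close> at \<open>y0\<close>.\<close>
        define m where "m = single a (d - 2) + single b (d - 2) + (if d = 3 then single e (1::nat) else 0)"
        have m: "m \<in> monoms d" "\<And>i. lookup m i \<le> d - 2"
          using m0 ab by (auto simp: m_def monoms_def monom_degree_add lookup_add lookup_single when_def)
        have "y0 k ^ lookup (m - single e 1) k \<noteq> 0" for k
          using m0 ab by (auto simp: m_def y0_def lookup_minus lookup_add lookup_single when_def)
        then have "monom_eval y0 (m - single e 1) \<noteq> 0"
          unfolding monom_eval_UNIV by simp
        moreover have "lookup m e \<noteq> 0"
          using m0 ab by (auto simp: m_def lookup_add lookup_single when_def)
        ultimately have "monom_deriv y0 e m \<noteq> 0" by (simp add: monom_deriv_def)
        then show ?thesis
          using test[OF m(1)] sum_node_terms_zero[OF d m, of "\<lambda>r. w (Some r)"] by simp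
      qed
      have "(\<lambda>r. w (Some r)) = (\<lambda>_. 0)"
        by (rule node_weights_zero[OF d]) (use test v in simp)
      then have "w (Some r) = 0" for r by metis
      with v show "w = (\<lambda>_. 0)"
        by (intro ext) (metis option.exhaust)
    qed
  qed
qed

text \<open>On the span of the points, tangency says that the gradient of the restricted form
  vanishes at the coordinate points, which removes its terms
  \<open>x_i ^ (d - 1) x_j\<close>.\<close>

lemma ex_restricted_form:
  fixes f :: "'n::finite option cpoly"
  assumes f: "f \<in> forms d" and d: "d \<ge> 1" and t: "tangency f t = 0"
  shows "\<exists>g\<in>forms d. (\<forall>y j. gradient g (\<chi> i. y i) $ j = dot (gradient f (span_point t y)) (point t j)) \<and>
    (\<forall>i j. lookup g (single i (d - 1) + single j 1) = 0)"
proof -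
  obtain g where g: "g \<in> forms d"
    "\<And>y. cpoly_eval y g = cpoly_eval (\<lambda>k. \<Sum>i\<in>UNIV. y i * point t i $ k) f"
    using ex_linear_substitution[OF f, of "\<lambda>i k. point t i $ k"] by blast
  have "cpoly_eval y g = cpoly_eval (($) (span_point t y)) f" for y
    by (simp only: g(2) span_point_nth[abs_def])
  then have grad: "gradient g y $ j = dot (gradient f (span_point t (($) y))) (point t j)" for y j
    by (rule gradient_linear_substitution)
  have "lookup g (single i (d - 1) + single j 1) = 0" (is "lookup g ?m = 0") for i j
  proof -
    have ax: "($) (axis i (1::complex)) = (\<lambda>u. if u = i then 1 else 0)"
      by (auto simp: axis_def)
    have "gradient g (axis i 1) $ j = tangency f t $ (i, j)"
      unfolding grad ax span_point_coordinate by (simp add: tangency_def)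
    then have "of_nat (lookup ?m j) * lookup g ?m = 0"
      using gradient_coordinate_point[OF d, of "lookup g" i j] form_of_lookup[OF g(1)] t by simp
    moreover have "lookup ?m j \<noteq> 0" by (simp add: lookup_add)
    ultimately show ?thesis by simp
  qed
  moreover have "gradient g (\<chi> i. y i) $ j = dot (gradient f (span_point t y)) (point t j)" for y j
    unfolding grad by (simp add: vec_lambda_inverse)
  ultimately show ?thesis using g(1) by blast
qed

lemma gradient_single_term:
  fixes g :: "'n::finite cpoly"
  assumes g: "g \<in> forms d" and m0: "m0 \<in> monoms d" and y: "\<And>v. v \<notin> S \<Longrightarrow> y v = 0"
    and only: "\<And>m. \<lbrakk>m \<in> monoms d; lookup g m \<noteq> 0; lookup m e \<noteq> 0;
      \<And>v. lookup (m - single e 1) v \<noteq> 0 \<Longrightarrow> v \<in> S\<rbrakk> \<Longrightarrow> m = m0"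
  shows "gradient g (\<chi> i. y i) $ e = lookup g m0 * monom_deriv y e m0"
proof -
  have yy: "($) (\<chi> i. y i) = y" by auto
  have "lookup g m * monom_deriv y e m = 0" if m: "m \<in> monoms d - {m0}" for m
  proof (rule ccontr)
    assume *: "lookup g m * monom_deriv y e m \<noteq> 0"
    then have "lookup m e \<noteq> 0" "monom_eval y (m - single e 1) \<noteq> 0" "lookup g m \<noteq> 0"
      by (auto simp: monom_deriv_def)
    moreover have "v \<in> S" if "lookup (m - single e 1) v \<noteq> 0" for v
    proof (rule ccontr)
      assume "v \<notin> S"
      then have "y v ^ lookup (m - single e 1) v = 0"
        using y that by simp
      then have "monom_eval y (m - single e 1) = 0"
        unfolding monom_eval_UNIV by (intro prod_zero) auto
      then show False using calculation by simp
    qed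
    ultimately have "m = m0" using only m by blast
    then show False using m by simp
  qed
  then have "(\<Sum>m\<in>monoms d. lookup g m * monom_deriv y e m) = (\<Sum>m\<in>{m0}. lookup g m * monom_deriv y e m)"
    using m0 by (intro sum.mono_neutral_right) (auto simp: finite_monoms)
  then show ?thesis by (simp add: gradient_form[OF g] yy)
qed

lemma monom_deriv_nonzero:
  assumes "lookup m e \<noteq> 0" "\<And>v. lookup m v \<noteq> 0 \<Longrightarrow> v \<noteq> e \<Longrightarrow> y v \<noteq> 0" "lookup m e \<ge> 2 \<Longrightarrow> y e \<noteq> 0"
  shows "monom_deriv y e (m :: 'v::finite \<Rightarrow>\<^sub>0 nat) \<noteq> 0"
proof -
  have "y v ^ lookup (m - single e 1) v \<noteq> 0" for v
    using assms(2)[of v] assms(3) by (cases "v = e") (auto simp: lookup_minus lookup_single when_def)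
  then have "monom_eval y (m - single e 1) \<noteq> 0"
    unfolding monom_eval_UNIV by simp
  then show ?thesis using assms(1) by (simp add: monom_deriv_def)
qed

text \<open>Without the node monomials, a single monomial \<open>m0\<close> in
  \<open>x_a, x_b, x_e\<close> can contribute to the derivative by \<open>x_e\<close>. Its vanishing
  at \<open>y\<close> forces the coefficient of \<open>m0\<close> to be 0, so the derivative
  vanishes at \<open>z\<close> as well.\<close>

lemma small_support_vanishing:
  fixes g :: "'n::finite cpoly" and y z :: "'n \<Rightarrow> complex"
  assumes g: "g \<in> forms d" and nodes: "\<And>i j. lookup g (single i (d - 1) + single j 1) = 0"
    and ab: "a \<noteq> b" and de: "d = 3 \<and> e \<noteq> a \<and> e \<noteq> b \<or> d = 4 \<and> e = a"
    and y: "\<And>v. v \<notin> {a, b, e} \<Longrightarrow> y v = 0" "y a \<noteq> 0" "y b \<noteq> 0" and z: "\<And>v. v \<notin> {a, b, e} \<Longrightarrow> z v = 0"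
    and grad: "gradient g (\<chi> i. y i) $ e = 0"
  shows "gradient g (\<chi> i. z i) $ e = 0"
proof -
  define m0 where "m0 = single a (d - 2) + single b (d - 2) +
    (if d = 3 then single e (1::nat) else 0)"
  have m0: "m0 \<in> monoms d"
    using de by (auto simp: m0_def monoms_def monom_degree_add)
  have only: "m = m0"
    if m: "m \<in> monoms d" "lookup g m \<noteq> 0" "lookup m e \<noteq> 0"
      and supp: "\<And>v. lookup (m - single e 1) v \<noteq> 0 \<Longrightarrow> v \<in> {a, b, e}" for m
  proof -
    have out: "lookup m v = 0" if "v \<notin> {a, b, e}" for v
      using supp[of v] that by (cases "lookup m v = 0") (auto simp: lookup_minus lookup_single when_def)
    have not_node: "m \<noteq> single i (d - 1) + single j 1" for i j
      using nodes m(2) by metis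
    have "d = (\<Sum>v\<in>UNIV. lookup m v)" using m(1) by (simp add: monoms_def monom_degree_UNIV)
    also have "\<dots> = (\<Sum>v\<in>{a, b, e}. lookup m v)"
      using out by (intro sum.mono_neutral_right) auto
    finally have sum: "d = (\<Sum>v\<in>{a, b, e}. lookup m v)" .
    have eqI: "m = p" if "lookup m a = lookup p a" "lookup m b = lookup p b" "lookup m e = lookup p e"
      "\<And>v. v \<notin> {a, b, e} \<Longrightarrow> lookup p v = 0" for p
    proof (rule poly_mapping_eqI)
      fix v
      show "lookup m v = lookup p v"
        using that out[of v] by (cases "v \<in> {a, b, e}") auto
    qed
    show ?thesis
    proof (cases "d = 3")
      case True
      then have e: "e \<noteq> a" "e \<noteq> b" using de by auto
      have s: "lookup m a + lookup m b + lookup m e = 3"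
        using sum ab e True by simp
      have "\<not> (lookup m a = 2 \<and> lookup m b = 0 \<and> lookup m e = 1)"
      proof
        assume A: "lookup m a = 2 \<and> lookup m b = 0 \<and> lookup m e = 1"
        have "m = single a 2 + single e 1"
          by (rule eqI) (use A True ab e in \<open>auto simp: lookup_add lookup_single when_def\<close>)
        then show False using not_node[of a e] True by simp
      qed
      moreover have "\<not> (lookup m a = 0 \<and> lookup m b = 2 \<and> lookup m e = 1)"
      proof
        assume A: "lookup m a = 0 \<and> lookup m b = 2 \<and> lookup m e = 1"
        have "m = single b 2 + single e 1"
          by (rule eqI) (use A True ab e in \<open>auto simp: lookup_add lookup_single when_def\<close>)
        then show False using not_node[of b e] True by simp
      qed
      moreover have "\<not> (lookup m a = 1 \<and> lookup m b = 0 \<and> lookup m e = 2)"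
      proof
        assume A: "lookup m a = 1 \<and> lookup m b = 0 \<and> lookup m e = 2"
        have "m = single e 2 + single a 1"
          by (rule eqI) (use A True ab e in \<open>auto simp: lookup_add lookup_single when_def\<close>)
        then show False using not_node[of e a] True by simp
      qed
      moreover have "\<not> (lookup m a = 0 \<and> lookup m b = 1 \<and> lookup m e = 2)"
      proof
        assume A: "lookup m a = 0 \<and> lookup m b = 1 \<and> lookup m e = 2"
        have "m = single e 2 + single b 1"
          by (rule eqI) (use A True ab e in \<open>auto simp: lookup_add lookup_single when_def\<close>)
        then show False using not_node[of e b] True by simp
      qed
      moreover have "\<not> (lookup m a = 0 \<and> lookup m b = 0 \<and> lookup m e = 3)"
      proof
        assume A: "lookup m a = 0 \<and> lookup m b = 0 \<and> lookup m e = 3"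
        have "m = single e 2 + single e 1"
          by (rule eqI) (use A True ab e in \<open>auto simp: lookup_add lookup_single when_def\<close>)
        then show False using not_node[of e e] True by simp
      qed
      ultimately have "lookup m a = 1 \<and> lookup m b = 1 \<and> lookup m e = 1"
        using s m(3) by presburger
      then show ?thesis
        using True ab e by (intro eqI) (auto simp: m0_def lookup_add lookup_single when_def)
    next
      case False
      then have d: "d = 4" "e = a" using de by auto
      have s: "lookup m a + lookup m b = 4"
        using sum ab d by (simp add: insert_commute)
      have "\<not> (lookup m a = 4 \<and> lookup m b = 0)"
      proof
        assume A: "lookup m a = 4 \<and> lookup m b = 0"
        have "m = single a 3 + single a 1"
          by (rule eqI) (use A d ab in \<open>auto simp: lookup_add lookup_single when_def\<close>)
        then show False using not_node[of a a] d by simp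
      qed
      moreover have "\<not> (lookup m a = 3 \<and> lookup m b = 1)"
      proof
        assume A: "lookup m a = 3 \<and> lookup m b = 1"
        have "m = single a 3 + single b 1"
          by (rule eqI) (use A d ab in \<open>auto simp: lookup_add lookup_single when_def\<close>)
        then show False using not_node[of a b] d by simp
      qed
      moreover have "\<not> (lookup m a = 1 \<and> lookup m b = 3)"
      proof
        assume A: "lookup m a = 1 \<and> lookup m b = 3"
        have "m = single b 3 + single a 1"
          by (rule eqI) (use A d ab in \<open>auto simp: lookup_add lookup_single when_def\<close>)
        then show False using not_node[of b a] d by simp
      qed
      ultimately have "lookup m a = 2 \<and> lookup m b = 2"
        using s m(3)[unfolded d(2)] by presburger
      then show ?thesis
        using d ab by (intro eqI) (auto simp: m0_def lookup_add lookup_single when_def)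
    qed
  qed
  have "monom_deriv y e m0 \<noteq> 0"
    by (rule monom_deriv_nonzero)
       (use y de ab in \<open>auto simp: m0_def lookup_add lookup_single when_def split: if_splits\<close>)
  moreover have "gradient g (\<chi> i. y i) $ e = lookup g m0 * monom_deriv y e m0"
    by (rule gradient_single_term[OF g m0, where S = "{a, b, e}"]) (fact y(1) only)+
  then have "lookup g m0 * monom_deriv y e m0 = 0"
    using grad by simp
  ultimately have "lookup g m0 = 0" by simp
  moreover have "gradient g (\<chi> i. z i) $ e = lookup g m0 * monom_deriv z e m0"
    by (rule gradient_single_term[OF g m0, where S = "{a, b, e}"]) (fact z only)+
  ultimately show ?thesis by simp
qed

lemma ex_third_element:
  assumes "CARD('n::finite) \<ge> 3"
  shows "\<exists>e :: 'n. e \<noteq> a \<and> e \<noteq> b"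
proof (rule ccontr)
  assume "\<not> ?thesis"
  then have "(UNIV :: 'n set) \<subseteq> {a, b}" by blast
  then have "CARD('n) \<le> card {a, b}" by (rule card_mono[rotated]) simp
  also have "\<dots> \<le> 2" by (simp add: card_insert_if)
  finally show False using assms by simp
qed

lemma thin_extra_tangency:
  assumes n: "CARD('n::finite) \<ge> 3" and d: "d \<ge> 3"
  shows "thin (monoms d) {c. \<exists>(t :: 'n \<times> 'n \<Rightarrow> complex) y. tangency_minor d t \<noteq> 0 \<and> tangency (form_of d c) t = 0 \<and>
    extra_tangency (form_of d c) t y \<and> card {i. y i \<noteq> 0} \<ge> 2}" (is "thin _ ?B")
proof -
  define C1 where "C1 i0 = {c. \<exists>(t :: 'n \<times> 'n \<Rightarrow> complex) y. tangency_minor d t \<noteq> 0 \<and> tangency (form_of d c) t = 0 \<and>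
    y i0 = 1 \<and> extra_tangency (form_of d c) t y \<and> card {i. y i \<noteq> 0} \<ge> 2 \<and>
    (d \<ge> 5 \<or> d = 4 \<and> card {i. y i \<noteq> 0} \<ge> 3 \<or> d = 3 \<and> card {i. y i \<noteq> 0} \<ge> 4)}" for i0
  define y0 :: "'n \<Rightarrow> 'n \<Rightarrow> 'n \<Rightarrow> complex" where "y0 a b = (\<lambda>i. if i = a \<or> i = b then 1 else 0)" for a b
  define S where "S = {(a, b, e :: 'n). a \<noteq> b \<and> (d = 3 \<and> e \<noteq> a \<and> e \<noteq> b \<or> d = 4 \<and> e = a)}"
  define C2 where "C2 = (\<lambda>(a, b, e). {c. \<exists>t :: 'n \<times> 'n \<Rightarrow> complex. tangency_minor d t \<noteq> 0 \<and> tangency (form_of d c) t = 0 \<and>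
    dot (gradient (form_of d c) (span_point t (y0 a b))) (point t e) = 0})"
  have "thin (monoms d) (C1 i0)" for i0
    unfolding C1_def by (rule thin_extra_tangency_general[OF d])
  moreover have "thin (monoms d) (C2 s)" if "s \<in> S" for s
  proof -
    obtain a b e where s: "s = (a, b, e)" by (metis surj_pair)
    then show ?thesis
      using that thin_extra_tangency_special[OF d, of a b e]
      unfolding S_def C2_def y0_def by simp
  qed
  ultimately have "thin (monoms d) ((\<Union>i0. C1 i0) \<union> (\<Union>s\<in>S. C2 s))"
    by (intro thin_Un thin_UN) auto
  then show ?thesis
  proof (rule thin_subset, intro subsetI, elim CollectE exE conjE)
    fix c t and y :: "'n \<Rightarrow> complex"
    assume t: "tangency_minor d t \<noteq> 0" "tangency (form_of d c) t = 0"
      and ex: "extra_tangency (form_of d c) t y" and card: "card {i. y i \<noteq> 0} \<ge> 2"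
    let ?K = "{i. y i \<noteq> 0}"
    obtain a b where ab: "y a \<noteq> 0" "y b \<noteq> 0" "a \<noteq> b"
      using ex_distinct_pair[OF card] by blast
    show "c \<in> (\<Union>i0. C1 i0) \<union> (\<Union>s\<in>S. C2 s)"
    proof (cases "d \<ge> 5 \<or> d = 4 \<and> card ?K \<ge> 3 \<or> d = 3 \<and> card ?K \<ge> 4")
      case True
      define z where "z = (\<lambda>i. y i / y a)"
      have "span_point t z = (1 / y a) *s span_point t y"
        by (simp add: vec_eq_iff span_point_nth z_def sum_distrib_left sum_divide_distrib)
      then have "extra_tangency (form_of d c) t z"
        using ex unfolding extra_tangency_def
        by (simp add: gradient_scale_arg[OF form_of_in_forms] dot_def mult.assoc flip: sum_distrib_left)
      moreover have "{i. z i \<noteq> 0} = ?K" using ab by (auto simp: z_def)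
      moreover have "z a = 1" using ab by (simp add: z_def)
      ultimately have "c \<in> C1 a"
        unfolding C1_def using t card True by (intro CollectI exI[of _ t] exI[of _ z]) simp
      then show ?thesis by blast
    next
      case False
      have "\<exists>a b e. (a, b, e) \<in> S \<and> y a \<noteq> 0 \<and> y b \<noteq> 0 \<and> ?K \<subseteq> {a, b, e}"
      proof -
        consider "d = 3" "card ?K = 2" | "d = 3" "card ?K = 3" | "d = 4" "card ?K = 2"
          using False d card by linarith
        then show ?thesis
        proof cases
          case 1
          from 1(2) obtain a b where K: "?K = {a, b}" "a \<noteq> b" unfolding card_2_iff by (elim exE conjE)
          \<comment> \<open>For \<open>d = 3\<close> and support \<open>{a, b}\<close>, the usable
            condition is the derivative in a third direction \<open>e\<close>, although
            \<open>y e = 0\<close>.\<close>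
          obtain e where "e \<noteq> a" "e \<noteq> b"
            using ex_third_element[OF n] by blast
          then have "(a, b, e) \<in> S" using K(2) 1 by (simp add: S_def)
          moreover have "a \<in> ?K" "b \<in> ?K" "?K \<subseteq> {a, b, e}" unfolding K(1) by auto
          ultimately show ?thesis by blast
        next
          case 2
          from 2(2) obtain a b e where K: "?K = {a, b, e}" "a \<noteq> b" "b \<noteq> e" "a \<noteq> e"
            unfolding card_3_iff by (elim exE conjE)
          then have "(a, b, e) \<in> S" using 2 by (simp add: S_def)
          moreover have "a \<in> ?K" "b \<in> ?K" "?K \<subseteq> {a, b, e}" unfolding K(1) by auto
          ultimately show ?thesis by blast
        next
          case 3
          from 3(2) obtain a b where K: "?K = {a, b}" "a \<noteq> b" unfolding card_2_iff by (elim exE conjE)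
          then have "(a, b, a) \<in> S" using 3 by (simp add: S_def)
          moreover have "a \<in> ?K" "b \<in> ?K" "?K \<subseteq> {a, b, a}" unfolding K(1) by auto
          ultimately show ?thesis by blast
        qed
      qed
      then obtain a b e where abe: "(a, b, e) \<in> S" "y a \<noteq> 0" "y b \<noteq> 0" "?K \<subseteq> {a, b, e}" by blast
      have "form_of d c \<in> forms d" "d \<ge> 1" using d by (auto intro: form_of_in_forms)
      from ex_restricted_form[OF this t(2)] obtain g where g: "g \<in> forms d"
        "\<And>y j. gradient g (\<chi> i. y i) $ j = dot (gradient (form_of d c) (span_point t y)) (point t j)"
        "\<And>i j. lookup g (single i (d - 1) + single j 1) = 0"
        by blast
      have "gradient g (\<chi> i. y0 a b i) $ e = 0"
      proof (rule small_support_vanishing[OF g(1,3), where a = a and b = b and y = y])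
        show "gradient g (\<chi> i. y i) $ e = 0"
          unfolding g(2) using ex by (simp add: extra_tangency_def)
        show "y v = 0" if "v \<notin> {a, b, e}" for v using that abe(4) by blast
        show "y0 a b v = 0" if "v \<notin> {a, b, e}" for v using that by (simp add: y0_def)
      qed (use abe in \<open>auto simp: S_def\<close>)
      then have "c \<in> C2 (a, b, e)"
        unfolding C2_def using t by (auto simp: g(2))
      then show ?thesis using abe(1) by blast
    qed
  qed
qed

section \<open>Holomorphic implicit functions\<close>

text \<open>The real inverse function theorem for the map sending \<open>(z, w)\<close> to
  \<open>(z, F (z, w))\<close>. Its derivative commutes with complex scalars, hence so does the
  inverse of the derivative, and the implicit function is holomorphic.\<close>

lemma holomorphic_implicit_function:
  fixes F :: "(complex^'n::finite) \<times> (complex^'m::finite) \<Rightarrow> complex^'m"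
  assumes der: "\<And>p. (F has_derivative F' p) (at p)"
    and cont: "\<And>e. continuous_on UNIV (\<lambda>p. F' p e)"
    and lin: "\<And>p c v u. F' p (c *s v, c *s u) = c *s F' p (v, u)"
    and F0: "F (z0, w0) = 0"
    and inj: "\<And>u. F' (z0, w0) (0, u) = 0 \<Longrightarrow> u = 0"
  obtains U V \<omega> \<omega>' where "open U" "z0 \<in> U" "open V" "(z0, w0) \<in> V" "\<omega> z0 = w0"
    "\<And>z w. (z, w) \<in> V \<Longrightarrow> F (z, w) = 0 \<Longrightarrow> w = \<omega> z"
    "\<And>z. z \<in> U \<Longrightarrow> F (z, \<omega> z) = 0"
    "\<And>z. z \<in> U \<Longrightarrow> (\<omega> has_derivative \<omega>' z) (at z)"
    "\<And>z c v. z \<in> U \<Longrightarrow> \<omega>' z (c *s v) = c *s \<omega>' z v"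
    "\<And>z v. z \<in> U \<Longrightarrow> F' (z, \<omega> z) (v, \<omega>' z v) = 0"
proof -
  let ?\<Phi> = "\<lambda>p. (fst p, F p)"
  let ?\<Phi>' = "\<lambda>p q. (fst q, F' p q)"
  \<comment> \<open>The inverse function theorem wants the derivative to be continuous as a bounded
    linear map; in finite dimension this may be checked vector by vector.\<close>
  define B where "B p = Blinfun (?\<Phi>' p)" for p
  have der\<Phi>: "(?\<Phi> has_derivative ?\<Phi>' p) (at p)" for p
    by (intro has_derivative_Pair has_derivative_fst has_derivative_ident der)
  have B: "blinfun_apply (B p) = ?\<Phi>' p" for p
    unfolding B_def by (rule bounded_linear_Blinfun_apply[OF has_derivative_bounded_linear[OF der\<Phi>]])
  have contB: "continuous_on UNIV B"
    by (rule continuous_on_blinfun_componentwise) (simp add: B continuous_on_Pair cont continuous_on_const)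
  have linB: "linear (?\<Phi>' p)" for p
    by (rule bounded_linear.linear[OF has_derivative_bounded_linear[OF der\<Phi>]])
  have "inj (?\<Phi>' (z0, w0))"
  proof (rule injI)
    fix a b assume ab: "?\<Phi>' (z0, w0) a = ?\<Phi>' (z0, w0) b"
    have "?\<Phi>' (z0, w0) (a - b) = ?\<Phi>' (z0, w0) a - ?\<Phi>' (z0, w0) b"
      by (rule linear_diff[OF linB])
    then have *: "?\<Phi>' (z0, w0) (a - b) = 0" using ab by simp
    then have "fst (a - b) = 0" by (simp add: zero_prod_def)
    then have "a - b = (0, snd (a - b))" by (simp add: prod_eq_iff)
    with * have "F' (z0, w0) (0, snd (a - b)) = 0" by (simp add: zero_prod_def)
    then have "snd (a - b) = 0" by (rule inj)
    with \<open>fst (a - b) = 0\<close> show "a = b" by (simp add: prod_eq_iff)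
  qed
  then obtain G where G: "linear G" "G \<circ> ?\<Phi>' (z0, w0) = id"
    using linear_injective_left_inverse[OF linB] by blast
  have bG: "blinfun_apply (Blinfun G) = G"
    by (rule bounded_linear_Blinfun_apply) (use G(1) linear_conv_bounded_linear in blast)
  have inv: "Blinfun G o\<^sub>L B (z0, w0) = id_blinfun"
  proof (rule blinfun_eqI)
    fix x
    have "(G \<circ> ?\<Phi>' (z0, w0)) x = x" using G(2) by simp
    then show "blinfun_apply (Blinfun G o\<^sub>L B (z0, w0)) x = blinfun_apply id_blinfun x"
      by (simp add: bG B)
  qed
  have derB: "\<And>p. p \<in> UNIV \<Longrightarrow> (?\<Phi> has_derivative blinfun_apply (B p)) (at p)"
    unfolding B by (rule der\<Phi>)
  obtain U' V g g' where ift': "open U'" "U' \<subseteq> UNIV" "(z0, w0) \<in> U'" "open V" "?\<Phi> (z0, w0) \<in> V"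
    "homeomorphism U' V ?\<Phi> g" "\<And>y. y \<in> V \<Longrightarrow> (g has_derivative g' y) (at y)"
    "\<And>y. y \<in> V \<Longrightarrow> g' y = Hilbert_Choice.inv (blinfun_apply (B (g y)))"
    "\<And>y. y \<in> V \<Longrightarrow> bij (blinfun_apply (B (g y)))"
  proof (rule inverse_function_theorem[OF open_UNIV _ contB UNIV_I inv, of ?\<Phi>])
    show "(?\<Phi> has_derivative blinfun_apply (B p)) (at p)" for p by (rule derB) simp
  next
    fix U' V g g'
    assume a: "open U'" "U' \<subseteq> UNIV" "(z0, w0) \<in> U'" "open V" "?\<Phi> (z0, w0) \<in> V"
      "homeomorphism U' V ?\<Phi> g" "\<And>y. y \<in> V \<Longrightarrow> (g has_derivative g' y) (at y)"
      "\<And>y. y \<in> V \<Longrightarrow> g' y = Hilbert_Choice.inv (blinfun_apply (B (g y)))"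
      "\<And>y. y \<in> V \<Longrightarrow> bij (blinfun_apply (B (g y)))"
    show thesis by (rule that) (fact a)+
  qed
  note ift = ift'(1,3-9)
  have gU: "g y \<in> U'" and \<Phi>g: "?\<Phi> (g y) = y" if "y \<in> V" for y
    using ift(5) that unfolding homeomorphism_def by auto
  have g\<Phi>: "?\<Phi> p \<in> V" "g (?\<Phi> p) = p" if "p \<in> U'" for p
    using ift(5) that unfolding homeomorphism_def by auto
  have g'y: "?\<Phi>' (g y) (g' y q) = q" if "y \<in> V" for y q
    using surj_f_inv_f[OF bij_is_surj[OF ift(8)[OF that]], of q] ift(7)[OF that] B by simp
  have g'lin: "g' y (c *s v, c *s u) = (c *s fst (g' y (v, u)), c *s snd (g' y (v, u)))" if "y \<in> V" for y c v u
  proof -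
    let ?q = "g' y (v, u)"
    have "?\<Phi>' (g y) (c *s fst ?q, c *s snd ?q) = (c *s v, c *s u)"
      using g'y[OF that, of "(v, u)"] lin[of "g y" c "fst ?q" "snd ?q"] by (cases ?q) simp
    then have "blinfun_apply (B (g y)) (c *s fst ?q, c *s snd ?q) = (c *s v, c *s u)" by (simp add: B)
    then show ?thesis
      using inv_f_f[OF bij_is_inj[OF ift(8)[OF that]], of "(c *s fst ?q, c *s snd ?q)"] ift(7)[OF that] by simp
  qed
  define U where "U = (\<lambda>z. (z, 0 :: complex^'m)) -` V"
  define \<omega> where "\<omega> z = snd (g (z, 0))" for z
  define \<omega>' where "\<omega>' z v = snd (g' (z, 0) (v, 0))" for z v
  have UV: "(z, 0) \<in> V" if "z \<in> U" for z using that by (simp add: U_def)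
  have gz: "g (z, 0) = (z, \<omega> z)" if "z \<in> U" for z
    using \<Phi>g[OF UV[OF that]] by (simp add: \<omega>_def prod_eq_iff)
  show ?thesis
  proof (rule that)
    show "open U"
      unfolding U_def by (rule open_vimage[OF ift(3)]) (intro continuous_intros)
    show "z0 \<in> U" using ift(4) F0 by (simp add: U_def)
    \<comment> \<open>The \<open>V\<close> of the conclusion is the source neighbourhood
      \<open>U'\<close>, on which the map is injective.\<close>
    show "open U'" "(z0, w0) \<in> U'" by fact+
    show "\<omega> z0 = w0" using g\<Phi>(2)[OF ift(2)] F0 by (simp add: \<omega>_def)
    show "w = \<omega> z" if "(z, w) \<in> U'" "F (z, w) = 0" for z w
      using g\<Phi>(2)[OF that(1)] that(2) by (simp add: \<omega>_def)
    show "F (z, \<omega> z) = 0" if "z \<in> U" for z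
      using \<Phi>g[OF UV[OF that]] gz[OF that] by simp
    show "(\<omega> has_derivative \<omega>' z) (at z)" if "z \<in> U" for z
    proof -
      have "((\<lambda>z. (z, 0 :: complex^'m)) has_derivative (\<lambda>v. (v, 0))) (at z)"
        by (intro has_derivative_Pair has_derivative_ident has_derivative_const)
      from has_derivative_compose[OF this, of g "g' (z, 0)"] ift(6)[OF UV[OF that]]
      have "((\<lambda>z. g (z, 0)) has_derivative (\<lambda>v. g' (z, 0) (v, 0))) (at z)" by simp
      from has_derivative_snd[OF this] show ?thesis
        unfolding \<omega>_def[abs_def] \<omega>'_def[abs_def] .
    qed
    show "\<omega>' z (c *s v) = c *s \<omega>' z v" if "z \<in> U" for z c v
      using g'lin[OF UV[OF that], of c v 0] by (simp add: \<omega>'_def)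
    show "F' (z, \<omega> z) (v, \<omega>' z v) = 0" if "z \<in> U" for z v
    proof -
      have *: "(fst (g' (z, 0) (v, 0)), F' (z, \<omega> z) (g' (z, 0) (v, 0))) = (v, 0)"
        using g'y[OF UV[OF that], of "(v, 0)"] gz[OF that] by simp
      then have "g' (z, 0) (v, 0) = (v, \<omega>' z v)" by (simp add: \<omega>'_def prod_eq_iff)
      with * show ?thesis by simp
    qed
  qed
qed

section \<open>Local structure of the dual hypersurface\<close>

lemma dot_simps:
  "dot (a + b) c = dot a c + dot b c" "dot a (b + c) = dot a b + dot a c"
  "dot (r *s a) b = r * dot a b" "dot a (r *s b) = r * dot a b"
  "dot (a - b) c = dot a c - dot b c" "dot 0 a = 0" "dot a 0 = 0"
  by (simp_all add: dot_def algebra_simps sum.distrib sum_distrib_left sum_subtractf)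

lemma dot_sum: "dot a (\<Sum>i\<in>A. b i) = (\<Sum>i\<in>A. dot a (b i))"
  by (induction A rule: infinite_finite_induct) (auto simp: dot_simps)

lemma dot_commute: "dot a b = dot b a"
  by (simp add: dot_def mult.commute)

lemma dot_axis: "dot a (axis k 1) = a $ k" "dot (axis k 1) a = a $ k"
  by (simp_all add: dot_def axis_def if_distrib[of "\<lambda>x. _ * x"] if_distrib[of "\<lambda>x. x * _"] cong: if_cong)

lemma dot_hessian: "dot (hessian f x *v u) v = dot u (hessian f x *v v)"
proof -
  have "dot (hessian f x *v u) v = (\<Sum>k\<in>UNIV. \<Sum>l\<in>UNIV. hessian f x $ k $ l * u $ l * v $ k)"
    by (simp add: dot_def matrix_vector_mult_def sum_distrib_right)
  also have "\<dots> = (\<Sum>l\<in>UNIV. \<Sum>k\<in>UNIV. u $ l * (hessian f x $ l $ k * v $ k))"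
    by (subst sum.swap) (simp add: hessian_sym[of f x] mult_ac)
  finally show ?thesis by (simp add: dot_def matrix_vector_mult_def sum_distrib_left)
qed

text \<open>Since \<open>H $ i0 \<noteq> 0\<close>, the basis vector \<open>axis i0 1\<close> lies
  off the hyperplane and completes the \<open>p i\<close> to a basis, the columns of
  \<open>?M\<close>.\<close>

lemma spanning_hyperplane:
  fixes p :: "'n::finite \<Rightarrow> complex^('n option)"
  assumes indep: "\<And>y. (\<Sum>i\<in>UNIV. y i *s p i) = 0 \<Longrightarrow> y = (\<lambda>_. 0)"
    and H: "\<And>i. dot H (p i) = 0" "H $ i0 \<noteq> 0"
  shows "dot H x = 0 \<Longrightarrow> \<exists>y. x = (\<Sum>i\<in>UNIV. y i *s p i)"
    and "(\<And>i. dot h (p i) = 0) \<Longrightarrow> h = (h $ i0 / H $ i0) *s H"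
proof -
  let ?M = "(\<chi> k c. case c of None \<Rightarrow> axis i0 1 $ k | Some j \<Rightarrow> p j $ k) :: complex^('n option)^('n option)"
  have Mv: "?M *v x = x $ None *s axis i0 1 + (\<Sum>j\<in>UNIV. x $ Some j *s p j)" for x
    by (simp add: vec_eq_iff matrix_vector_mult_def sum_option_UNIV mult.commute)
  have dM: "dot h (?M *v x) = x $ None * h $ i0 + (\<Sum>j\<in>UNIV. x $ Some j * dot h (p j))" for h x
    unfolding Mv by (simp add: dot_simps dot_sum dot_axis)
  have ker: "x = 0" if x: "?M *v x = 0" for x
  proof -
    have "x $ None * H $ i0 = 0" using dM[of H x] x H(1) by (simp add: dot_simps)
    then have 0: "x $ None = 0" using H(2) by simp
    then have "(\<Sum>j\<in>UNIV. x $ Some j *s p j) = 0" using x unfolding Mv by simp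
    then have "(\<lambda>j. x $ Some j) = (\<lambda>_. 0)" by (rule indep)
    then have "x $ Some j = 0" for j by (simp only: fun_eq_iff)
    then have "x $ k = 0" for k using 0 by (cases k) simp_all
    then show ?thesis by (simp add: vec_eq_iff)
  qed
  have "invertible ?M"
    unfolding invertible_left_inverse matrix_left_invertible_ker by (intro allI impI) (rule ker)
  then obtain N where N: "?M ** N = mat 1" unfolding invertible_def by blast
  have surj: "?M *v (N *v x) = x" for x by (simp add: matrix_vector_mul_assoc N)
  show "\<exists>y. x = (\<Sum>i\<in>UNIV. y i *s p i)" if "dot H x = 0"
  proof -
    have "(N *v x) $ None * H $ i0 = 0"
      using dM[of H "N *v x"] that H(1) unfolding surj by simp
    then have "(N *v x) $ None = 0" using H(2) by simp
    then have "x = (\<Sum>j\<in>UNIV. (N *v x) $ Some j *s p j)"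
      using Mv[of "N *v x"] unfolding surj by simp
    then show ?thesis by (intro exI[of _ "\<lambda>j. (N *v x) $ Some j"])
  qed
  show "h = (h $ i0 / H $ i0) *s H" if "\<And>i. dot h (p i) = 0"
  proof -
    let ?h = "h - (h $ i0 / H $ i0) *s H"
    have *: "dot ?h (?M *v x) = 0" for x
      unfolding dM using that H by (simp add: dot_simps)
    have "?h $ k = 0" for k
      using *[of "N *v axis k 1"] unfolding surj dot_axis .
    then have "?h = 0" by (simp only: vec_eq_iff zero_index simp_thms)
    then show ?thesis by (rule right_minus_eq[THEN iffD1])
  qed
qed

section \<open>Affine charts of the dual space\<close>

definition chart_vector :: "'n::finite option \<Rightarrow> complex^'n \<Rightarrow> complex^('n option)" where
  "chart_vector i z = (\<chi> k. case Transposition.transpose None i k of None \<Rightarrow> 1 | Some j \<Rightarrow> z $ j)"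

definition chart_direction :: "'n::finite option \<Rightarrow> complex^'n \<Rightarrow> complex^('n option)" where
  "chart_direction i v = (\<chi> k. case Transposition.transpose None i k of None \<Rightarrow> 0 | Some j \<Rightarrow> v $ j)"

lemma chart_vector_self [simp]: "chart_vector i z $ i = 1"
  by (simp add: chart_vector_def)

lemma chart_vector_surj:
  assumes "H $ i = 1"
  shows "\<exists>z. chart_vector i z = H"
proof (intro exI[of _ "\<chi> j. H $ Transposition.transpose None i (Some j)"])
  show "chart_vector i (\<chi> j. H $ Transposition.transpose None i (Some j)) = H"
    unfolding vec_eq_iff
  proof
    fix k
    show "chart_vector i (\<chi> j. H $ Transposition.transpose None i (Some j)) $ k = H $ k"
    proof (cases "Transposition.transpose None i k")
      case None
      then have "k = i" by (metis transpose_apply_first transpose_involutory)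
      then show ?thesis using assms by simp
    next
      case (Some j)
      then have "Transposition.transpose None i (Some j) = k" by (metis transpose_involutory)
      then show ?thesis using Some by (simp add: chart_vector_def)
    qed
  qed
qed

lemma chart_vector_has_derivative: "(chart_vector i has_derivative chart_direction i) (at z)"
  unfolding chart_vector_def[abs_def] chart_direction_def[abs_def]
proof (rule has_derivative_vec_lambda)
  fix k
  show "((\<lambda>z. case Transposition.transpose None i k of None \<Rightarrow> 1 | Some j \<Rightarrow> z $ j) has_derivative
      (\<lambda>v. case Transposition.transpose None i k of None \<Rightarrow> 0 | Some j \<Rightarrow> v $ j)) (at z)"
    by (cases "Transposition.transpose None i k") (simp_all add: has_derivative_vec_nth)
qed

lemma chart_direction_scale: "chart_direction i (c *s v) = c *s chart_direction i v"
  by (auto simp: chart_direction_def vec_eq_iff split: option.splits)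

lemma chart_direction_axis:
  assumes "k \<noteq> i"
  shows "\<exists>v. chart_direction i v = axis k 1"
proof -
  obtain j where j: "Transposition.transpose None i k = Some j"
    using assms by (metis not_Some_eq transpose_apply_first transpose_involutory)
  have "chart_direction i (axis j 1) = axis k 1"
    unfolding vec_eq_iff
  proof
    fix k'
    show "chart_direction i (axis j 1) $ k' = axis k 1 $ k'"
    proof (cases "k' = k")
      case True
      then show ?thesis using j by (simp add: chart_direction_def)
    next
      case False
      then have "Transposition.transpose None i k' \<noteq> Some j"
        using j by (metis transpose_involutory)
      then show ?thesis using False
        by (auto simp: chart_direction_def axis_def split: option.splits)
    qed
  qed
  then show ?thesis by blast
qed

text \<open>The scalar \<open>c\<close> absorbs the choice of representatives, which turns
  membership in the projective image into an equation between vectors.\<close>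

lemma dual_hypersurface_chart:
  assumes f: "f \<in> forms d"
  shows "affine_chart i z \<in> dual_hypersurface f \<longleftrightarrow>
    (\<exists>x c. x \<noteq> 0 \<and> cpoly_eval (($) x) f = 0 \<and> c \<noteq> 0 \<and> gradient f x = c *s chart_vector i z)"
    (is "?l \<longleftrightarrow> ?r")
proof -
  have chart: "affine_chart i z = vec_class (chart_vector i z)"
    by (simp add: affine_chart_def chart_vector_def)
  show ?thesis
  proof
    assume ?l
    then obtain P where P: "P \<in> hypersurface f" "vec_class (chart_vector i z) = dual_map f P"
      unfolding dual_hypersurface_def chart by blast
    have "chart_vector i z \<in> vec_class (chart_vector i z)"
      unfolding proj_class_def by (intro CollectI exI[of _ 1]) simp
    then obtain x where x: "x \<in> P" "chart_vector i z \<in> vec_class (gradient f x)"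
      unfolding P(2) dual_map_def by blast
    then obtain c where c: "chart_vector i z = c *s gradient f x" "c \<noteq> 0"
      unfolding proj_class_def by blast
    have "x \<noteq> 0" "cpoly_eval (($) x) f = 0"
      using P(1) x(1) unfolding hypersurface_def proj_space_def proj_class_def by auto
    moreover have "gradient f x = (1 / c) *s chart_vector i z"
      using c by (simp add: vec_eq_iff)
    moreover have "1 / c \<noteq> 0" using c(2) by simp
    ultimately show ?r by blast
  next
    assume ?r
    then obtain x c where x: "x \<noteq> 0" "cpoly_eval (($) x) f = 0" "c \<noteq> 0" "gradient f x = c *s chart_vector i z"
      by blast
    have P: "vec_class x \<in> hypersurface f"
      using x(1,2) unfolding hypersurface_def proj_space_def
      by (auto simp: proj_class_def cpoly_eval_scale_arg[OF f])
    have "dual_map f (vec_class x) = vec_class (chart_vector i z)"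
    proof
      show "dual_map f (vec_class x) \<subseteq> vec_class (chart_vector i z)"
        unfolding dual_map_def proj_class_def using x(3)
        by (auto simp: gradient_scale_arg[OF f] x(4))
      show "vec_class (chart_vector i z) \<subseteq> dual_map f (vec_class x)"
      proof
        fix u assume "u \<in> vec_class (chart_vector i z)"
        then obtain b where b: "u = b *s chart_vector i z" "b \<noteq> 0" unfolding proj_class_def by blast
        then have "u = (b / c) *s gradient f x" using x(3,4) by (simp add: vec_eq_iff)
        then have "u \<in> vec_class (gradient f x)"
          using b(2) x(3) unfolding proj_class_def by (intro CollectI exI[of _ "b / c"]) simp
        moreover have "x \<in> vec_class x"
          unfolding proj_class_def by (intro CollectI exI[of _ 1]) simp
        ultimately show "u \<in> dual_map f (vec_class x)"
          unfolding dual_map_def by blast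
      qed
    qed
    then show ?l unfolding dual_hypersurface_def chart using P by blast
  qed
qed

section \<open>The Gauss map in local coordinates\<close>

definition slice :: "'n \<Rightarrow> complex^('n::finite option) \<Rightarrow> complex^('n option)" where
  "slice i w = (\<chi> k. if k = Some i then 1 else w $ k)"

definition slice_dir :: "'n \<Rightarrow> complex^('n::finite option) \<Rightarrow> complex^('n option)" where
  "slice_dir i u = (\<chi> k. if k = Some i then 0 else u $ k)"

lemma slice_has_derivative: "(slice i has_derivative slice_dir i) (at w)"
  unfolding slice_def[abs_def] slice_dir_def[abs_def]
proof (rule has_derivative_vec_lambda)
  show "((\<lambda>w. if k = Some i then 1 else w $ k) has_derivative (\<lambda>u. if k = Some i then 0 else u $ k)) (at w)" for k
    by (cases "k = Some i") (simp_all add: has_derivative_vec_nth)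
qed

lemma slice_dir_scale: "slice_dir i (c *s u) = c *s slice_dir i u"
  by (simp add: slice_dir_def vec_eq_iff)

lemma has_derivative_smult:
  assumes "(a has_derivative a') (at p)" "(b has_derivative b') (at p)"
  shows "((\<lambda>p. a p *s b p :: complex^'m::finite) has_derivative (\<lambda>q. a p *s b' q + a' q *s b p)) (at p)"
proof -
  have "((\<lambda>p. \<chi> k. a p * b p $ k) has_derivative (\<lambda>q. \<chi> k. a p * b' q $ k + a' q * b p $ k)) (at p)"
    by (intro has_derivative_vec_lambda has_derivative_mult assms
        bounded_linear.has_derivative[OF bounded_linear_vec_nth])
  moreover have "(\<lambda>p. \<chi> k. a p * b p $ k) = (\<lambda>p. a p *s b p)"
    "(\<lambda>q. \<chi> k. a p * b' q $ k + a' q * b p $ k) = (\<lambda>q. a p *s b' q + a' q *s b p)"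
    by (auto simp: vec_eq_iff)
  ultimately show ?thesis by simp
qed

text \<open>A point \<open>w\<close> stands for the point \<open>slice i w\<close> of an affine chart together with the
  factor \<open>w $ Some i\<close> relating its gradient to the hyperplane with chart coordinates \<open>z\<close>.\<close>

definition gauss_equation ::
  "'n::finite option cpoly \<Rightarrow> 'n option \<Rightarrow> 'n \<Rightarrow> (complex^'n) \<times> (complex^('n option)) \<Rightarrow> complex^('n option)" where
  "gauss_equation f i0 i p = gradient f (slice i (snd p)) - snd p $ Some i *s chart_vector i0 (fst p)"

definition gauss_equation_deriv ::
  "'n::finite option cpoly \<Rightarrow> 'n option \<Rightarrow> 'n \<Rightarrow> (complex^'n) \<times> (complex^('n option)) \<Rightarrow>
    (complex^'n) \<times> (complex^('n option)) \<Rightarrow> complex^('n option)" where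
  "gauss_equation_deriv f i0 i p q = hessian f (slice i (snd p)) *v slice_dir i (snd q) -
    (snd p $ Some i *s chart_direction i0 (fst q) + snd q $ Some i *s chart_vector i0 (fst p))"

lemma gauss_equation_has_derivative:
  "(gauss_equation f i0 i has_derivative gauss_equation_deriv f i0 i p) (at p)"
  unfolding gauss_equation_def[abs_def] gauss_equation_deriv_def[abs_def]
proof (intro has_derivative_diff has_derivative_smult)
  have s: "((\<lambda>p. slice i (snd p)) has_derivative (\<lambda>q. slice_dir i (snd q))) (at p)"
    by (rule has_derivative_compose[OF has_derivative_snd[OF has_derivative_ident] slice_has_derivative])
  show "((\<lambda>p. gradient f (slice i (snd p))) has_derivative (\<lambda>q. hessian f (slice i (snd p)) *v slice_dir i (snd q))) (at p)"
    by (rule has_derivative_compose[OF s gradient_has_derivative])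
  show "((\<lambda>p. snd p $ Some i) has_derivative (\<lambda>q. snd q $ Some i)) (at p)"
    by (rule has_derivative_compose[OF has_derivative_snd[OF has_derivative_ident] has_derivative_vec_nth])
  show "((\<lambda>p. chart_vector i0 (fst p)) has_derivative (\<lambda>q. chart_direction i0 (fst q))) (at p)"
    by (rule has_derivative_compose[OF has_derivative_fst[OF has_derivative_ident] chart_vector_has_derivative])
qed

lemma continuous_on_slice: "continuous_on S (slice i)"
  by (intro continuous_at_imp_continuous_on ballI has_derivative_continuous[OF slice_has_derivative])

lemma continuous_on_chart_vector: "continuous_on S (chart_vector i)"
  by (intro continuous_at_imp_continuous_on ballI has_derivative_continuous[OF chart_vector_has_derivative])

lemma continuous_on_smult:
  fixes b :: "'a::topological_space \<Rightarrow> complex^'m::finite"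
  assumes "continuous_on S a" "continuous_on S b"
  shows "continuous_on S (\<lambda>x. a x *s b x)"
  unfolding vector_scalar_mult_def
  by (intro continuous_on_vec_lambda continuous_on_mult bounded_linear.continuous_on[OF bounded_linear_vec_nth] assms)

lemma gauss_equation_deriv_continuous: "continuous_on UNIV (\<lambda>p. gauss_equation_deriv f i0 i p q)"
proof -
  have h: "continuous_on UNIV (\<lambda>p :: (complex^'a) \<times> (complex^('a option)). hessian f (slice i (snd p)) $ k $ l)" for k l
    by (rule continuous_on_compose2[OF continuous_on_hessian[of UNIV]])
       (auto intro!: continuous_on_compose2[OF continuous_on_slice[of UNIV]] continuous_intros)
  have c: "continuous_on UNIV (\<lambda>p :: (complex^'a) \<times> (complex^('a option)). chart_vector i0 (fst p))"
    by (rule continuous_on_compose2[OF continuous_on_chart_vector[of UNIV]]) (auto intro!: continuous_intros)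
  show ?thesis
    unfolding gauss_equation_deriv_def matrix_vector_mult_def
    by (intro continuous_on_diff continuous_on_vec_lambda continuous_on_sum continuous_on_mult
        continuous_on_add continuous_on_smult h c continuous_intros)
qed

lemma gauss_equation_deriv_scale:
  "gauss_equation_deriv f i0 i p (c *s v, c *s u) = c *s gauss_equation_deriv f i0 i p (v, u)"
proof -
  have "A *v (c *s x) = c *s (A *v x)" for A :: "complex^('a option)^('a option)" and x
    by (simp add: vec_eq_iff matrix_vector_mult_def sum_distrib_left mult_ac)
  then show ?thesis
    by (simp add: gauss_equation_deriv_def chart_direction_scale slice_dir_scale vec_eq_iff algebra_simps)
qed

lemma smooth_gradient_nonzero:
  assumes "smooth_hypersurface f" "f \<in> forms d" "x \<noteq> 0" "cpoly_eval (($) x) f = 0"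
  shows "gradient f x \<noteq> 0"
proof -
  have "vec_class x \<in> hypersurface f"
    using assms(3,4) unfolding hypersurface_def proj_space_def
    by (auto simp: proj_class_def cpoly_eval_scale_arg[OF assms(2)])
  moreover have "x \<in> vec_class x"
    unfolding proj_class_def by (intro CollectI exI[of _ 1]) simp
  ultimately show ?thesis using assms(1) unfolding smooth_hypersurface_def by blast
qed

section \<open>Normal crossing at a nondegenerate multitangent hyperplane\<close>

locale node_hyperplane =
  fixes f :: "'n::finite option cpoly" and d :: nat and t :: "'n \<times> 'n \<Rightarrow> complex"
    and i0 :: "'n option" and z0 :: "complex^'n"
  assumes form: "f \<in> forms d" and d2: "d \<ge> 2" and smooth: "smooth_hypersurface f"
    and tangent: "tangency f t = 0" and jac: "tangency_jacobian f t \<noteq> 0"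
    and indep: "\<And>y. span_point t y = 0 \<Longrightarrow> y = (\<lambda>_. 0)"
    and only: "\<And>y. extra_tangency f t y \<Longrightarrow> card {i. y i \<noteq> 0} < 2"
    and H: "\<And>i. dot (chart_vector i0 z0) (point t i) = 0"
begin

abbreviation "\<xi> \<equiv> chart_vector i0"

text \<open>The ratio between the gradient at the node and the hyperplane vector; it is read off at
  \<open>i0\<close>, where the latter has entry 1.\<close>

definition factor :: "'n \<Rightarrow> complex" where
  "factor i = gradient f (point t i) $ i0"

text \<open>The solution of \<open>gauss_equation\<close> over \<open>z0\<close> from which branch
  \<open>i\<close> starts.\<close>

definition node_param :: "'n \<Rightarrow> complex^('n option)" where
  "node_param i = (\<chi> k. if k = Some i then factor i else point t i $ k)"

lemma point_self [simp]: "point t i $ Some i = 1"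
  by (simp add: point_def)

lemma slice_node_param: "slice i (node_param i) = point t i"
  by (simp add: slice_def node_param_def vec_eq_iff)

lemma node_param_self: "node_param i $ Some i = factor i"
  by (simp add: node_param_def)

lemma point_ne: "point t i \<noteq> 0"
  using point_self[of i] by (metis zero_index zero_neq_one)

lemma euler: "dot (gradient f x) x = of_nat d * cpoly_eval (($) x) f"
  using euler_gradient[OF form] by (simp add: dot_def)

lemma dot_gradient_point: "dot (gradient f (point t i)) (point t j) = 0"
proof -
  have "tangency f t $ (i, j) = 0" using tangent by simp
  then show ?thesis by (simp add: tangency_def)
qed

lemma spanning: "dot (\<xi> z0) x = 0 \<Longrightarrow> \<exists>y. x = span_point t y"
  using spanning_hyperplane(1)[of "point t" "\<xi> z0" i0 x] indep H by (simp add: span_point_def)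

lemma gradient_point: "gradient f (point t i) = factor i *s \<xi> z0"
  using spanning_hyperplane(2)[of "point t" "\<xi> z0" i0 "gradient f (point t i)"] indep H dot_gradient_point
  by (simp add: span_point_def factor_def)

lemma factor_ne: "factor i \<noteq> 0"
proof
  assume "factor i = 0"
  then have "gradient f (point t i) = 0" by (simp add: gradient_point)
  moreover have "cpoly_eval (($) (point t i)) f = 0"
    using euler[of "point t i"] dot_gradient_point d2 by simp
  ultimately show False using smooth_gradient_nonzero[OF smooth form point_ne] by blast
qed

text \<open>The bordered Hessian is injective: by symmetry and Euler's formula \<open>x\<close> lies
  in the hyperplane, and moving the point \<open>i\<close> alone in direction \<open>x\<close> then
  preserves all tangency conditions to first order. This contradicts the Jacobian unless
  \<open>x = 0\<close>.\<close>

lemma hessian_radical: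
  assumes "hessian f (point t i) *v x = c *s \<xi> z0" "x $ Some i = 0"
  shows "x = 0 \<and> c = 0"
proof -
  have "dot (hessian f (point t i) *v x) (point t i) = 0"
    unfolding assms(1) by (simp add: dot_simps H)
  then have "of_nat (d - 1) * (factor i * dot x (\<xi> z0)) = 0"
    unfolding dot_hessian euler_hessian[OF form] gradient_point by (simp add: dot_simps)
  then have xH: "dot (\<xi> z0) x = 0"
    using factor_ne d2 by (simp add: dot_commute)
  \<comment> \<open>As in \<open>point\<close>, the diagonal slot \<open>(i, i)\<close> stores the
    coordinate \<open>None\<close>; the coordinate \<open>Some i\<close> of \<open>x\<close> is 0 by
    assumption.\<close>
  define \<delta> :: "complex^('n \<times> 'n)" where
    "\<delta> = (\<chi> r. if fst r = i then (if snd r = i then x $ None else x $ Some (snd r)) else 0)"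
  have \<delta>: "point_deriv (($) \<delta>) j = (if j = i then x else 0)" for j
    using assms(2) by (auto simp: point_deriv_def \<delta>_def vec_eq_iff split: option.splits)
  have "tangency_deriv f t \<delta> = 0"
    unfolding tangency_deriv_def vec_eq_iff
  proof (intro allI)
    fix r :: "'n \<times> 'n"
    have "dot (hessian f (point t (fst r)) *v point_deriv (($) \<delta>) (fst r)) (point t (snd r)) = 0"
      by (cases "fst r = i") (simp_all add: \<delta> assms(1) dot_simps H)
    moreover have "dot (gradient f (point t (fst r))) (point_deriv (($) \<delta>) (snd r)) = 0"
      by (simp add: \<delta> gradient_point dot_simps xH)
    ultimately show "(\<chi> r. dot (hessian f (point t (fst r)) *v point_deriv (($) \<delta>) (fst r)) (point t (snd r)) +
      dot (gradient f (point t (fst r))) (point_deriv (($) \<delta>) (snd r))) $ r = 0 $ r"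
      by simp
  qed
  then have "\<delta> = 0" using jac unfolding tangency_jacobian_kernel by blast
  then have "x = point_deriv (($) (0 :: complex^('n \<times> 'n))) i" using \<delta>[of i] by simp
  also have "\<dots> = 0" by (auto simp: point_deriv_def vec_eq_iff split: option.splits)
  finally have "x = 0" .
  moreover have "(c *s \<xi> z0) $ i0 = 0"
    using assms(1) \<open>x = 0\<close> by (metis matrix_vector_mult_0_right zero_index)
  ultimately show ?thesis by simp
qed

definition tangent_at :: "complex^'n \<Rightarrow> complex^('n option) \<Rightarrow> bool" where
  "tangent_at z x \<longleftrightarrow> x \<noteq> 0 \<and> cpoly_eval (($) x) f = 0 \<and> (\<exists>c. c \<noteq> 0 \<and> gradient f x = c *s \<xi> z)"

lemma dual_iff: "affine_chart i0 z \<in> dual_hypersurface f \<longleftrightarrow> (\<exists>x. tangent_at z x)"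
  unfolding dual_hypersurface_chart[OF form] tangent_at_def by blast

text \<open>For \<open>z\<close> near \<open>z0\<close> there is a point near the node with gradient
  proportional to the hyperplane \<open>z\<close>. By Euler's formula it lies on
  \<open>f = 0\<close> if and only if it lies on this hyperplane, so \<open>h\<close> is their
  pairing.\<close>

lemma branch:
  "\<exists>U V h l. open U \<and> z0 \<in> U \<and> open V \<and> (z0, node_param i) \<in> V \<and>
    multi_holomorphic_on h U \<and> h z0 = 0 \<and> has_complex_deriv h l z0 \<and>
    (\<forall>v. l v = of_nat d / of_nat (d - 1) * dot (chart_direction i0 v) (point t i)) \<and>
    (\<forall>z\<in>U. h z = 0 \<longrightarrow> affine_chart i0 z \<in> dual_hypersurface f) \<and>
    (\<forall>z\<in>U. \<forall>w. (z, w) \<in> V \<longrightarrow> gauss_equation f i0 i (z, w) = 0 \<longrightarrow> dot (\<xi> z) (slice i w) = 0 \<longrightarrow> h z = 0)"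
proof -
  let ?F = "gauss_equation f i0 i"
  let ?F' = "gauss_equation_deriv f i0 i"
  have F0: "?F (z0, node_param i) = 0"
    by (simp add: gauss_equation_def slice_node_param node_param_self gradient_point)
  have inj: "u = 0" if "?F' (z0, node_param i) (0, u) = 0" for u
  proof -
    have "chart_direction i0 0 = 0"
      by (auto simp: chart_direction_def vec_eq_iff split: option.splits)
    then have "hessian f (point t i) *v slice_dir i u = u $ Some i *s \<xi> z0"
      using that by (simp add: gauss_equation_deriv_def slice_node_param)
    then have "slice_dir i u = 0 \<and> u $ Some i = 0"
      by (rule hessian_radical) (simp add: slice_dir_def)
    then show ?thesis by (simp add: slice_dir_def vec_eq_iff) metis
  qed
  obtain U V \<omega> \<omega>' where io: "open U" "z0 \<in> U" "open V" "(z0, node_param i) \<in> V" "\<omega> z0 = node_param i"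
    "\<And>z w. (z, w) \<in> V \<Longrightarrow> ?F (z, w) = 0 \<Longrightarrow> w = \<omega> z"
    "\<And>z. z \<in> U \<Longrightarrow> ?F (z, \<omega> z) = 0"
    "\<And>z. z \<in> U \<Longrightarrow> (\<omega> has_derivative \<omega>' z) (at z)"
    "\<And>z c v. z \<in> U \<Longrightarrow> \<omega>' z (c *s v) = c *s \<omega>' z v"
    "\<And>z v. z \<in> U \<Longrightarrow> ?F' (z, \<omega> z) (v, \<omega>' z v) = 0"
  proof (rule holomorphic_implicit_function[OF gauss_equation_has_derivative
        gauss_equation_deriv_continuous gauss_equation_deriv_scale F0 inj])
    fix U V \<omega> \<omega>'
    assume a: "open U" "z0 \<in> U" "open V" "(z0, node_param i) \<in> V" "\<omega> z0 = node_param i"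
      "\<And>z w. (z, w) \<in> V \<Longrightarrow> ?F (z, w) = 0 \<Longrightarrow> w = \<omega> z"
      "\<And>z. z \<in> U \<Longrightarrow> ?F (z, \<omega> z) = 0"
      "\<And>z. z \<in> U \<Longrightarrow> (\<omega> has_derivative \<omega>' z) (at z)"
      "\<And>z c v. z \<in> U \<Longrightarrow> \<omega>' z (c *s v) = c *s \<omega>' z v"
      "\<And>z v. z \<in> U \<Longrightarrow> ?F' (z, \<omega> z) (v, \<omega>' z v) = 0"
    show thesis by (rule that) (fact a)+
  qed
  define h where "h z = dot (\<xi> z) (slice i (\<omega> z))" for z
  define D where "D z v = dot (chart_direction i0 v) (slice i (\<omega> z)) + dot (\<xi> z) (slice_dir i (\<omega>' z v))" for z v
  have hD: "has_complex_deriv h (D z) z" if "z \<in> U" for z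
    unfolding has_complex_deriv_def
  proof (intro conjI allI)
    show "(h has_derivative D z) (at z)"
      unfolding h_def[abs_def] D_def[abs_def]
      by (intro has_derivative_dot chart_vector_has_derivative
          has_derivative_compose[OF io(8)[OF that] slice_has_derivative])
    show "D z (c *s v) = c * D z v" for c v
      unfolding D_def io(9)[OF that] chart_direction_scale slice_dir_scale by (simp add: dot_simps distrib_left)
  qed
  have l: "D z0 v = of_nat d / of_nat (d - 1) * dot (chart_direction i0 v) (point t i)" for v
  proof -
    let ?u = "\<omega>' z0 v"
    have "?F' (z0, node_param i) (v, ?u) = 0"
      using io(10)[OF io(2), of v] io(5) by simp
    then have "hessian f (point t i) *v slice_dir i ?u =
        factor i *s chart_direction i0 v + ?u $ Some i *s \<xi> z0"
      by (simp add: gauss_equation_deriv_def slice_node_param node_param_self)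
    \<comment> \<open>Pairing with the node removes the term along the hyperplane vector. By
      symmetry and Euler's formula, the motion of the point then contributes
      \<open>1 / (d - 1)\<close> times the motion of the hyperplane, in total
      \<open>d / (d - 1)\<close>.\<close>
    then have "dot (hessian f (point t i) *v slice_dir i ?u) (point t i) =
        factor i * dot (chart_direction i0 v) (point t i)"
      by (simp add: dot_simps H)
    then have "factor i * (of_nat (d - 1) * dot (\<xi> z0) (slice_dir i ?u)) =
        factor i * dot (chart_direction i0 v) (point t i)"
      unfolding dot_hessian euler_hessian[OF form] gradient_point by (simp add: dot_simps dot_commute mult_ac)
    then have *: "of_nat (d - 1) * dot (\<xi> z0) (slice_dir i ?u) = dot (chart_direction i0 v) (point t i)"
      using factor_ne by simp
    have "(of_nat (d - 1) :: complex) \<noteq> 0" using d2 by simp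
    moreover have "of_nat d = of_nat (d - 1) + (1 :: complex)" using d2 by (simp add: of_nat_diff)
    ultimately show ?thesis
      unfolding D_def io(5) slice_node_param *[symmetric] by (simp add: field_simps)
  qed
  show ?thesis
  proof (rule exI[of _ U], rule exI[of _ V], rule exI[of _ h], rule exI[of _ "D z0"], intro conjI ballI allI impI)
    show "open U" "z0 \<in> U" "open V" "(z0, node_param i) \<in> V" by fact+
    show "multi_holomorphic_on h U"
      unfolding multi_holomorphic_on_def using io(1) hD by blast
    show "h z0 = 0" by (simp add: h_def io(5) slice_node_param H)
    show "has_complex_deriv h (D z0) z0" by (rule hD[OF io(2)])
    show "D z0 v = of_nat d / of_nat (d - 1) * dot (chart_direction i0 v) (point t i)" for v by (rule l)
    show "h z = 0" if "(z, w) \<in> V" "?F (z, w) = 0" "dot (\<xi> z) (slice i w) = 0" for z w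
      using io(6)[OF that(1,2)] that(3) by (simp add: h_def)
    show "affine_chart i0 z \<in> dual_hypersurface f" if z: "z \<in> U" "h z = 0" for z
    proof -
      let ?x = "slice i (\<omega> z)" and ?c = "\<omega> z $ Some i"
      have g: "gradient f ?x = ?c *s \<xi> z"
        using io(7)[OF z(1)] by (simp add: gauss_equation_def)
      have "?x $ Some i = 1" by (simp add: slice_def)
      then have x: "?x \<noteq> 0" by (metis zero_index zero_neq_one)
      have "of_nat d * cpoly_eval (($) ?x) f = 0"
        using z(2) unfolding euler[symmetric] g by (simp add: dot_simps h_def)
      then have fx: "cpoly_eval (($) ?x) f = 0" using d2 by simp
      have "?c \<noteq> 0"
        using smooth_gradient_nonzero[OF smooth form x fx] g by auto
      then show ?thesis
        unfolding dual_iff tangent_at_def using x fx g by blast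
    qed
  qed
qed

text \<open>The unknown \<open>w\<close> of \<open>gauss_equation\<close> belonging to a tangency
  point \<open>x\<close>, independent of its scaling; meaningful only for
  \<open>x $ Some i \<noteq> 0\<close>.\<close>

definition tangent_param :: "'n \<Rightarrow> complex^('n option) \<Rightarrow> complex^('n option)" where
  "tangent_param i x = (\<chi> k. if k = Some i then gradient f ((1 / x $ Some i) *s x) $ i0 else x $ k / x $ Some i)"

lemma slice_tangent_param: "x $ Some i \<noteq> 0 \<Longrightarrow> slice i (tangent_param i x) = (1 / x $ Some i) *s x"
  by (simp add: slice_def tangent_param_def vec_eq_iff)

lemma tangent_param_scale:
  assumes "c \<noteq> 0" shows "tangent_param i (c *s x) = tangent_param i x"
proof -
  have "(1 / (c *s x) $ Some i) *s (c *s x) = (1 / x $ Some i) *s x"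
    using assms by (simp add: vec_eq_iff)
  then show ?thesis
    using assms by (simp add: tangent_param_def vec_eq_iff del: vector_smult_assoc)
qed

lemma tangent_at_scale:
  assumes "tangent_at z x" "c \<noteq> 0"
  shows "tangent_at z (c *s x)"
proof -
  obtain b where b: "b \<noteq> 0" "gradient f x = b *s \<xi> z" "x \<noteq> 0" "cpoly_eval (($) x) f = 0"
    using assms(1) unfolding tangent_at_def by blast
  have "gradient f (c *s x) = (c ^ (d - 1) * b) *s \<xi> z"
    by (simp add: gradient_scale_arg[OF form] b(2))
  moreover have "c ^ (d - 1) * b \<noteq> 0" using assms(2) b(1) by simp
  moreover have "c *s x \<noteq> 0" using assms(2) b(3) by (simp add: vec_eq_iff)
  moreover have "cpoly_eval (($) (c *s x)) f = 0" by (simp add: cpoly_eval_scale_arg[OF form] b(4))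
  ultimately show ?thesis unfolding tangent_at_def by blast
qed

lemma tangent_param_equation:
  assumes "tangent_at z x" "x $ Some i \<noteq> 0"
  shows "gauss_equation f i0 i (z, tangent_param i x) = 0" "dot (\<xi> z) (slice i (tangent_param i x)) = 0"
proof -
  let ?y = "(1 / x $ Some i) *s x"
  have "tangent_at z ?y" using assms by (intro tangent_at_scale) auto
  then obtain c where c: "c \<noteq> 0" "gradient f ?y = c *s \<xi> z" "cpoly_eval (($) ?y) f = 0"
    unfolding tangent_at_def by blast
  then have "gradient f ?y $ i0 = c" by simp
  then have "tangent_param i x $ Some i = c" by (simp add: tangent_param_def)
  then show "gauss_equation f i0 i (z, tangent_param i x) = 0"
    using c(2) by (simp add: gauss_equation_def slice_tangent_param[OF assms(2)])
  have "c * dot (\<xi> z) ?y = 0"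
    using euler[of ?y] c(2,3) by (simp add: dot_simps)
  then show "dot (\<xi> z) (slice i (tangent_param i x)) = 0"
    using c(1) by (simp add: slice_tangent_param[OF assms(2)])
qed

text \<open>Euler's formula puts \<open>x\<close> on the hyperplane, hence in the span of the nodes,
  where \<open>only\<close> leaves a single nonzero coordinate. So \<open>x\<close> is a multiple of
  a node.\<close>

lemma tangent_at_z0:
  assumes "tangent_at z0 x"
  shows "\<exists>i. x $ Some i \<noteq> 0 \<and> tangent_param i x = node_param i"
proof -
  obtain c where c: "c \<noteq> 0" "gradient f x = c *s \<xi> z0" "x \<noteq> 0" "cpoly_eval (($) x) f = 0"
    using assms unfolding tangent_at_def by blast
  have "c * dot (\<xi> z0) x = 0"
    using euler[of x] c(2,4) by (simp add: dot_simps)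
  then obtain y where y: "x = span_point t y" using spanning c(1) by auto
  have "extra_tangency f t y"
    unfolding extra_tangency_def y[symmetric] c(2) by (simp add: dot_simps H)
  then have card: "card {i. y i \<noteq> 0} < 2" by (rule only)
  obtain i where i: "y i \<noteq> 0"
    using c(3) y by (force simp: span_point_def)
  have yj: "y j = 0" if "j \<noteq> i" for j
  proof (rule ccontr)
    assume "y j \<noteq> 0"
    then have "{i, j} \<subseteq> {i. y i \<noteq> 0}" using i by blast
    then have "card {i, j} \<le> card {i. y i \<noteq> 0}" by (intro card_mono) auto
    then show False using card that by simp
  qed
  have x: "x = y i *s point t i"
    unfolding y span_point_def by (subst sum.remove[of _ i]) (auto simp: yj intro: sum.neutral)
  then have "x $ Some i = y i" by simp
  moreover have "tangent_param i x = tangent_param i (point t i)"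
    unfolding x by (rule tangent_param_scale[OF i])
  moreover have "tangent_param i (point t i) = node_param i"
    unfolding vec_eq_iff by (simp add: tangent_param_def node_param_def factor_def)
  ultimately show ?thesis using i by metis
qed

text \<open>Compactness of the unit sphere: unit tangency points that avoid all \<open>V i\<close>
  over hyperplanes tending to \<open>z0\<close> would accumulate at a tangency point over
  \<open>z0\<close>, hence at a multiple of a node.\<close>

lemma tangent_points_near_nodes:
  assumes V: "\<And>i. open (V i)" "\<And>i. (z0, node_param i) \<in> V i"
  shows "\<exists>W. open W \<and> z0 \<in> W \<and>
    (\<forall>z\<in>W. \<forall>x. tangent_at z x \<longrightarrow> (\<exists>i. x $ Some i \<noteq> 0 \<and> (z, tangent_param i x) \<in> V i))"
proof (rule ccontr)
  assume *: "\<not> ?thesis"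
  have "\<exists>z x. dist z z0 < inverse (real (Suc m)) \<and> tangent_at z x \<and> norm x = 1 \<and>
      (\<forall>i. x $ Some i \<noteq> 0 \<longrightarrow> (z, tangent_param i x) \<notin> V i)" for m
  proof -
    have "open (ball z0 (inverse (real (Suc m))))" "z0 \<in> ball z0 (inverse (real (Suc m)))" by auto
    then obtain z x where z: "z \<in> ball z0 (inverse (real (Suc m)))" "tangent_at z x"
      "\<forall>i. x $ Some i \<noteq> 0 \<longrightarrow> (z, tangent_param i x) \<notin> V i"
      using * by blast
    have x: "norm x \<noteq> 0" using z(2) by (simp add: tangent_at_def)
    let ?c = "complex_of_real (1 / norm x)"
    have c: "?c \<noteq> 0" using x by simp
    have "(?c *s x) $ k = ((1 / norm x) *\<^sub>R x) $ k" for k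
      unfolding vector_smult_component vector_scaleR_component by (rule scaleR_conv_of_real[symmetric])
    then have "?c *s x = (1 / norm x) *\<^sub>R x"
      unfolding vec_eq_iff by blast
    then have "norm (?c *s x) = 1" using x by simp
    moreover have "tangent_at z (?c *s x)" by (rule tangent_at_scale[OF z(2) c])
    moreover have "\<forall>i. (?c *s x) $ Some i \<noteq> 0 \<longrightarrow> (z, tangent_param i (?c *s x)) \<notin> V i"
      unfolding tangent_param_scale[OF c] using z(3) by simp
    moreover have "dist z z0 < inverse (real (Suc m))" using z(1) by (simp add: dist_commute)
    ultimately show ?thesis by blast
  qed
  then obtain z x where zx: "\<And>m. dist (z m) z0 < inverse (real (Suc m))" "\<And>m. tangent_at (z m) (x m)"
    "\<And>m. norm (x m) = 1" "\<And>m i. x m $ Some i \<noteq> 0 \<Longrightarrow> (z m, tangent_param i (x m)) \<notin> V i"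
    by metis
  have zlim: "z \<longlonglongrightarrow> z0"
    using zx(1) by (intro metric_tendsto_imp_tendsto[OF LIMSEQ_inverse_real_of_nat]) 
      (auto intro!: always_eventually less_imp_le)
  have "bounded (range x)" unfolding bounded_iff using zx(3) by (intro exI[of _ 1]) auto
  then obtain a \<rho> where \<rho>: "strict_mono \<rho>" "(x \<circ> \<rho>) \<longlonglongrightarrow> a"
    using bounded_imp_convergent_subsequence by blast
  have zl: "(\<lambda>m. z (\<rho> m)) \<longlonglongrightarrow> z0"
    using LIMSEQ_subseq_LIMSEQ[OF zlim \<rho>(1)] by (simp add: o_def)
  have xl: "(\<lambda>m. x (\<rho> m)) \<longlonglongrightarrow> a" using \<rho>(2) by (simp add: o_def)
  have "(\<lambda>m. norm (x (\<rho> m))) \<longlonglongrightarrow> norm a" by (rule tendsto_norm[OF xl])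
  then have "norm a = 1" by (simp add: zx(3) LIMSEQ_const_iff)
  then have a0: "a \<noteq> 0" by auto
  have "(\<lambda>m. cpoly_eval (($) (x (\<rho> m))) f) \<longlonglongrightarrow> cpoly_eval (($) a) f"
    by (rule continuous_on_tendsto_compose[OF continuous_on_cpoly_eval[of UNIV] xl]) simp_all
  moreover have "cpoly_eval (($) (x m)) f = 0" for m using zx(2) by (simp add: tangent_at_def)
  ultimately have fa: "cpoly_eval (($) a) f = 0" by (simp add: LIMSEQ_const_iff)
  have gl: "(\<lambda>m. gradient f (x (\<rho> m))) \<longlonglongrightarrow> gradient f a"
    by (rule continuous_on_tendsto_compose[OF continuous_on_gradient[of UNIV] xl]) simp_all
  have \<xi>l: "(\<lambda>m. \<xi> (z (\<rho> m))) \<longlonglongrightarrow> \<xi> z0"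
    by (rule continuous_on_tendsto_compose[OF continuous_on_chart_vector[of UNIV] zl]) simp_all
  \<comment> \<open>The unknown factor is replaced by the entry \<open>i0\<close> of the gradient,
    so that proportionality becomes a closed condition.\<close>
  have g: "gradient f (x m) $ k = gradient f (x m) $ i0 * \<xi> (z m) $ k" for m k
  proof -
    obtain c where "gradient f (x m) = c *s \<xi> (z m)" using zx(2)[of m] unfolding tangent_at_def by blast
    then show ?thesis by simp
  qed
  have "gradient f a $ k = gradient f a $ i0 * \<xi> z0 $ k" for k
  proof (rule LIMSEQ_unique)
    show "(\<lambda>m. gradient f (x (\<rho> m)) $ k) \<longlonglongrightarrow> gradient f a $ k"
      by (intro tendsto_vec_nth gl)
    show "(\<lambda>m. gradient f (x (\<rho> m)) $ k) \<longlonglongrightarrow> gradient f a $ i0 * \<xi> z0 $ k"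
      unfolding g[of _ k] by (intro tendsto_mult tendsto_vec_nth gl \<xi>l)
  qed
  then have ga: "gradient f a = gradient f a $ i0 *s \<xi> z0"
    unfolding vec_eq_iff vector_smult_component by (rule allI)
  \<comment> \<open>Smoothness keeps the factor from tending to 0.\<close>
  have gne: "gradient f a \<noteq> 0" by (rule smooth_gradient_nonzero[OF smooth form a0 fa])
  have "gradient f a $ i0 \<noteq> 0"
  proof
    assume 0: "gradient f a $ i0 = 0"
    have "gradient f a = 0 *s \<xi> z0" using ga unfolding 0 .
    then show False using gne by simp
  qed
  then have "tangent_at z0 a" unfolding tangent_at_def using a0 fa ga by blast
  then obtain i where i: "a $ Some i \<noteq> 0" "tangent_param i a = node_param i"
    using tangent_at_z0 by blast
  have xi: "(\<lambda>m. x (\<rho> m) $ Some i) \<longlonglongrightarrow> a $ Some i" by (rule tendsto_vec_nth[OF xl])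
  have sc: "(\<lambda>m. (1 / x (\<rho> m) $ Some i) *s x (\<rho> m)) \<longlonglongrightarrow> (1 / a $ Some i) *s a"
    unfolding vector_scalar_mult_def
    by (intro tendsto_vec_lambda tendsto_mult tendsto_divide tendsto_const xi i tendsto_vec_nth xl)
  have "(\<lambda>m. tangent_param i (x (\<rho> m))) \<longlonglongrightarrow> tangent_param i a"
    unfolding tangent_param_def
  proof (rule tendsto_vec_lambda)
    fix k
    have "(\<lambda>m. gradient f ((1 / x (\<rho> m) $ Some i) *s x (\<rho> m)) $ i0) \<longlonglongrightarrow> gradient f ((1 / a $ Some i) *s a) $ i0"
      by (intro tendsto_vec_nth continuous_on_tendsto_compose[OF continuous_on_gradient[of UNIV] sc]) simp_all
    moreover have "(\<lambda>m. x (\<rho> m) $ k / x (\<rho> m) $ Some i) \<longlonglongrightarrow> a $ k / a $ Some i"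
      by (intro tendsto_divide tendsto_vec_nth xl i)
    ultimately show "(\<lambda>m. if k = Some i then gradient f ((1 / x (\<rho> m) $ Some i) *s x (\<rho> m)) $ i0
        else x (\<rho> m) $ k / x (\<rho> m) $ Some i) \<longlonglongrightarrow>
      (if k = Some i then gradient f ((1 / a $ Some i) *s a) $ i0 else a $ k / a $ Some i)"
      by (cases "k = Some i") simp_all
  qed
  then have "(\<lambda>m. (z (\<rho> m), tangent_param i (x (\<rho> m)))) \<longlonglongrightarrow> (z0, node_param i)"
    using zl i(2) by (intro tendsto_Pair) simp_all
  then have "\<forall>\<^sub>F m in sequentially. (z (\<rho> m), tangent_param i (x (\<rho> m))) \<in> V i"
    by (rule topological_tendstoD[OF _ V])
  moreover have "\<forall>\<^sub>F m in sequentially. x (\<rho> m) $ Some i \<noteq> 0"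
    by (rule tendsto_imp_eventually_ne[OF xi i(1)])
  ultimately have "\<forall>\<^sub>F m in sequentially. False"
    by eventually_elim (use zx(4) in blast)
  then show False by simp
qed

text \<open>Chart directions reach every coordinate except \<open>i0\<close>, so the combination of
  the nodes can only have the entry \<open>i0\<close>. This entry vanishes as well, because the
  combination lies on the hyperplane \<open>z0\<close>, whose coefficient at \<open>i0\<close> is
  1.\<close>

lemma independent_directions:
  assumes "\<And>v. (\<Sum>i\<in>UNIV. y i * dot (chart_direction i0 v) (point t i)) = 0"
  shows "y = (\<lambda>_. 0)"
proof (rule indep)
  let ?s = "span_point t y"
  have dot_s: "dot a ?s = (\<Sum>i\<in>UNIV. y i * dot a (point t i))" for a
    unfolding span_point_def by (simp add: dot_sum dot_simps)
  have "?s $ k = 0" if "k \<noteq> i0" for k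
  proof -
    from chart_direction_axis[OF that] obtain v where "chart_direction i0 v = axis k 1" by (elim exE)
    then show ?thesis using dot_s[of "axis k 1"] assms[of v] by (simp add: dot_axis)
  qed
  then have "dot (\<xi> z0) ?s = \<xi> z0 $ i0 * ?s $ i0"
    unfolding dot_def by (subst sum.remove[of _ i0]) (auto intro: sum.neutral)
  then have "?s $ i0 = 0" using dot_s[of "\<xi> z0"] H by simp
  then show "?s = 0"
    using \<open>\<And>k. k \<noteq> i0 \<Longrightarrow> ?s $ k = 0\<close> by (metis vec_eq_iff zero_index)
qed

lemma normal_crossing:
  "\<exists>Q\<in>dual_hypersurface f. normal_crossing_at CARD('n) (dual_hypersurface f) Q"
proof -
  let ?\<kappa> = "of_nat d / of_nat (d - 1) :: complex"
  have \<kappa>: "?\<kappa> \<noteq> 0" using d2 by simp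
  define P where "P i U V h l \<longleftrightarrow> open U \<and> z0 \<in> U \<and> open V \<and> (z0, node_param i) \<in> V \<and>
    multi_holomorphic_on h U \<and> h z0 = 0 \<and> has_complex_deriv h l z0 \<and>
    (\<forall>v. l v = ?\<kappa> * dot (chart_direction i0 v) (point t i)) \<and>
    (\<forall>z\<in>U. h z = 0 \<longrightarrow> affine_chart i0 z \<in> dual_hypersurface f) \<and>
    (\<forall>z\<in>U. \<forall>w. (z, w) \<in> V \<longrightarrow> gauss_equation f i0 i (z, w) = 0 \<longrightarrow> dot (\<xi> z) (slice i w) = 0 \<longrightarrow> h z = 0)"
    for i U V h l
  have "\<forall>i. \<exists>U V h l. P i U V h l" unfolding P_def using branch by blast
  then obtain U V h l where P: "\<And>i. P i (U i) (V i) (h i) (l i)" by metis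
  have oU: "open (U i)" and zU: "z0 \<in> U i" and oV: "open (V i)" and zV: "(z0, node_param i) \<in> V i"
    and hol: "multi_holomorphic_on (h i) (U i)" and h0: "h i z0 = 0" and hl: "has_complex_deriv (h i) (l i) z0"
    and l: "l i v = ?\<kappa> * dot (chart_direction i0 v) (point t i)"
    and dual: "z \<in> U i \<Longrightarrow> h i z = 0 \<Longrightarrow> affine_chart i0 z \<in> dual_hypersurface f"
    and conv: "z \<in> U i \<Longrightarrow> (z, w) \<in> V i \<Longrightarrow> gauss_equation f i0 i (z, w) = 0 \<Longrightarrow>
      dot (\<xi> z) (slice i w) = 0 \<Longrightarrow> h i z = 0" for i z v w
    using P[of i] unfolding P_def by blast+
  obtain W0 where W0: "open W0" "z0 \<in> W0"
    "\<And>z x. z \<in> W0 \<Longrightarrow> tangent_at z x \<Longrightarrow> \<exists>i. x $ Some i \<noteq> 0 \<and> (z, tangent_param i x) \<in> V i"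
    using tangent_points_near_nodes[OF oV zV] by blast
  \<comment> \<open>Over \<open>W0\<close> every tangency point has its parameters in some
    \<open>V i\<close>, where uniqueness of the implicit function puts \<open>z\<close> on branch
    \<open>i\<close>. The sets \<open>U i\<close> keep all branches defined.\<close>
  define W where "W = W0 \<inter> (\<Inter>i. U i)"
  have W: "open W" "z0 \<in> W" "\<And>i. W \<subseteq> U i"
    unfolding W_def using W0 oU zU by (auto intro!: open_Int open_INT)
  \<comment> \<open>Branches are indexed by \<open>'n\<close>, but
    \<open>normal_crossing_germ\<close> numbers them by naturals.\<close>
  obtain e :: "nat \<Rightarrow> 'n" where e: "bij_betw e {..<CARD('n)} UNIV"
    using ex_bij_betw_nat_finite[OF finite_class.finite_UNIV] by (auto simp: lessThan_atLeast0)
  have indep_l: "independent_forms CARD('n) (\<lambda>k. l (e k))"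
    unfolding independent_forms_def
  proof (intro allI impI)
    fix c :: "nat \<Rightarrow> complex" and k
    assume c: "\<forall>v. (\<Sum>k<CARD('n). c k * l (e k) v) = 0" and k: "k < CARD('n)"
    define y where "y i = c (inv_into {..<CARD('n)} e i)" for i
    have "(\<Sum>i\<in>UNIV. y i * dot (chart_direction i0 v) (point t i)) = 0" for v
    proof -
      have "?\<kappa> * (\<Sum>i\<in>UNIV. y i * dot (chart_direction i0 v) (point t i)) = (\<Sum>i\<in>UNIV. y i * l i v)"
        by (simp add: l sum_distrib_left mult_ac)
      also have "\<dots> = (\<Sum>k<CARD('n). y (e k) * l (e k) v)"
        by (rule sum.reindex_bij_betw[OF e, symmetric])
      also have "\<dots> = (\<Sum>k<CARD('n). c k * l (e k) v)"
        by (rule sum.cong) (simp_all add: y_def bij_betw_inv_into_left[OF e])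
      also have "\<dots> = 0" using c by blast
      finally show ?thesis using \<kappa> by simp
    qed
    then have "y = (\<lambda>_. 0)" by (rule independent_directions)
    then have "y (e k) = 0" by simp
    then show "c k = 0" using k by (simp add: y_def bij_betw_inv_into_left[OF e])
  qed
  have lne: "\<exists>v. l i v \<noteq> 0" for i
  proof (rule ccontr)
    assume "\<not> ?thesis"
    then have z: "dot (chart_direction i0 v) (point t i) = 0" for v using l[of i v] \<kappa> by simp
    have "(\<Sum>j\<in>UNIV. (if j = i then 1 else 0) * dot (chart_direction i0 v) (point t j)) = 0" for v
      using z by (simp add: if_distrib[of "\<lambda>x. x * _"] cong: if_cong)
    then have "(\<lambda>j. if j = i then 1 else 0) = (\<lambda>_. 0 :: complex)" by (rule independent_directions)
    then show False by (metis zero_neq_one)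
  qed
  define B where "B k = {z \<in> W. h (e k) z = 0}" for k
  have br: "smooth_branch W z0 (B k) (l (e k))" for k
    unfolding smooth_branch_def
  proof (intro exI[of _ "h (e k)"] conjI)
    show "multi_holomorphic_on (h (e k)) W"
      using hol[of "e k"] W(1) W(3)[of "e k"] unfolding multi_holomorphic_on_def by blast
  qed (use h0 hl lne in \<open>auto simp: B_def\<close>)
  have "affine_chart i0 -` dual_hypersurface f \<inter> W = (\<Union>k<CARD('n). B k)"
  proof (intro equalityI subsetI)
    fix z assume z: "z \<in> affine_chart i0 -` dual_hypersurface f \<inter> W"
    then obtain x where x: "tangent_at z x" using dual_iff by auto
    obtain i where i: "x $ Some i \<noteq> 0" "(z, tangent_param i x) \<in> V i"
      using W0(3)[OF _ x] z unfolding W_def by blast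
    have "h i z = 0"
      by (rule conv[OF _ i(2) tangent_param_equation[OF x i(1)]]) (use z W(3) in blast)
    moreover have "i \<in> e ` {..<CARD('n)}" using e by (simp add: bij_betw_def)
    then obtain k where "k < CARD('n)" "e k = i" by auto
    ultimately show "z \<in> (\<Union>k<CARD('n). B k)" using z by (auto simp: B_def)
  next
    fix z assume "z \<in> (\<Union>k<CARD('n). B k)"
    then show "z \<in> affine_chart i0 -` dual_hypersurface f \<inter> W"
      using dual W(3) by (auto simp: B_def)
  qed
  then have "normal_crossing_germ CARD('n) (affine_chart i0 -` dual_hypersurface f) z0"
    unfolding normal_crossing_germ_def using W br indep_l
    by (intro exI[of _ W] exI[of _ B] exI[of _ "\<lambda>k. l (e k)"]) simp
  then have "normal_crossing_at CARD('n) (dual_hypersurface f) (affine_chart i0 z0)"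
    unfolding normal_crossing_at_def by blast
  moreover have "affine_chart i0 z0 \<in> dual_hypersurface f"
    using dual[OF zU h0] .
  ultimately show ?thesis by blast
qed

end

lemma node_hyperplane_chart:
  fixes f :: "'n::finite option cpoly" and t :: "'n \<times> 'n \<Rightarrow> complex"
  assumes "f \<in> forms d" "d \<ge> 1" "smooth_hypersurface f" "tangency f t = 0"
  shows "\<exists>i0 z0. \<forall>i. dot (chart_vector i0 z0) (point t i) = 0"
proof -
  \<comment> \<open>Any node serves, since its tangent hyperplane contains all of them.\<close>
  let ?x = "point t undefined"
  have dot0: "dot (gradient f ?x) (point t i) = 0" for i
  proof -
    have "tangency f t $ (undefined, i) = 0" using assms(4) by simp
    then show ?thesis by (simp add: tangency_def)
  qed
  have "?x $ Some undefined = 1" by (simp add: point_def)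
  then have x: "?x \<noteq> 0" by (metis zero_index zero_neq_one)
  have "of_nat d * cpoly_eval (($) ?x) f = 0"
    using dot0[of undefined] euler_gradient[OF assms(1), of ?x] by (simp add: dot_def)
  then have "gradient f ?x \<noteq> 0"
    using assms(2) by (intro smooth_gradient_nonzero[OF assms(3,1) x]) simp
  then obtain i0 where i0: "gradient f ?x $ i0 \<noteq> 0" by (auto simp: vec_eq_iff)
  let ?H = "(1 / gradient f ?x $ i0) *s gradient f ?x"
  obtain z0 where "chart_vector i0 z0 = ?H"
    using chart_vector_surj[of ?H i0] i0 by auto
  then show ?thesis
    using dot0 by (intro exI[of _ i0] exI[of _ z0]) (simp add: dot_simps)
qed

section \<open>Genericity\<close>

definition has_normal_crossing :: "'n::finite option cpoly \<Rightarrow> bool" where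
  "has_normal_crossing f \<longleftrightarrow> smooth_hypersurface f \<and>
    (\<exists>Q\<in>dual_hypersurface f. normal_crossing_at CARD('n) (dual_hypersurface f) Q)"

lemma thin_no_normal_crossing:
  assumes n: "CARD('n::finite) \<ge> 3" and d: "d \<ge> 3"
  shows "thin (monoms d) {c. \<not> has_normal_crossing (form_of d c :: 'n option cpoly)}"
proof -
  obtain B where B: "thin (monoms d) B" "\<And>c. c \<notin> B \<Longrightarrow>
    \<exists>t :: 'n \<times> 'n \<Rightarrow> complex. tangency (form_of d c) t = 0 \<and> tangency_minor d t \<noteq> 0 \<and>
      tangency_jacobian (form_of d c) t \<noteq> 0"
    using generic_multitangent_hyperplane[OF n d] by blast
  define S where "S = {c. \<not> smooth_hypersurface (form_of d c :: 'n option cpoly)}"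
  define X where "X = {c. \<exists>(t :: 'n \<times> 'n \<Rightarrow> complex) y. tangency_minor d t \<noteq> 0 \<and> tangency (form_of d c) t = 0 \<and>
    extra_tangency (form_of d c) t y \<and> card {i. y i \<noteq> 0} \<ge> 2}"
  have "thin (monoms d) S" unfolding S_def by (rule thin_singular_forms) (use d in simp)
  moreover have "thin (monoms d) X" unfolding X_def by (rule thin_extra_tangency[OF n d])
  ultimately have thin: "thin (monoms d) (B \<union> S \<union> X)" using B(1) by (intro thin_Un)
  have "{c. \<not> has_normal_crossing (form_of d c :: 'n option cpoly)} \<subseteq> B \<union> S \<union> X"
  proof (rule subsetI, rule ccontr)
    fix c assume c: "c \<in> {c. \<not> has_normal_crossing (form_of d c :: 'n option cpoly)}" "c \<notin> B \<union> S \<union> X"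
    let ?f = "form_of d c :: 'n option cpoly"
    obtain t :: "'n \<times> 'n \<Rightarrow> complex" where t: "tangency ?f t = 0" "tangency_minor d t \<noteq> 0" "tangency_jacobian ?f t \<noteq> 0"
      using B(2) c(2) by blast
    have sm: "smooth_hypersurface ?f" using c(2) unfolding S_def by blast
    obtain i0 z0 where H: "\<forall>i. dot (chart_vector i0 z0) (point t i) = 0"
      using node_hyperplane_chart[OF form_of_in_forms _ sm t(1)] d by auto
    interpret node_hyperplane ?f d t i0 z0
    proof
      show "card {i. y i \<noteq> 0} < 2" if "extra_tangency ?f t y" for y
        using c(2) that t(1,2) unfolding X_def by (metis (mono_tags, lifting) UnI2 mem_Collect_eq not_less)
      show "y = (\<lambda>_. 0)" if "span_point t y = 0" for y
        using points_independent[OF t(2), of y] that by (simp add: span_point_def)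
    qed (use d form_of_in_forms sm t H in auto)
    have "has_normal_crossing ?f"
      unfolding has_normal_crossing_def using sm normal_crossing by blast
    then show False using c(1) by blast
  qed
  with thin show ?thesis by (rule thin_subset)
qed

section \<open>From coefficient vectors to projective classes and the Zariski topology\<close>

lemma cpoly_eval_cpoly_scale: "cpoly_eval a (cpoly_scale c f) = c * cpoly_eval a f"
proof -
  have "keys (cpoly_scale c f) \<subseteq> keys f"
    by (auto simp: in_keys_iff)
  then have "cpoly_eval a (cpoly_scale c f) = (\<Sum>m\<in>keys f. lookup (cpoly_scale c f) m * monom_eval a m)"
    by (intro cpoly_eval_superset) auto
  then show ?thesis by (simp add: cpoly_eval_def sum_distrib_left mult.assoc)
qed

lemma gradient_cpoly_scale: "gradient (cpoly_scale c f) x = c *s gradient f x"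
proof -
  have "partial_deriv k (cpoly_scale c f) = cpoly_scale c (partial_deriv k f)" for k
    by (rule poly_mapping_eqI) (simp only: lookup_partial_deriv lookup_cpoly_scale mult.left_commute)
  then show ?thesis by (simp add: gradient_def cpoly_eval_cpoly_scale vec_eq_iff)
qed

lemma vec_class_scale:
  assumes "c \<noteq> 0" shows "vec_class (c *s v) = vec_class v"
proof (intro equalityI subsetI)
  fix u assume "u \<in> vec_class (c *s v)"
  then obtain b where "u = b *s (c *s v)" "b \<noteq> 0" unfolding proj_class_def by blast
  then show "u \<in> vec_class v"
    using assms unfolding proj_class_def by (intro CollectI exI[of _ "b * c"]) simp
next
  fix u assume "u \<in> vec_class v"
  then obtain b where "u = b *s v" "b \<noteq> 0" unfolding proj_class_def by blast
  then show "u \<in> vec_class (c *s v)"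
    using assms unfolding proj_class_def by (intro CollectI exI[of _ "b / c"]) simp
qed

lemma has_normal_crossing_scale:
  assumes "c \<noteq> 0"
  shows "has_normal_crossing (cpoly_scale c f) \<longleftrightarrow> has_normal_crossing f"
proof -
  have h: "hypersurface (cpoly_scale c f) = hypersurface f"
    using assms by (simp add: hypersurface_def cpoly_eval_cpoly_scale)
  have "smooth_hypersurface (cpoly_scale c f) \<longleftrightarrow> smooth_hypersurface f"
    using assms by (simp add: smooth_hypersurface_def h gradient_cpoly_scale)
  moreover have "dual_hypersurface (cpoly_scale c f) = dual_hypersurface f"
    using assms by (simp add: dual_hypersurface_def h dual_map_def gradient_cpoly_scale vec_class_scale)
  ultimately show ?thesis by (simp add: has_normal_crossing_def)
qed

text \<open>The polynomial that defines a thin set may be inhomogeneous, while Zariski closed sets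
  are cut out by homogeneous ones; its components supply these.\<close>

definition homogeneous_component :: "nat \<Rightarrow> 'v cpoly \<Rightarrow> 'v cpoly" where
  "homogeneous_component e p = (\<Sum>m\<in>{m \<in> keys p. monom_degree m = e}. single m (lookup p m))"

lemma homogeneous_homogeneous_component: "homogeneous e (homogeneous_component e p)"
  unfolding homogeneous_component_def
  by (intro homogeneous_sum) (auto simp flip: homogeneous_single intro: homogeneous_single)

lemma cpoly_eval_homogeneous_components:
  "cpoly_eval a p = (\<Sum>e\<in>monom_degree ` keys p. cpoly_eval a (homogeneous_component e p))"
proof -
  have "(\<Sum>e\<in>monom_degree ` keys p. cpoly_eval a (homogeneous_component e p)) =
    (\<Sum>e\<in>monom_degree ` keys p. \<Sum>m\<in>{m \<in> keys p. monom_degree m = e}.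
      lookup p m * monom_eval a m)"
    by (simp add: homogeneous_component_def cpoly_eval_sum)
  also have "\<dots> = (\<Sum>m\<in>keys p. lookup p m * monom_eval a m)"
    by (rule sum.group) auto
  finally show ?thesis by (simp add: cpoly_eval_def)
qed

text \<open>As a function of \<open>c\<close>, the value at \<open>c * a\<close> is a polynomial
  whose coefficients are the components at \<open>a\<close>.\<close>

lemma ex_scale_nonzero:
  assumes "cpoly_eval a (homogeneous_component e p) \<noteq> 0"
  shows "\<exists>c. c \<noteq> 0 \<and> cpoly_eval (\<lambda>v. c * a v) p \<noteq> 0"
proof -
  let ?D = "monom_degree ` keys p"
  define q where "q = (\<Sum>e\<in>?D. monom (cpoly_eval a (homogeneous_component e p)) e)"
  have q: "poly q c = cpoly_eval (\<lambda>v. c * a v) p" for c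
    by (subst cpoly_eval_homogeneous_components)
       (simp add: q_def poly_sum poly_monom mult.commute cpoly_eval_homogeneous_scale[OF homogeneous_homogeneous_component])
  have "e \<in> ?D"
  proof (rule ccontr)
    assume "e \<notin> ?D"
    then have "{m \<in> keys p. monom_degree m = e} = {}" by blast
    then have "homogeneous_component e p = 0" unfolding homogeneous_component_def by (simp only: sum.empty)
    then show False using assms by simp
  qed
  then have "coeff q e = cpoly_eval a (homogeneous_component e p)"
    by (simp add: q_def coeff_sum if_distrib cong: if_cong)
  then have "q \<noteq> 0" using assms by auto
  then have "finite ({c. poly q c = 0} \<union> {0})" using poly_roots_finite by simp
  then obtain c where "c \<notin> {c. poly q c = 0} \<union> {0}"
    using ex_new_if_finite[OF infinite_UNIV_char_0] by blast
  then show ?thesis using q by auto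
qed

lemma proj_class_refl: "f \<in> proj_class cpoly_scale f"
  unfolding proj_class_def by (intro CollectI exI[of _ 1] conjI poly_mapping_eqI) simp_all

text \<open>A nonempty open set contains a class on which some equation \<open>G\<close> of its
  complement is nonzero. \<open>F\<close> and \<open>G\<close> are then nonzero at a common form, by
  the line argument.\<close>

lemma zariski_dense_of_nonzero:
  fixes p :: "('v::finite \<Rightarrow>\<^sub>0 nat) cpoly"
  assumes F: "F \<in> pol (monoms d)" "F x \<noteq> 0" "\<And>y. F y = cpoly_eval y p"
  defines "U \<equiv> proj_forms d - zero_locus d (range (\<lambda>e. homogeneous_component e p))"
  shows "openin (zariski_topology d) U" "zariski_topology d closure_of U = topspace (zariski_topology d)"
proof -
  show "openin (zariski_topology d) U"
    unfolding openin_zariski_topology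
  proof
    show "U \<subseteq> proj_forms d" by (auto simp: U_def)
    have "proj_forms d - U = zero_locus d (range (\<lambda>e. homogeneous_component e p))"
      by (auto simp: U_def zero_locus_def)
    then show "zariski_closed d (proj_forms d - U)"
      unfolding zariski_closed_def
      by (intro exI[of _ "range (\<lambda>e. homogeneous_component e p)"]) (auto intro: homogeneous_homogeneous_component)
  qed
  have "U \<inter> T \<noteq> {}" if T: "openin (zariski_topology d) T" "T \<noteq> {}" for T
  proof -
    obtain I where I: "proj_forms d - T = zero_locus d I" and TP: "T \<subseteq> proj_forms d"
      using T(1) unfolding openin_zariski_topology zariski_closed_def by blast
    obtain P where P: "P \<in> T" using T(2) by blast
    then have "P \<notin> zero_locus d I" "P \<in> proj_forms d" using I TP by blast+
    then obtain G f where G: "G \<in> I" "f \<in> P" "cpoly_eval (lookup f) G \<noteq> 0"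
      unfolding zero_locus_def by blast
    obtain g where g: "g \<in> forms d" "g \<noteq> 0" "P = proj_class cpoly_scale g"
      using \<open>P \<in> proj_forms d\<close> unfolding proj_space_def by blast
    obtain c where fc: "f = cpoly_scale c g" using G(2) g(3) unfolding proj_class_def by blast
    have f: "f \<in> forms d"
      using keys_form[OF g(1)] by (intro formsI) (auto simp: fc in_keys_iff)
    \<comment> \<open>\<open>G\<close> may contain variables for monomials of other degrees. Passing
      through \<open>form_of\<close> sets these to 0.\<close>
    let ?r = "\<lambda>x. lookup (form_of d x :: 'v cpoly)"
    have r: "(\<lambda>x. ?r x m) \<in> pol UNIV" for m
      by (cases "m \<in> monoms d") (auto simp: lookup_form_of intro: pol_var)
    have F': "(\<lambda>x. F (?r x)) \<in> pol UNIV"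
      by (rule pol_compose[OF F(1) r])
    have "F (?r x) = F x" by (rule pol_cong[OF F(1)]) (simp add: lookup_form_of)
    then have Fx: "F (?r x) \<noteq> 0" using F(2) by simp
    have "(\<lambda>x. cpoly_eval x G) \<in> pol UNIV"
      unfolding cpoly_eval_def monom_eval_def by (intro pol_sum pol_mult pol_const pol_prod pol_power pol_var UNIV_I)
    then have G': "(\<lambda>x. cpoly_eval (?r x) G) \<in> pol UNIV"
      by (rule pol_compose[OF _ r])
    have Gf: "cpoly_eval (?r (lookup f)) G \<noteq> 0" using G(3) by (simp add: form_of_lookup[OF f])
    \<comment> \<open>Keeping this coefficient nonzero ensures that the common form is nonzero and
      has a projective class.\<close>
    obtain m where m: "lookup g m \<noteq> 0" using g(2) by (metis lookup_zero poly_mapping_eqI)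
    have gm: "?r (lookup g) m \<noteq> 0" using m by (simp add: form_of_lookup[OF g(1)])
    obtain z1 where z1: "F (?r z1) * cpoly_eval (?r z1) G \<noteq> 0"
      using pol_common_nonzero[OF F' Fx G' Gf] by auto
    obtain z where z: "F (?r z) * cpoly_eval (?r z) G \<noteq> 0" "?r z m \<noteq> 0"
      using pol_common_nonzero[OF pol_mult[OF F' G'] z1 r gm] by auto
    let ?f = "form_of d z :: 'v cpoly"
    let ?P = "proj_class cpoly_scale ?f"
    have "?f \<noteq> 0" using z(2) by auto
    then have Pf: "?P \<in> proj_forms d"
      unfolding proj_space_def using form_of_in_forms by blast
    have "?P \<notin> zero_locus d I"
      using z(1) G(1) proj_class_refl unfolding zero_locus_def by fastforce
    then have "?P \<in> T" using Pf I by blast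
    moreover have "?P \<in> U"
    proof -
      have "cpoly_eval (lookup ?f) p \<noteq> 0" using z(1) F(3) by simp
      then have "(\<Sum>e\<in>monom_degree ` keys p. cpoly_eval (lookup ?f) (homogeneous_component e p)) \<noteq> 0"
        by (subst (asm) cpoly_eval_homogeneous_components)
      then obtain e where "cpoly_eval (lookup ?f) (homogeneous_component e p) \<noteq> 0"
        by (rule sum.not_neutral_contains_not_neutral)
      then have "?P \<notin> zero_locus d (range (\<lambda>e. homogeneous_component e p))"
        using proj_class_refl unfolding zero_locus_def by blast
      then show ?thesis unfolding U_def using Pf by blast
    qed
    ultimately show ?thesis by blast
  qed
  then show "zariski_topology d closure_of U = topspace (zariski_topology d)"
    unfolding dense_intersects_open by blast
qed

theorem theorem1p2:
  fixes n d :: nat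
  assumes "n = CARD('n::finite)" and "n \<ge> 3" and "d \<ge> 3"
  shows "\<exists>U :: 'n option cpoly set set.
           openin (zariski_topology d) U \<and>
           zariski_topology d closure_of U = topspace (zariski_topology d) \<and>
           (\<forall>P\<in>U. \<forall>f\<in>P. smooth_hypersurface f \<and>
              (\<exists>Q\<in>dual_hypersurface f. normal_crossing_at n (dual_hypersurface f) Q))"
proof -
  have "thin (monoms d) {c. \<not> has_normal_crossing (form_of d c :: 'n option cpoly)}"
    using assms by (intro thin_no_normal_crossing) auto
  then obtain F x where F: "F \<in> pol (monoms d)" "F x \<noteq> 0"
    "\<And>c. F c \<noteq> 0 \<Longrightarrow> has_normal_crossing (form_of d c :: 'n option cpoly)"
    unfolding thin_def by blast
  obtain p where p: "\<And>y. F y = cpoly_eval y p" using pol_imp_cpoly[OF F(1)] by blast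
  define U where "U = proj_forms d - zero_locus d (range (\<lambda>e. homogeneous_component e p))"
  have "smooth_hypersurface f \<and> (\<exists>Q\<in>dual_hypersurface f. normal_crossing_at n (dual_hypersurface f) Q)"
    if P: "P \<in> U" and f: "f \<in> P" for P f
  proof -
    obtain g where g: "g \<in> forms d" "P = proj_class cpoly_scale g"
      using P unfolding U_def proj_space_def by blast
    obtain c where c: "f = cpoly_scale c g" "c \<noteq> 0" using f g(2) unfolding proj_class_def by blast
    obtain e f1 where f1: "f1 \<in> P" "cpoly_eval (lookup f1) (homogeneous_component e p) \<noteq> 0"
      using P unfolding U_def zero_locus_def by blast
    obtain c1 where c1: "f1 = cpoly_scale c1 g" using f1(1) g(2) unfolding proj_class_def by blast
    have "lookup f1 = (\<lambda>m. c1 * lookup g m)" by (auto simp: c1)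
    then have "cpoly_eval (lookup g) (homogeneous_component e p) \<noteq> 0"
      using f1(2) by (simp add: cpoly_eval_homogeneous_scale[OF homogeneous_homogeneous_component])
    \<comment> \<open>\<open>F\<close> may vanish at \<open>g\<close> itself, but not at some
      nonzero multiple, which has the same dual hypersurface.\<close>
    then obtain b where b: "b \<noteq> 0" "F (\<lambda>m. b * lookup g m) \<noteq> 0"
      using ex_scale_nonzero p by metis
    have "form_of d (\<lambda>m. b * lookup g m) = cpoly_scale b (form_of d (lookup g))"
      by (rule poly_mapping_eqI) (simp add: lookup_form_of)
    then have "has_normal_crossing (cpoly_scale b g)"
      using F(3)[OF b(2)] by (simp add: form_of_lookup[OF g(1)])
    then have "has_normal_crossing f"
      unfolding c(1) using b(1) c(2) by (simp add: has_normal_crossing_scale)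
    then show ?thesis unfolding has_normal_crossing_def assms(1) .
  qed
  then show ?thesis
    using zariski_dense_of_nonzero[OF F(1,2) p] unfolding U_def[symmetric]
    by (intro exI[of _ U]) blast
qed

end
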